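(* Let $m\ge 2$ be an integer, let $U\subset\mathbb{R}\times\mathbb{R}^n$ be open, and let $f(t,x;\tau,\xi)$ be a polynomial of degree $m+1$ in $(\tau,\xi)\in\mathbb{R}\times\mathbb{R}^n$ whose coefficients are analytic functions of $(t,x)\in U$. Write $f=\sum_{l=0}^{m+1}f_l$, where $f_l$ is the part of $f$ that is homogeneous of degree $l$ in $(\tau,\xi)$. Let $\psi(x)$ be an analytic function and let $\Sigma=\{(t,x)\in U;\ t=\psi(x)\}$. Assume that there is a nonzero constant $a$ such that, for all $x$ with $(\psi(x),x)\in U$, $$0\ne 1-|\nabla\psi(x)|^2=\frac{(-m+1)^m a^m}{m^{m-1}}\, f_{m+1}\bigl(\psi(x),x;-1,\nabla\psi(x)\bigr)$$ and $$f_m\bigl(\psi(x),x;-1,\nabla\psi(x)\bigr)=0.$$ Then there exist an open neighborhood $\Omega$ of $\Sigma$ and an analytic solution $u(t,x)$ of $$u_{tt}-\Delta u=f(t,x;\partial_t u,\nabla u)$$ in $\Omega\cap\{t>\psi(x)\}$ such that $$u(t,x)\sim a\bigl(t-\psi(x)\bigr)^{(m-1)/m},\qquad \partial_t u(t,x)\sim a\,\frac{m-1}{m}\bigl(t-\psi(x)\bigr)^{-1/m}$$ as $t-\psi(x)\to +0$ (so $u$ vanishes and $\partial_t u$ blows up on $\Sigma$). Moreover, this solution $u(t,x)$ is analytic in $\bigl((t-\psi(x))^{1/m},x\bigr)$, with no logarithm involved.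
   Context: Points of $\mathbb{R}\times\mathbb{R}^n$ are written $(t,x)$ with $x=(x_1,\dots,x_n)$. $\nabla$ and $\Delta$ denote the gradient and the Laplacian with respect to $x$. All functions are real-valued, "analytic" means real-analytic, and constants are real. The function $\psi$ is analytic on an open subset of $\mathbb{R}^n$ over which the hypersurface $\Sigma$ is a graph, and the neighborhood $\Omega\subset U$ of $\Sigma$ is taken to lie over the domain of $\psi$. The notation $g\sim h$ as $t-\psi(x)\to+0$ means $g/h\to 1$ as $(t,x)$ in $\{t>\psi(x)\}$ approaches a point of $\Sigma$. "Analytic in $((t-\psi(x))^{1/m},x)$" means that $u(t,x)=F\bigl((t-\psi(x))^{1/m},x\bigr)$ for a function $F(s,x)$ that is analytic in a neighborhood of $\{(0,x);\ (\psi(x),x)\in\Sigma\}$. *)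

theory Defs
  imports "HOL-Analysis.Analysis" "HOL-Library.Landau_Symbols"
begin

text \<open>Multi-indices are indexed by the canonical basis, so that the same notion serves
  \<^typ>\<open>real ^ 'n\<close> and \<^typ>\<open>real \<times> (real ^ 'n)\<close>.\<close>

definition multi_indices :: "('a::euclidean_space \<Rightarrow> nat) set" where
  "multi_indices = Basis \<rightarrow>\<^sub>E UNIV"

definition mi_order :: "('a::euclidean_space \<Rightarrow> nat) \<Rightarrow> nat" where
  "mi_order \<alpha> = (\<Sum>b\<in>Basis. \<alpha> b)"

definition mi_power :: "'a::euclidean_space \<Rightarrow> ('a \<Rightarrow> nat) \<Rightarrow> real" where
  "mi_power z \<alpha> = (\<Prod>b\<in>Basis. (z \<bullet> b) ^ \<alpha> b)"

text \<open>Real-analyticity in several variables: near every point the function is the sum of an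
  (absolutely) convergent power series in the coordinates.\<close>

definition real_analytic_on :: "('a::euclidean_space \<Rightarrow> real) \<Rightarrow> 'a set \<Rightarrow> bool" where
  "real_analytic_on g S \<longleftrightarrow>
     (\<forall>p\<in>S. \<exists>C. \<exists>r>0. \<forall>z\<in>ball p r.
        ((\<lambda>\<alpha>. C \<alpha> * mi_power (z - p) \<alpha>) has_sum g z) multi_indices)"

definition partial :: "'n \<Rightarrow> (real ^ 'n \<Rightarrow> real) \<Rightarrow> real ^ 'n \<Rightarrow> real" where
  "partial i g x = deriv (\<lambda>h. g (x + h *\<^sub>R axis i 1)) 0"

definition grad :: "(real ^ 'n \<Rightarrow> real) \<Rightarrow> real ^ 'n \<Rightarrow> real ^ 'n" where
  "grad g x = (\<chi> i. partial i g x)"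

definition laplacian :: "(real ^ 'n \<Rightarrow> real) \<Rightarrow> real ^ 'n \<Rightarrow> real" where
  "laplacian g x = (\<Sum>i\<in>UNIV. partial i (partial i g) x)"

text \<open>With \<^term>\<open>c \<alpha> p\<close> the coefficient at the base point \<open>p\<close> of the monomial with exponent
  \<open>\<alpha>\<close>, \<open>hom_part c l p\<close> is the part of degree \<open>l\<close> of the polynomial with coefficients \<open>c\<close>.\<close>

definition hom_part ::
    "(('b::euclidean_space \<Rightarrow> nat) \<Rightarrow> 'a \<Rightarrow> real) \<Rightarrow> nat \<Rightarrow> 'a \<Rightarrow> 'b \<Rightarrow> real" where
  "hom_part c l p \<zeta> = (\<Sum>\<alpha> | \<alpha> \<in> multi_indices \<and> mi_order \<alpha> = l. c \<alpha> p * mi_power \<zeta> \<alpha>)"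

definition above :: "(real ^ 'n \<Rightarrow> real) \<Rightarrow> (real \<times> (real ^ 'n)) set \<Rightarrow> (real \<times> (real ^ 'n)) set" where
  "above \<psi> \<Omega> = {(t, x). (t, x) \<in> \<Omega> \<and> t > \<psi> x}"

end

theory Submission
  imports Defs
begin

text \<open>Let \<open>s\<close> be the \<open>m\<close>-th root of \<open>t - \<psi> x\<close> and look for a solution of the form
\<open>u = s\<^sup>m\<^sup>-\<^sup>1 (a + Y(s, x))\<close> with \<open>Y = 0\<close> on \<open>s = 0\<close>. Put \<open>g0 = a (m - 1) / m\<close> and
\<open>m \<Gamma> = (m - 1) Y + s \<partial>\<^sub>s Y\<close>. Then \<open>\<partial>\<^sub>t u = (g0 + \<Gamma>) / s\<close>, and the wave equation, multiplied by
\<open>s\<^sup>m\<^sup>+\<^sup>1\<close>, becomes a polynomial equation in \<open>\<Gamma>\<close>, \<open>s \<partial>\<^sub>s \<Gamma>\<close>, \<open>s\<^sup>m \<partial>\<^sub>i \<Gamma>\<close>, \<open>s\<^sup>m \<partial>\<^sub>i Y\<close> and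
\<open>s\<^sup>2\<^sup>m \<partial>\<^sub>i\<^sup>2 Y\<close> whose coefficients are analytic in \<open>(s, x)\<close>. With \<open>A = 1 - |\<nabla>\<psi>|\<^sup>2\<close>, the wave operator
contributes \<open>(A / m) (s \<partial>\<^sub>s \<Gamma> - \<Gamma> - g0)\<close>, and at \<open>s = 0\<close> the right hand side is the top degree part, which
is \<open>- (A / (m g0\<^sup>m)) (g0 + \<Gamma>)\<^sup>m\<^sup>+\<^sup>1\<close> by the hypothesis that relates \<open>a\<close> to the coefficients. So the constants
cancel, and the linear part of the equation is \<open>(A / m) (s \<partial>\<^sub>s + m) \<Gamma>\<close>. On \<open>s\<^sup>k\<close> the operator \<open>s \<partial>\<^sub>s + m\<close>
is multiplication by \<open>k + m > 0\<close>: each power of \<open>s\<close> determines the next coefficient, without free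
parameters and without a logarithm.\<close>

text \<open>Convergence comes from a contraction. Power series are normed by \<open>\<Sum>\<alpha>. (\<alpha>! / |\<alpha>|!) |u \<alpha>|\<close>. This is a Banach
algebra in which inverting \<open>s \<partial>\<^sub>s\<close> pays for one derivative in \<open>x\<close>: the operator that
multiplies by a power of \<open>s\<close>, differentiates once in \<open>x\<close> and divides the coefficient of \<open>s\<^sup>k\<close> by \<open>k + m\<close> is
bounded (\<open>norm_pow_deriv_le\<close>). With the unknown \<open>h = (s \<partial>\<^sub>s + m) \<Gamma>\<close> all terms of the equation are
therefore polynomials in bounded operators. After zooming in to a point of \<open>s = 0\<close> by a factor \<open>d\<close>, the
coefficients tend to constants, the \<open>x\<close>-derivatives acquire powers of \<open>d\<close>, and the equation reads
\<open>h = T d h\<close> with a map \<open>T d\<close> that is a contraction near \<open>0\<close> for small \<open>d\<close> (\<open>cong_small_resE\<close>,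
\<open>fixed_point_problem\<close>, \<open>small_fixed_point\<close>). Its fixed points are exactly the local solutions, which gives existence
(\<open>local_solution\<close>) and uniqueness (\<open>local_uniqueness\<close>); by uniqueness the local solutions fit together
to one profile near all of \<open>s = 0\<close> (\<open>global_solution\<close>).\<close>

text \<open>Analyticity is handled through the same algebra. A function is analytic at \<open>q\<close> iff it is the evaluation of an
element of the algebra after zooming in to \<open>q\<close> (\<open>analytic_at_iff_lifts\<close>), and a convergent power series may be
applied to elements of any commutative Banach algebra. Compositions, recentering and the coefficients of the equation
are all obtained in this way.\<close>

section \<open>Multi-indices\<close>

text \<open>As a type of their own, multi-indices form a commutative monoid, and sums over them range over the whole type.\<close>

typedef (overloaded) 'a mindex = "multi_indices :: ('a::euclidean_space \<Rightarrow> nat) set"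
  morphisms expo Mindex
  by (auto simp: multi_indices_def PiE_eq_empty_iff)

lemma mindex_eqI: "(\<And>b. b \<in> Basis \<Longrightarrow> expo \<alpha> b = expo \<beta> b) \<Longrightarrow> \<alpha> = \<beta>"
  using expo[of \<alpha>] expo[of \<beta>] unfolding multi_indices_def
  by (metis PiE_ext expo_inject)

lemma expo_Mindex: "b \<in> Basis \<Longrightarrow> expo (Mindex (\<lambda>b\<in>Basis. e b)) b = e b"
  by (subst Mindex_inverse) (auto simp: multi_indices_def)

instantiation mindex :: (euclidean_space) cancel_comm_monoid_add
begin

definition zero_mindex :: "'a mindex" where
  "0 = Mindex (\<lambda>b\<in>Basis. 0)"

definition plus_mindex :: "'a mindex \<Rightarrow> 'a mindex \<Rightarrow> 'a mindex" where
  "\<alpha> + \<beta> = Mindex (\<lambda>b\<in>Basis. expo \<alpha> b + expo \<beta> b)"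

definition minus_mindex :: "'a mindex \<Rightarrow> 'a mindex \<Rightarrow> 'a mindex" where
  "\<alpha> - \<beta> = Mindex (\<lambda>b\<in>Basis. expo \<alpha> b - expo \<beta> b)"

instance
  by standard (auto intro!: mindex_eqI
      simp: zero_mindex_def plus_mindex_def minus_mindex_def expo_Mindex)

end

lemma expo_0 [simp]: "b \<in> Basis \<Longrightarrow> expo 0 b = 0"
  and expo_plus [simp]: "b \<in> Basis \<Longrightarrow> expo (\<alpha> + \<beta>) b = expo \<alpha> b + expo \<beta> b"
  and expo_minus [simp]: "b \<in> Basis \<Longrightarrow> expo (\<alpha> - \<beta>) b = expo \<alpha> b - expo \<beta> b"
  by (simp_all add: zero_mindex_def plus_mindex_def minus_mindex_def expo_Mindex)

definition unit_index :: "'a::euclidean_space \<Rightarrow> 'a mindex" where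
  "unit_index c = Mindex (\<lambda>b\<in>Basis. if b = c then 1 else 0)"

lemma expo_unit_index [simp]: "b \<in> Basis \<Longrightarrow> expo (unit_index c) b = (if b = c then 1 else 0)"
  unfolding unit_index_def by (subst expo_Mindex) auto

definition deg :: "'a::euclidean_space mindex \<Rightarrow> nat" where
  "deg \<alpha> = (\<Sum>b\<in>Basis. expo \<alpha> b)"

lemma deg_0 [simp]: "deg 0 = 0"
  and deg_plus [simp]: "deg (\<alpha> + \<beta>) = deg \<alpha> + deg \<beta>"
  by (simp_all add: deg_def sum.distrib)

lemma deg_unit_index [simp]: "b \<in> Basis \<Longrightarrow> deg (unit_index b) = 1"
  by (simp add: deg_def)

lemma deg_eq_0_iff [simp]: "deg \<alpha> = 0 \<longleftrightarrow> \<alpha> = 0"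
  by (auto simp: deg_def intro!: mindex_eqI)

lemma expo_le_deg: "b \<in> Basis \<Longrightarrow> expo \<alpha> b \<le> deg \<alpha>"
  unfolding deg_def by (rule member_le_sum) auto

lemma unit_index_decompose:
  assumes "b \<in> Basis" "expo \<alpha> b > 0"
  shows "(\<alpha> - unit_index b) + unit_index b = \<alpha>"
  using assms by (intro mindex_eqI) auto

lemma mindex_induct [case_names zero add]:
  assumes "P 0" "\<And>\<alpha> b. b \<in> Basis \<Longrightarrow> P \<alpha> \<Longrightarrow> P (\<alpha> + unit_index b)"
  shows "P \<alpha>"
proof (induction "deg \<alpha>" arbitrary: \<alpha>)
  case 0
  then show ?case using assms(1) by (metis deg_eq_0_iff)
next
  case (Suc n)
  have "deg \<alpha> \<noteq> 0" using Suc.hyps(2) by (metis nat.distinct(1))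
  then obtain b where b: "b \<in> Basis" "expo \<alpha> b > 0" unfolding deg_def by (metis gr0I sum.neutral)
  have "deg (\<alpha> - unit_index b) = n"
    using arg_cong[OF unit_index_decompose[OF b], of deg] Suc.hyps b by simp
  with Suc assms(2)[OF b(1), of "\<alpha> - unit_index b"] show ?case
    by (simp add: unit_index_decompose[OF b])
qed

text \<open>The entries of \<open>Z\<close> may lie in any commutative algebra: they are real numbers when a power series is
  evaluated, and themselves power series when it is composed.\<close>

definition mpow :: "('a::euclidean_space \<Rightarrow> 'e::comm_monoid_mult) \<Rightarrow> 'a mindex \<Rightarrow> 'e" where
  "mpow Z \<alpha> = (\<Prod>b\<in>Basis. Z b ^ expo \<alpha> b)"

lemma mpow_0 [simp]: "mpow Z 0 = 1"
  and mpow_plus: "mpow Z (\<alpha> + \<beta>) = mpow Z \<alpha> * mpow Z \<beta>"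
  by (simp_all add: mpow_def power_add prod.distrib)

lemma mpow_unit [simp]: "b \<in> Basis \<Longrightarrow> mpow Z (unit_index b) = Z b"
proof -
  assume b: "b \<in> Basis"
  have "mpow Z (unit_index b) = (\<Prod>c\<in>Basis. if c = b then Z c else 1)"
    unfolding mpow_def by (rule prod.cong) auto
  then show ?thesis using b by simp
qed

lemma mpow_mult: "mpow (\<lambda>b. Y b * Z b) \<alpha> = mpow Y \<alpha> * mpow Z \<alpha>"
  by (simp add: mpow_def power_mult_distrib prod.distrib)

lemma mpow_const: "mpow (\<lambda>_. c) \<alpha> = c ^ deg \<alpha>"
  by (simp add: mpow_def deg_def power_sum)

lemma mpow_cong: "(\<And>b. b \<in> Basis \<Longrightarrow> Y b = Z b) \<Longrightarrow> mpow Y \<alpha> = mpow Z \<alpha>"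
  by (simp add: mpow_def)

lemma norm_mpow_le:
  fixes Z :: "'a::euclidean_space \<Rightarrow> 'e::{real_normed_algebra_1, comm_monoid_mult}"
  assumes "\<And>b. b \<in> Basis \<Longrightarrow> norm (Z b) \<le> r"
  shows "norm (mpow Z \<alpha>) \<le> r ^ deg \<alpha>"
proof (induction \<alpha> rule: mindex_induct)
  case (add \<alpha> b)
  have "norm (mpow Z (\<alpha> + unit_index b)) \<le> norm (mpow Z \<alpha>) * norm (Z b)"
    using add by (simp add: mpow_plus norm_mult_ineq)
  also have "\<dots> \<le> r ^ deg \<alpha> * r"
    using add assms[OF add(1)] by (intro mult_mono) (auto intro: order_trans[OF norm_ge_zero])
  finally show ?case using add by (simp add: mult.commute)
qed simp

lemma mi_power_expo: "mi_power z (expo \<alpha>) = mpow (\<lambda>b. z \<bullet> b) \<alpha>"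
  by (simp add: mi_power_def mpow_def)

lemma bij_betw_expo: "bij_betw expo UNIV multi_indices"
  by (rule bij_betwI') (auto simp: expo_inject expo intro: Mindex_inverse[symmetric])

definition splits :: "'a::euclidean_space mindex \<Rightarrow> ('a mindex \<times> 'a mindex) set" where
  "splits \<alpha> = {(\<beta>, \<gamma>). \<beta> + \<gamma> = \<alpha>}"

lemma finite_splits [simp]: "finite (splits \<alpha>)"
proof -
  have "finite (Mindex ` (\<Pi>\<^sub>E b\<in>Basis. {..expo \<alpha> b}))" (is "finite ?F")
    by (intro finite_imageI finite_PiE) auto
  moreover have "\<beta> \<in> ?F \<and> \<gamma> \<in> ?F" if "\<beta> + \<gamma> = \<alpha>" for \<beta> \<gamma>
  proof -
    have "expo \<beta> \<in> (\<Pi>\<^sub>E b\<in>Basis. {..expo \<alpha> b})" "expo \<gamma> \<in> (\<Pi>\<^sub>E b\<in>Basis. {..expo \<alpha> b})"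
      using expo[of \<beta>] expo[of \<gamma>] that by (auto simp: multi_indices_def PiE_iff)
    then show ?thesis by (metis expo_inverse image_eqI)
  qed
  then have "splits \<alpha> \<subseteq> ?F \<times> ?F" unfolding splits_def by blast
  ultimately show ?thesis by (meson finite_SigmaI finite_subset)
qed

text \<open>Both families are absolutely summable, so the terms of the double series may be collected along \<open>\<beta> + \<gamma> = \<alpha>\<close>.\<close>

lemma has_sum_Cauchy_product:
  fixes f g :: "'a::euclidean_space mindex \<Rightarrow> real"
  assumes f: "f summable_on UNIV" and g: "g summable_on UNIV"
  shows "((\<lambda>\<alpha>. \<Sum>(\<beta>, \<gamma>)\<in>splits \<alpha>. f \<beta> * g \<gamma>) has_sum infsum f UNIV * infsum g UNIV) UNIV"
proof -
  let ?P = "\<lambda>(\<beta>, \<gamma>). f \<beta> * g \<gamma>"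
  have f': "(\<lambda>\<beta>. \<bar>f \<beta>\<bar>) summable_on UNIV" and g': "(\<lambda>\<beta>. \<bar>g \<beta>\<bar>) summable_on UNIV"
    using f g summable_on_iff_abs_summable_on_real[of f UNIV]
      summable_on_iff_abs_summable_on_real[of g UNIV] by simp_all
  have "(\<lambda>(\<beta>, \<gamma>). \<bar>f \<beta>\<bar> * \<bar>g \<gamma>\<bar>) summable_on UNIV \<times> UNIV"
    by (rule summable_on_SigmaI[where g = "\<lambda>\<beta>. \<bar>f \<beta>\<bar> * infsum (\<lambda>\<gamma>. \<bar>g \<gamma>\<bar>) UNIV"])
      (use f' g' in \<open>auto intro!: has_sum_cmult_right has_sum_infsum summable_on_cmult_left\<close>)
  then have "(\<lambda>p. norm (?P p)) summable_on UNIV \<times> UNIV"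
    by (rule summable_on_cong[THEN iffD1, rotated]) (auto simp: abs_mult)
  then have "?P summable_on UNIV \<times> UNIV" by (rule abs_summable_summable)
  then obtain S where S: "(?P has_sum S) (UNIV \<times> UNIV)" by (auto simp: summable_on_def)
  have "((\<lambda>\<beta>. f \<beta> * infsum g UNIV) has_sum S) UNIV"
    by (rule has_sum_SigmaD[OF S]) (use g in \<open>auto intro!: has_sum_cmult_right has_sum_infsum\<close>)
  moreover have "((\<lambda>\<beta>. f \<beta> * infsum g UNIV) has_sum infsum f UNIV * infsum g UNIV) UNIV"
    using f by (intro has_sum_cmult_left has_sum_infsum)
  ultimately have S_eq: "S = infsum f UNIV * infsum g UNIV" by (rule has_sum_unique)
  have "bij_betw snd (SIGMA \<alpha>:UNIV. splits \<alpha>) (UNIV \<times> UNIV)"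
    by (rule bij_betw_byWitness[where f' = "\<lambda>(\<beta>, \<gamma>). (\<beta> + \<gamma>, (\<beta>, \<gamma>))"]) (auto simp: splits_def)
  from has_sum_reindex_bij_betw[OF this, of ?P S] S
  have "((\<lambda>q. ?P (snd q)) has_sum S) (SIGMA \<alpha>:UNIV. splits \<alpha>)" by blast
  then have "((\<lambda>\<alpha>. sum ?P (splits \<alpha>)) has_sum S) UNIV"
    by (rule has_sum_Sigma') (auto intro: has_sum_finite)
  then show ?thesis by (simp add: S_eq)
qed

section \<open>Multinomial weights\<close>

text \<open>A multinomial coefficient with \<open>card B\<close> slots is one term in the expansion of a power of \<open>1 + \<dots> + 1 = card B\<close>;
each step of the induction splits off one binomial coefficient.\<close>

lemma fact_sum_le:
  assumes "finite B"
  shows "fact (\<Sum>b\<in>B. n b) \<le> real (card B) ^ (\<Sum>b\<in>B. n b) * (\<Prod>b\<in>B. fact (n b))"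
  using assms
proof (induction B rule: finite_induct)
  case (insert x B)
  let ?N = "\<Sum>b\<in>B. n b"
  have "real (n x + ?N choose ?N) * real (card B) ^ ?N \<le> (1 + real (card B)) ^ (n x + ?N)"
  proof -
    have "real (n x + ?N choose ?N) * real (card B) ^ ?N * 1 ^ (n x + ?N - ?N)
        \<le> (\<Sum>k\<le>n x + ?N. real (n x + ?N choose k) * real (card B) ^ k * 1 ^ (n x + ?N - k))"
      by (rule member_le_sum) auto
    then show ?thesis using binomial_ring[of "real (card B)" 1 "n x + ?N"] by (simp add: add.commute)
  qed
  moreover have "fact (n x + ?N) = real (n x + ?N choose ?N) * fact ?N * fact (n x)"
    by (simp add: binomial_fact)
  moreover have "real (n x + ?N choose ?N) * fact ?N * fact (n x)
      \<le> real (n x + ?N choose ?N) * (real (card B) ^ ?N * (\<Prod>b\<in>B. fact (n b))) * fact (n x)"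
    by (intro mult_right_mono mult_left_mono insert) auto
  ultimately have "fact (n x + ?N) \<le> (1 + real (card B)) ^ (n x + ?N) * (\<Prod>b\<in>B. fact (n b)) * fact (n x)"
    by (smt (verit, ccfv_SIG) fact_ge_zero mult.assoc mult_right_mono prod_nonneg)
  then show ?case using insert by (simp add: ac_simps)
qed simp

text \<open>The product of two binomial coefficients is one term of Vandermonde's convolution.\<close>

lemma prod_binomial_le:
  assumes "finite B"
  shows "(\<Prod>b\<in>B. n b + k b choose n b) \<le> ((\<Sum>b\<in>B. n b) + (\<Sum>b\<in>B. k b) choose (\<Sum>b\<in>B. n b))"
  using assms
proof (induction B rule: finite_induct)
  case (insert x B)
  let ?N = "\<Sum>b\<in>B. n b" and ?K = "\<Sum>b\<in>B. k b"
  have "(n x + k x choose n x) * (?N + ?K choose ?N)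
      = (n x + k x choose n x) * (?N + ?K choose (n x + ?N - n x))" by simp
  also have "\<dots> \<le> (\<Sum>j\<le>n x + ?N. (n x + k x choose j) * (?N + ?K choose (n x + ?N - j)))"
    by (rule member_le_sum) auto
  also have "\<dots> = (n x + k x + (?N + ?K) choose (n x + ?N))"
    by (rule vandermonde)
  finally have "(n x + k x choose n x) * (?N + ?K choose ?N) \<le> (n x + k x + (?N + ?K) choose (n x + ?N))" .
  moreover have "(n x + k x choose n x) * (\<Prod>b\<in>B. n b + k b choose n b)
      \<le> (n x + k x choose n x) * (?N + ?K choose ?N)"
    using insert by (intro mult_left_mono) auto
  ultimately have "(n x + k x choose n x) * (\<Prod>b\<in>B. n b + k b choose n b)
      \<le> (n x + k x + (?N + ?K) choose (n x + ?N))" by linarith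
  then show ?case using insert.hyps by (simp add: ac_simps)
qed simp

text \<open>The reciprocal of the multinomial coefficient of \<open>\<alpha>\<close>. It is submultiplicative, which makes the weighted series an
algebra. Raising the exponent of \<open>b\<close> by one multiplies it by \<open>(\<alpha>\<^sub>b + 1) / (|\<alpha>| + 1)\<close>, where the denominator is the same
for all directions; this is what lets a factor \<open>1 / k\<close> in one variable compensate a derivative in another.\<close>

definition wt :: "'a::euclidean_space mindex \<Rightarrow> real" where
  "wt \<alpha> = (\<Prod>b\<in>Basis. fact (expo \<alpha> b)) / fact (deg \<alpha>)"

lemma wt_pos [simp]: "wt \<alpha> > 0"
  unfolding wt_def by (intro divide_pos_pos prod_pos) auto

lemma wt_nonneg [simp]: "wt \<alpha> \<ge> 0"
  using wt_pos[of \<alpha>] by linarith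

lemma wt_0 [simp]: "wt 0 = 1"
  by (simp add: wt_def)

lemma wt_plus_le: "wt (\<alpha> + \<beta>) \<le> wt \<alpha> * wt \<beta>"
proof -
  let ?n = "expo \<alpha>" and ?k = "expo \<beta>"
  let ?A = "\<Prod>b\<in>Basis. fact (?n b) :: real" and ?B = "\<Prod>b\<in>Basis. fact (?k b) :: real"
  have fb: "fact (n + k) = real (n + k choose n) * (fact n * fact k)" for n k
    by (simp add: binomial_fact)
  have "(\<Prod>b\<in>Basis. fact (?n b + ?k b)) = (\<Prod>b\<in>Basis. real (?n b + ?k b choose ?n b)) * (?A * ?B)"
    by (simp add: fb prod.distrib)
  also have "\<dots> \<le> real (deg \<alpha> + deg \<beta> choose deg \<alpha>) * (?A * ?B)"
    using prod_binomial_le[of Basis ?n ?k]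
    by (intro mult_right_mono) (auto simp: deg_def prod_nonneg simp flip: of_nat_prod)
  finally have "(\<Prod>b\<in>Basis. fact (?n b + ?k b)) \<le> real (deg \<alpha> + deg \<beta> choose deg \<alpha>) * (?A * ?B)" .
  then have "wt (\<alpha> + \<beta>) \<le> real (deg \<alpha> + deg \<beta> choose deg \<alpha>) * (?A * ?B) / fact (deg \<alpha> + deg \<beta>)"
    unfolding wt_def by (simp add: divide_right_mono)
  also have "\<dots> = wt \<alpha> * wt \<beta>"
    by (simp add: wt_def fb)
  finally show ?thesis .
qed

text \<open>Because of this lower bound, series of finite norm converge on the box of radius \<open>1 / DIM('a)\<close>.\<close>

lemma wt_ge: "1 / real DIM('a) ^ deg \<alpha> \<le> wt (\<alpha> :: 'a::euclidean_space mindex)"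
  using fact_sum_le[of "Basis :: 'a set" "expo \<alpha>"]
  by (simp add: wt_def deg_def divide_simps mult.commute)

lemma wt_unit_plus: "b \<in> Basis \<Longrightarrow> wt (\<alpha> + unit_index b) * (real (deg \<alpha>) + 1) = wt \<alpha> * (real (expo \<alpha> b) + 1)"
proof -
  assume b: "b \<in> Basis"
  have "(\<Prod>c\<in>Basis. fact (expo (\<alpha> + unit_index b) c) :: real)
      = (\<Prod>c\<in>Basis. fact (expo \<alpha> c) * (if c = b then real (expo \<alpha> b) + 1 else 1))"
    by (rule prod.cong) (auto simp: add.commute)
  also have "\<dots> = (\<Prod>c\<in>Basis. fact (expo \<alpha> c)) * (real (expo \<alpha> b) + 1)"
    using b by (simp add: prod.distrib)
  finally show ?thesis using b by (simp add: wt_def divide_simps)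
qed

lemma wt_le_1: "wt \<alpha> \<le> 1"
proof (induction \<alpha> rule: mindex_induct)
  case (add \<alpha> b)
  have "wt (\<alpha> + unit_index b) * (real (deg \<alpha>) + 1) \<le> 1 * (real (deg \<alpha>) + 1)"
    unfolding wt_unit_plus[OF add(1)] using add expo_le_deg[OF add(1), of \<alpha>]
    by (intro mult_mono) auto
  then show ?case by (rule mult_right_le_imp_le) simp
qed simp

section \<open>The Banach algebra of weighted power series\<close>

text \<open>The radius of convergence is fixed by the weights. Other radii are reached by rescaling the variables.\<close>

typedef (overloaded) 'a pser =
  "{u :: 'a::euclidean_space mindex \<Rightarrow> real. (\<lambda>\<alpha>. wt \<alpha> * \<bar>u \<alpha>\<bar>) summable_on UNIV}"
  morphisms coef Pser
  by (rule exI[of _ "\<lambda>_. 0"]) simp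

setup_lifting type_definition_pser

lemma coef_summable: "(\<lambda>\<alpha>. wt \<alpha> * \<bar>coef u \<alpha>\<bar>) summable_on UNIV"
  using coef[of u] by simp

lemma coef_Pser: "(\<lambda>\<alpha>. wt \<alpha> * \<bar>u \<alpha>\<bar>) summable_on UNIV \<Longrightarrow> coef (Pser u) = u"
  by (simp add: Pser_inverse)

lemma pser_eqI: "(\<And>\<alpha>. coef u \<alpha> = coef v \<alpha>) \<Longrightarrow> u = v"
  by (metis coef_inject ext)

lemma convolution_bound:
  fixes u v :: "'a::euclidean_space mindex \<Rightarrow> real"
  shows "wt \<alpha> * \<bar>\<Sum>(\<beta>, \<gamma>)\<in>splits \<alpha>. u \<beta> * v \<gamma>\<bar>
    \<le> (\<Sum>(\<beta>, \<gamma>)\<in>splits \<alpha>. (wt \<beta> * \<bar>u \<beta>\<bar>) * (wt \<gamma> * \<bar>v \<gamma>\<bar>))"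
proof -
  have "wt \<alpha> * \<bar>\<Sum>(\<beta>, \<gamma>)\<in>splits \<alpha>. u \<beta> * v \<gamma>\<bar> \<le> wt \<alpha> * (\<Sum>(\<beta>, \<gamma>)\<in>splits \<alpha>. \<bar>u \<beta>\<bar> * \<bar>v \<gamma>\<bar>)"
    by (intro mult_left_mono order_trans[OF sum_abs] sum_mono) (auto simp: abs_mult)
  also have "\<dots> = (\<Sum>(\<beta>, \<gamma>)\<in>splits \<alpha>. wt \<alpha> * (\<bar>u \<beta>\<bar> * \<bar>v \<gamma>\<bar>))"
    by (simp add: sum_distrib_left case_prod_unfold)
  also have "\<dots> \<le> (\<Sum>(\<beta>, \<gamma>)\<in>splits \<alpha>. (wt \<beta> * \<bar>u \<beta>\<bar>) * (wt \<gamma> * \<bar>v \<gamma>\<bar>))"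
  proof (rule sum_mono, clarify)
    fix \<beta> \<gamma> assume "(\<beta>, \<gamma>) \<in> splits \<alpha>"
    then have "wt \<alpha> * (\<bar>u \<beta>\<bar> * \<bar>v \<gamma>\<bar>) \<le> (wt \<beta> * wt \<gamma>) * (\<bar>u \<beta>\<bar> * \<bar>v \<gamma>\<bar>)"
      using wt_plus_le[of \<beta> \<gamma>] by (intro mult_right_mono) (auto simp: splits_def)
    then show "wt \<alpha> * (\<bar>u \<beta>\<bar> * \<bar>v \<gamma>\<bar>) \<le> wt \<beta> * \<bar>u \<beta>\<bar> * (wt \<gamma> * \<bar>v \<gamma>\<bar>)"
      by (simp add: ac_simps)
  qed
  finally show ?thesis .
qed

lemma convolution_summable:
  fixes u v :: "'a::euclidean_space mindex \<Rightarrow> real"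
  assumes "(\<lambda>\<alpha>. wt \<alpha> * \<bar>u \<alpha>\<bar>) summable_on UNIV" "(\<lambda>\<alpha>. wt \<alpha> * \<bar>v \<alpha>\<bar>) summable_on UNIV"
  shows "(\<lambda>\<alpha>. wt \<alpha> * \<bar>\<Sum>(\<beta>, \<gamma>)\<in>splits \<alpha>. u \<beta> * v \<gamma>\<bar>) summable_on UNIV"
  using has_sum_imp_summable[OF has_sum_Cauchy_product[OF assms]]
  by (rule summable_on_comparison_test) (auto intro: convolution_bound)

lemma summable_add_bound:
  fixes u v :: "'a::euclidean_space mindex \<Rightarrow> real"
  assumes "(\<lambda>\<alpha>. wt \<alpha> * \<bar>u \<alpha>\<bar>) summable_on UNIV" "(\<lambda>\<alpha>. wt \<alpha> * \<bar>v \<alpha>\<bar>) summable_on UNIV"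
  shows "(\<lambda>\<alpha>. wt \<alpha> * \<bar>u \<alpha> + v \<alpha>\<bar>) summable_on UNIV"
  using summable_on_add[OF assms]
  by (rule summable_on_comparison_test)
    (auto simp flip: distrib_left intro!: mult_left_mono abs_triangle_ineq)

instantiation pser :: (euclidean_space) comm_ring_1
begin

lift_definition zero_pser :: "'a pser" is "\<lambda>_. 0" by simp
lift_definition one_pser :: "'a pser" is "\<lambda>\<alpha>. if \<alpha> = 0 then 1 else 0"
  by (rule finite_nonzero_values_imp_summable_on) (auto intro: finite_subset[of _ "{0}"])
lift_definition plus_pser :: "'a pser \<Rightarrow> 'a pser \<Rightarrow> 'a pser" is "\<lambda>u v \<alpha>. u \<alpha> + v \<alpha>"
  by (rule summable_add_bound)
lift_definition uminus_pser :: "'a pser \<Rightarrow> 'a pser" is "\<lambda>u \<alpha>. - u \<alpha>" by simp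
lift_definition minus_pser :: "'a pser \<Rightarrow> 'a pser \<Rightarrow> 'a pser" is "\<lambda>u v \<alpha>. u \<alpha> - v \<alpha>"
  using summable_add_bound[where v = "\<lambda>\<alpha>. - v \<alpha>" for v] by fastforce
lift_definition times_pser :: "'a pser \<Rightarrow> 'a pser \<Rightarrow> 'a pser"
  is "\<lambda>u v \<alpha>. \<Sum>(\<beta>, \<gamma>)\<in>splits \<alpha>. u \<beta> * v \<gamma>"
  by (rule convolution_summable)

instance
proof
  fix u v w :: "'a pser"
  show "u * v * w = u * (v * w)"
  proof (rule pser_eqI)
    fix \<alpha>
    let ?f = "\<lambda>(\<beta>, \<gamma>, \<delta>). coef u \<beta> * coef v \<gamma> * coef w \<delta>"
    have "coef (u * v * w) \<alpha>
        = (\<Sum>((\<epsilon>, \<delta>), (\<beta>, \<gamma>))\<in>(SIGMA p:splits \<alpha>. splits (fst p)). coef u \<beta> * coef v \<gamma> * coef w \<delta>)"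
      by (simp add: times_pser.rep_eq sum_distrib_right case_prod_unfold sum.Sigma)
    also have "\<dots> = sum ?f {(\<beta>, \<gamma>, \<delta>). \<beta> + \<gamma> + \<delta> = \<alpha>}"
      by (rule sum.reindex_bij_witness[where i = "\<lambda>(\<beta>, \<gamma>, \<delta>). ((\<beta> + \<gamma>, \<delta>), (\<beta>, \<gamma>))"
            and j = "\<lambda>((\<epsilon>, \<delta>), (\<beta>, \<gamma>)). (\<beta>, \<gamma>, \<delta>)"]) (auto simp: splits_def)
    also have "\<dots> = (\<Sum>((\<beta>, \<epsilon>), (\<gamma>, \<delta>))\<in>(SIGMA p:splits \<alpha>. splits (snd p)).
        coef u \<beta> * coef v \<gamma> * coef w \<delta>)"
      by (rule sum.reindex_bij_witness[where j = "\<lambda>(\<beta>, \<gamma>, \<delta>). ((\<beta>, \<gamma> + \<delta>), (\<gamma>, \<delta>))"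
            and i = "\<lambda>((\<beta>, \<epsilon>), (\<gamma>, \<delta>)). (\<beta>, \<gamma>, \<delta>)"]) (auto simp: splits_def add.assoc)
    also have "\<dots> = coef (u * (v * w)) \<alpha>"
      by (simp add: times_pser.rep_eq sum_distrib_left case_prod_unfold sum.Sigma mult.assoc)
    finally show "coef (u * v * w) \<alpha> = coef (u * (v * w)) \<alpha>" .
  qed
  show "u * v = v * u"
    by (rule pser_eqI, unfold times_pser.rep_eq,
        rule sum.reindex_bij_witness[where i = "\<lambda>(x, y). (y, x)" and j = "\<lambda>(x, y). (y, x)"])
      (auto simp: splits_def add.commute)
  show "1 * u = u"
  proof (rule pser_eqI)
    fix \<alpha>
    have "coef (1 * u) \<alpha> = (\<Sum>(\<beta>, \<gamma>)\<in>{(0 :: 'a mindex, \<alpha>)}. coef u \<gamma>)"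
      unfolding times_pser.rep_eq one_pser.rep_eq
      by (rule sum.mono_neutral_cong_right)
        (use finite_splits[of \<alpha>] in \<open>auto simp: splits_def split: if_splits\<close>)
    then show "coef (1 * u) \<alpha> = coef u \<alpha>" by simp
  qed
  show "(u + v) * w = u * w + v * w"
    by (rule pser_eqI)
      (simp add: times_pser.rep_eq plus_pser.rep_eq distrib_right sum.distrib case_prod_unfold)
  have "coef (0 :: 'a pser) 0 \<noteq> coef 1 0" by (simp add: zero_pser.rep_eq one_pser.rep_eq)
  then show "(0 :: 'a pser) \<noteq> 1" by metis
qed (transfer; auto)+

end

instantiation pser :: (euclidean_space) real_normed_vector
begin

lift_definition scaleR_pser :: "real \<Rightarrow> 'a pser \<Rightarrow> 'a pser" is "\<lambda>c u \<alpha>. c * u \<alpha>"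
  using summable_on_cmult_right by (fastforce simp: abs_mult mult.left_commute)

definition norm_pser :: "'a pser \<Rightarrow> real" where
  "norm u = (\<Sum>\<^sub>\<infinity>\<alpha>. wt \<alpha> * \<bar>coef u \<alpha>\<bar>)"

definition dist_pser :: "'a pser \<Rightarrow> 'a pser \<Rightarrow> real" where "dist_pser u v = norm (u - v)"
definition sgn_pser :: "'a pser \<Rightarrow> 'a pser" where "sgn_pser u = inverse (norm u) *\<^sub>R u"
definition uniformity_pser :: "('a pser \<times> 'a pser) filter" where
  "uniformity_pser = (INF e\<in>{0 <..}. principal {(x, y). dist x y < e})"
definition open_pser :: "'a pser set \<Rightarrow> bool" where
  "open_pser S = (\<forall>x\<in>S. \<forall>\<^sub>F (x', y) in uniformity. x' = x \<longrightarrow> y \<in> S)"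

instance
proof
  fix u v :: "'a pser" and c d :: real
  show "norm u = 0 \<longleftrightarrow> u = 0"
  proof
    assume "norm u = 0"
    then have "wt \<alpha> * \<bar>coef u \<alpha>\<bar> = 0" for \<alpha>
      using nonneg_infsum_le_0D[of "\<lambda>\<alpha>. wt \<alpha> * \<bar>coef u \<alpha>\<bar>" UNIV] coef_summable[of u]
      by (simp add: norm_pser_def)
    then have "coef u \<alpha> = 0" for \<alpha> using wt_pos[of \<alpha>] by (metis abs_eq_0 less_irrefl mult_eq_0_iff)
    then show "u = 0" by (intro pser_eqI) (simp add: zero_pser.rep_eq)
  qed (simp add: norm_pser_def zero_pser.rep_eq)
  show "norm (u + v) \<le> norm u + norm v"
    unfolding norm_pser_def plus_pser.rep_eq infsum_add[OF coef_summable coef_summable, symmetric]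
    by (intro infsum_mono summable_add_bound summable_on_add coef_summable)
      (auto simp flip: distrib_left intro!: mult_left_mono abs_triangle_ineq)
  show "norm (c *\<^sub>R u) = \<bar>c\<bar> * norm u"
    by (simp add: norm_pser_def scaleR_pser.rep_eq abs_mult mult.left_commute infsum_cmult_right')
qed (transfer; simp add: dist_pser_def sgn_pser_def uniformity_pser_def open_pser_def algebra_simps; fail
    | simp add: dist_pser_def sgn_pser_def uniformity_pser_def open_pser_def)+

end

lemmas coef_simps [simp] = zero_pser.rep_eq plus_pser.rep_eq minus_pser.rep_eq uminus_pser.rep_eq
  scaleR_pser.rep_eq

lemma weighted_coef_le_norm: "wt \<alpha> * \<bar>coef u \<alpha>\<bar> \<le> norm u"
  using finite_sum_le_infsum[OF coef_summable[of u], of "{\<alpha>}"] by (simp add: norm_pser_def)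

text \<open>Bounding the finite partial sums proves membership and the norm estimate at the same time.\<close>

lemma norm_pser_le:
  assumes "\<And>F. finite F \<Longrightarrow> (\<Sum>\<alpha>\<in>F. wt \<alpha> * \<bar>u \<alpha>\<bar>) \<le> M"
  shows "(\<lambda>\<alpha>. wt \<alpha> * \<bar>u \<alpha>\<bar>) summable_on UNIV" "norm (Pser u) \<le> M"
proof -
  show s: "(\<lambda>\<alpha>. wt \<alpha> * \<bar>u \<alpha>\<bar>) summable_on UNIV"
    by (rule nonneg_bdd_above_summable_on) (auto intro!: bdd_aboveI2[where M = M] assms)
  show "norm (Pser u) \<le> M"
    unfolding norm_pser_def coef_Pser[OF s] by (rule infsum_le_finite_sums[OF s]) (auto intro: assms)
qed

instance pser :: (euclidean_space) "{real_normed_algebra_1, banach}"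
proof
  fix u v :: "'a pser" and c :: real
  show "c *\<^sub>R u * v = c *\<^sub>R (u * v)" "u * c *\<^sub>R v = c *\<^sub>R (u * v)"
    by (rule pser_eqI,
        simp add: times_pser.rep_eq sum_distrib_left case_prod_unfold mult.assoc mult.left_commute)+
  show "norm (u * v) \<le> norm u * norm v"
    using convolution_summable[OF coef_summable coef_summable, of u v]
    unfolding norm_pser_def infsumI[OF has_sum_Cauchy_product[OF coef_summable coef_summable], symmetric]
      times_pser.rep_eq
    by (intro infsum_mono convolution_bound)
      (auto intro!: has_sum_imp_summable[OF has_sum_Cauchy_product] coef_summable)
  have "norm (1 :: 'a pser) = (\<Sum>\<^sub>\<infinity>\<alpha>\<in>{0 :: 'a mindex}. 1)"
    unfolding norm_pser_def one_pser.rep_eq by (rule infsum_cong_neutral) auto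
  then show "norm (1 :: 'a pser) = 1" by simp
next
  fix X :: "nat \<Rightarrow> 'a pser"
  assume X: "Cauchy X"
  have "Cauchy (\<lambda>n. coef (X n) \<alpha>)" for \<alpha>
  proof (rule metric_CauchyI)
    fix e :: real assume "e > 0"
    then have "wt \<alpha> * e > 0" by simp
    from metric_CauchyD[OF X this]
    obtain N where N: "\<And>m n. m \<ge> N \<Longrightarrow> n \<ge> N \<Longrightarrow> norm (X m - X n) < wt \<alpha> * e"
      by (auto simp: dist_norm)
    have "dist (coef (X m) \<alpha>) (coef (X n) \<alpha>) < e" if "m \<ge> N" "n \<ge> N" for m n
    proof -
      have "wt \<alpha> * \<bar>coef (X m - X n) \<alpha>\<bar> < wt \<alpha> * e"
        using weighted_coef_le_norm[of \<alpha> "X m - X n"] N[OF that] by linarith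
      then show ?thesis by (simp add: dist_real_def)
    qed
    then show "\<exists>M. \<forall>m\<ge>M. \<forall>n\<ge>M. dist (coef (X m) \<alpha>) (coef (X n) \<alpha>) < e" by blast
  qed
  then have "\<exists>l. (\<lambda>n. coef (X n) \<alpha>) \<longlonglongrightarrow> l" for \<alpha>
    by (meson Cauchy_convergent_iff convergent_def)
  then obtain l where l: "\<And>\<alpha>. (\<lambda>n. coef (X n) \<alpha>) \<longlonglongrightarrow> l \<alpha>" by metis
  \<comment> \<open>The bound for the finite partial sums of \<open>X m - X n\<close> passes to the coefficientwise limit \<open>m \<rightarrow> \<infinity>\<close>.\<close>
  have tail: "\<exists>N. \<forall>n\<ge>N. \<forall>F. finite F \<longrightarrow> (\<Sum>\<alpha>\<in>F. wt \<alpha> * \<bar>l \<alpha> - coef (X n) \<alpha>\<bar>) \<le> e" if "e > 0" for e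
  proof -
    from metric_CauchyD[OF X \<open>e > 0\<close>]
    obtain N where N: "\<And>m n. m \<ge> N \<Longrightarrow> n \<ge> N \<Longrightarrow> norm (X m - X n) < e"
      by (auto simp: dist_norm)
    have "(\<Sum>\<alpha>\<in>F. wt \<alpha> * \<bar>l \<alpha> - coef (X n) \<alpha>\<bar>) \<le> e" if "n \<ge> N" "finite F" for n F
    proof (rule tendsto_upperbound)
      show "((\<lambda>m. \<Sum>\<alpha>\<in>F. wt \<alpha> * \<bar>coef (X m) \<alpha> - coef (X n) \<alpha>\<bar>)
          \<longlonglongrightarrow> (\<Sum>\<alpha>\<in>F. wt \<alpha> * \<bar>l \<alpha> - coef (X n) \<alpha>\<bar>))"
        by (intro tendsto_intros l)
      have "(\<Sum>\<alpha>\<in>F. wt \<alpha> * \<bar>coef (X m) \<alpha> - coef (X n) \<alpha>\<bar>) \<le> e" if "m \<ge> N" for m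
        using finite_sum_le_infsum[OF coef_summable[of "X m - X n"] \<open>finite F\<close>] N[OF \<open>m \<ge> N\<close> \<open>n \<ge> N\<close>]
        by (simp add: norm_pser_def)
      then show "\<forall>\<^sub>F m in sequentially. (\<Sum>\<alpha>\<in>F. wt \<alpha> * \<bar>coef (X m) \<alpha> - coef (X n) \<alpha>\<bar>) \<le> e"
        by (auto simp: eventually_sequentially)
    qed simp
    then show ?thesis by blast
  qed
  obtain n0 where n0: "\<And>F. finite F \<Longrightarrow> (\<Sum>\<alpha>\<in>F. wt \<alpha> * \<bar>l \<alpha> - coef (X n0) \<alpha>\<bar>) \<le> 1"
    using tail[of 1] by auto
  have "(\<lambda>\<alpha>. wt \<alpha> * \<bar>(l \<alpha> - coef (X n0) \<alpha>) + coef (X n0) \<alpha>\<bar>) summable_on UNIV"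
    by (intro summable_add_bound norm_pser_le(1)[OF n0] coef_summable)
  then have "coef (Pser l) = l" by (intro coef_Pser) simp
  moreover have "Pser (coef u) = u" for u :: "'a pser" by (rule coef_inverse)
  ultimately have sub: "Pser l - X n = Pser (\<lambda>\<alpha>. l \<alpha> - coef (X n) \<alpha>)" for n
    by (metis (no_types, lifting) ext minus_pser.rep_eq)
  have "X \<longlonglongrightarrow> Pser l"
  proof (rule metric_LIMSEQ_I)
    fix e :: real assume "e > 0"
    then obtain N where N: "\<And>n F. n \<ge> N \<Longrightarrow> finite F \<Longrightarrow> (\<Sum>\<alpha>\<in>F. wt \<alpha> * \<bar>l \<alpha> - coef (X n) \<alpha>\<bar>) \<le> e / 2"
      using tail[of "e / 2"] by auto
    have "dist (X n) (Pser l) < e" if "n \<ge> N" for n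
    proof -
      have "norm (Pser l - X n) \<le> e / 2"
        unfolding sub by (rule norm_pser_le(2)) (rule N[OF that])
      then show ?thesis using \<open>e > 0\<close> by (simp add: dist_norm norm_minus_commute)
    qed
    then show "\<exists>N. \<forall>n\<ge>N. dist (X n) (Pser l) < e" by blast
  qed
  then show "convergent X" by (auto simp: convergent_def)
qed

section \<open>Evaluation of power series\<close>

text \<open>On this box every monomial is bounded by its weight, see \<open>wt_ge\<close>.\<close>

definition ebox :: "'a::euclidean_space set" where
  "ebox = {z. \<forall>b\<in>Basis. \<bar>z \<bullet> b\<bar> \<le> 1 / DIM('a)}"

definition ev :: "'a::euclidean_space \<Rightarrow> 'a pser \<Rightarrow> real" where
  "ev z u = (\<Sum>\<^sub>\<infinity>\<alpha>. coef u \<alpha> * mpow (\<lambda>b. z \<bullet> b) \<alpha>)"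

lemma ev_term_le:
  assumes "z \<in> ebox"
  shows "\<bar>coef u \<alpha> * mpow (\<lambda>b. z \<bullet> b) \<alpha>\<bar> \<le> wt \<alpha> * \<bar>coef u \<alpha>\<bar>"
proof -
  have "\<bar>mpow (\<lambda>b. z \<bullet> b) \<alpha>\<bar> \<le> (1 / real DIM('a)) ^ deg \<alpha>"
    using norm_mpow_le[of "\<lambda>b. z \<bullet> b" "1 / real DIM('a)" \<alpha>] assms by (simp add: ebox_def)
  also have "\<dots> \<le> wt \<alpha>" using wt_ge[of \<alpha>] by (simp add: power_one_over)
  finally show ?thesis by (simp add: abs_mult mult.commute[of "wt \<alpha>"] mult_left_mono)
qed

lemma ev_abs_summable:
  assumes "z \<in> ebox"
  shows "(\<lambda>\<alpha>. coef u \<alpha> * mpow (\<lambda>b. z \<bullet> b) \<alpha>) summable_on UNIV"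
proof (rule abs_summable_summable)
  show "(\<lambda>\<alpha>. norm (coef u \<alpha> * mpow (\<lambda>b. z \<bullet> b) \<alpha>)) summable_on UNIV"
    by (rule summable_on_comparison_test[OF coef_summable[of u]]) (use ev_term_le[OF assms] in auto)
qed

lemma ev_has_sum: "z \<in> ebox \<Longrightarrow> ((\<lambda>\<alpha>. coef u \<alpha> * mpow (\<lambda>b. z \<bullet> b) \<alpha>) has_sum ev z u) UNIV"
  unfolding ev_def by (intro has_sum_infsum ev_abs_summable)

lemma ev_add: "z \<in> ebox \<Longrightarrow> ev z (u + v) = ev z u + ev z v"
  by (rule has_sum_unique[OF ev_has_sum], assumption)
    (use has_sum_add[OF ev_has_sum[of z u] ev_has_sum[of z v]] in \<open>simp add: distrib_right\<close>)

lemma ev_scaleR: "z \<in> ebox \<Longrightarrow> ev z (c *\<^sub>R u) = c * ev z u"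
  by (rule has_sum_unique[OF ev_has_sum], assumption)
    (use has_sum_cmult_right[OF ev_has_sum[of z u], of c] in \<open>simp add: mult.assoc\<close>)

lemma abs_ev_le: "z \<in> ebox \<Longrightarrow> \<bar>ev z u\<bar> \<le> norm u"
proof -
  assume z: "z \<in> ebox"
  have "norm (ev z u) \<le> (\<Sum>\<^sub>\<infinity>\<alpha>. wt \<alpha> * \<bar>coef u \<alpha>\<bar>)"
    unfolding ev_def
    by (rule norm_infsum_le[OF has_sum_infsum has_sum_infsum])
      (use ev_term_le[OF z] in \<open>auto intro: ev_abs_summable z coef_summable\<close>)
  then show ?thesis by (simp add: norm_pser_def)
qed

lemma bounded_linear_ev: "z \<in> ebox \<Longrightarrow> bounded_linear (ev z)"
  by (rule bounded_linear_intro[where K = 1]) (auto simp: ev_add ev_scaleR abs_ev_le)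

text \<open>The Cauchy product formula makes evaluation multiplicative, so evaluations are continuous algebra homomorphisms.\<close>

lemma ev_mult:
  assumes "z \<in> ebox"
  shows "ev z (u * v) = ev z u * ev z v"
proof (rule has_sum_unique[OF ev_has_sum[OF assms]])
  have "((\<lambda>\<alpha>. \<Sum>(\<beta>, \<gamma>)\<in>splits \<alpha>. (coef u \<beta> * mpow (\<lambda>b. z \<bullet> b) \<beta>) * (coef v \<gamma> * mpow (\<lambda>b. z \<bullet> b) \<gamma>))
      has_sum ev z u * ev z v) UNIV"
    unfolding ev_def by (intro has_sum_Cauchy_product ev_abs_summable assms)
  moreover have "(\<Sum>(\<beta>, \<gamma>)\<in>splits \<alpha>. (coef u \<beta> * mpow (\<lambda>b. z \<bullet> b) \<beta>) * (coef v \<gamma> * mpow (\<lambda>b. z \<bullet> b) \<gamma>))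
      = coef (u * v) \<alpha> * mpow (\<lambda>b. z \<bullet> b) \<alpha>" for \<alpha>
    unfolding times_pser.rep_eq sum_distrib_right
    by (rule sum.cong) (auto simp: splits_def mpow_plus[of "\<lambda>b. z \<bullet> b"] simp del: mpow_plus)
  ultimately show "((\<lambda>\<alpha>. coef (u * v) \<alpha> * mpow (\<lambda>b. z \<bullet> b) \<alpha>) has_sum ev z u * ev z v) UNIV"
    by simp
qed

lemma ev_1:
  assumes "z \<in> ebox"
  shows "ev z 1 = 1"
proof (rule has_sum_unique[OF ev_has_sum[OF assms]])
  show "((\<lambda>\<alpha>. coef 1 \<alpha> * mpow (\<lambda>b. z \<bullet> b) \<alpha>) has_sum 1) UNIV"
    by (rule has_sum_finite_neutralI[of "{0}"]) (auto simp: one_pser.rep_eq)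
qed

lemma ev_diff: "z \<in> ebox \<Longrightarrow> ev z (u - v) = ev z u - ev z v"
  by (rule bounded_linear.linear[OF bounded_linear_ev, THEN linear_diff])

lemma ev_0: "z \<in> ebox \<Longrightarrow> ev z 0 = 0"
  by (rule bounded_linear.linear[OF bounded_linear_ev, THEN linear_0])

lemma ev_of_real: "z \<in> ebox \<Longrightarrow> ev z (of_real c) = c"
  by (simp add: of_real_def ev_scaleR ev_1)

lemma ev_power: "z \<in> ebox \<Longrightarrow> ev z (u ^ n) = ev z u ^ n"
  by (induction n) (simp_all add: ev_1 ev_mult)

lemma ev_sum: "z \<in> ebox \<Longrightarrow> ev z (\<Sum>i\<in>I. u i) = (\<Sum>i\<in>I. ev z (u i))"
  by (rule bounded_linear.linear[OF bounded_linear_ev, THEN linear_sum])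

lemma ev_prod: "z \<in> ebox \<Longrightarrow> ev z (\<Prod>i\<in>I. u i) = (\<Prod>i\<in>I. ev z (u i))"
  by (induction I rule: infinite_finite_induct) (simp_all add: ev_1 ev_mult)

lemma ev_mpow: "z \<in> ebox \<Longrightarrow> ev z (mpow Z \<alpha>) = mpow (\<lambda>b. ev z (Z b)) \<alpha>"
  by (simp add: mpow_def ev_prod ev_power)

lemmas ev_simps = ev_add ev_diff ev_scaleR ev_mult ev_1 ev_0 ev_of_real ev_power ev_sum ev_prod ev_mpow

lift_definition Coord :: "'a::euclidean_space \<Rightarrow> 'a pser" is "\<lambda>b \<alpha>. if \<alpha> = unit_index b then 1 else 0"
  by (rule finite_nonzero_values_imp_summable_on) (auto intro: finite_subset[of _ "{unit_index b}" for b])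

lemma ev_Coord: 
  assumes "z \<in> ebox" "b \<in> Basis"
  shows "ev z (Coord b) = z \<bullet> b"
proof (rule has_sum_unique[OF ev_has_sum[OF assms(1)]])
  show "((\<lambda>\<alpha>. coef (Coord b) \<alpha> * mpow (\<lambda>b. z \<bullet> b) \<alpha>) has_sum z \<bullet> b) UNIV"
    by (rule has_sum_finite_neutralI[of "{unit_index b}"]) (use assms in \<open>auto simp: Coord.rep_eq\<close>)
qed

lemma norm_Coord_le: "norm (Coord b) \<le> 1"
proof -
  have "norm (Coord b) = (\<Sum>\<^sub>\<infinity>\<alpha>\<in>{unit_index b}. wt \<alpha>)"
    unfolding norm_pser_def Coord.rep_eq by (rule infsum_cong_neutral) auto
  then show ?thesis by (simp add: wt_le_1)
qed

section \<open>Local power series expansions\<close>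

text \<open>Expansions hold on closed boxes and absolutely up to the corner of the box, so that \<open>R\<close> can serve as a bound for the
norms of the elements that are substituted for the variables.\<close>

definition expands ::
    "('a::euclidean_space mindex \<Rightarrow> real) \<Rightarrow> real \<Rightarrow> 'a \<Rightarrow> ('a \<Rightarrow> real) \<Rightarrow> bool" where
  "expands C R p g \<longleftrightarrow> R > 0 \<and> (\<lambda>\<alpha>. \<bar>C \<alpha>\<bar> * R ^ deg \<alpha>) summable_on UNIV \<and>
     (\<forall>z. (\<forall>b\<in>Basis. \<bar>(z - p) \<bullet> b\<bar> \<le> R) \<longrightarrow>
        ((\<lambda>\<alpha>. C \<alpha> * mpow (\<lambda>b. (z - p) \<bullet> b) \<alpha>) has_sum g z) UNIV)"

definition analytic_at :: "('a::euclidean_space \<Rightarrow> real) \<Rightarrow> 'a \<Rightarrow> bool" where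
  "analytic_at g p \<longleftrightarrow> (\<exists>C R. expands C R p g)"

lemma expands_pos: "expands C R p g \<Longrightarrow> R > 0"
  and expands_summable: "expands C R p g \<Longrightarrow> (\<lambda>\<alpha>. \<bar>C \<alpha>\<bar> * R ^ deg \<alpha>) summable_on UNIV"
  and expands_has_sum: "expands C R p g \<Longrightarrow> (\<And>b. b \<in> Basis \<Longrightarrow> \<bar>(z - p) \<bullet> b\<bar> \<le> R) \<Longrightarrow>
     ((\<lambda>\<alpha>. C \<alpha> * mpow (\<lambda>b. (z - p) \<bullet> b) \<alpha>) has_sum g z) UNIV"
  by (auto simp: expands_def)

lemma abs_term_le:
  fixes w :: "'a::euclidean_space \<Rightarrow> real"
  assumes "\<And>b. b \<in> Basis \<Longrightarrow> \<bar>w b\<bar> \<le> R"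
  shows "\<bar>c * mpow w \<alpha>\<bar> \<le> \<bar>c\<bar> * R ^ deg \<alpha>"
  using norm_mpow_le[of w R \<alpha>] assms by (simp add: abs_mult mult_left_mono)

lemma summable_radius_mono:
  fixes C :: "'a::euclidean_space mindex \<Rightarrow> real"
  assumes "(\<lambda>\<alpha>. \<bar>C \<alpha>\<bar> * R ^ deg \<alpha>) summable_on UNIV" "0 \<le> r" "r \<le> R"
  shows "(\<lambda>\<alpha>. \<bar>C \<alpha>\<bar> * r ^ deg \<alpha>) summable_on UNIV"
  using assms(1) by (rule summable_on_comparison_test) (use assms in \<open>auto intro!: mult_left_mono power_mono\<close>)

lemma expands_mono: "expands C R p g \<Longrightarrow> 0 < r \<Longrightarrow> r \<le> R \<Longrightarrow> expands C r p g"
  unfolding expands_def using summable_radius_mono[of C R r] by (auto intro: order_trans)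

lemma expands_center: 
  assumes "expands C R p g" shows "g p = C 0"
proof (rule has_sum_unique)
  show "((\<lambda>\<alpha>. C \<alpha> * mpow (\<lambda>b. (p - p) \<bullet> b) \<alpha>) has_sum g p) UNIV"
    by (rule expands_has_sum[OF assms]) (use expands_pos[OF assms] in simp)
  have "mpow (\<lambda>b :: 'a. 0 :: real) \<alpha> = (if \<alpha> = 0 then 1 else 0)" for \<alpha>
    by (simp add: mpow_const power_0_left)
  then show "((\<lambda>\<alpha>. C \<alpha> * mpow (\<lambda>b. (p - p) \<bullet> b) \<alpha>) has_sum C 0) UNIV"
    by (intro has_sum_finite_neutralI[of "{0}"]) auto
qed

lemma norm_le_box:
  fixes z :: "'a::euclidean_space"
  assumes "\<And>b. b \<in> Basis \<Longrightarrow> \<bar>z \<bullet> b\<bar> \<le> R"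
  shows "norm z \<le> real DIM('a) * R"
  using norm_le_l1[of z] sum_bounded_above[of Basis "\<lambda>b. \<bar>z \<bullet> b\<bar>" R] assms by simp

text \<open>For the direction from left to right, summability at the corner of a box inside the ball is absolute summability on
the whole box, since real families are summable only if they are absolutely summable.\<close>

lemma real_analytic_on_iff_analytic_at:
  "real_analytic_on g S \<longleftrightarrow> (\<forall>p\<in>S. analytic_at g p)"
proof -
  have "(\<exists>C. \<exists>r>0. \<forall>z\<in>ball p r. ((\<lambda>\<alpha>. C \<alpha> * mi_power (z - p) \<alpha>) has_sum g z) multi_indices)
      \<longleftrightarrow> analytic_at g p" (is "?L \<longleftrightarrow> _") for p
  proof
    assume ?L
    then obtain C r where "r > 0"
      and C: "\<And>z. z \<in> ball p r \<Longrightarrow> ((\<lambda>\<alpha>. C \<alpha> * mi_power (z - p) \<alpha>) has_sum g z) multi_indices"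
      by blast
    have hs: "((\<lambda>\<alpha>. C (expo \<alpha>) * mpow (\<lambda>b. (z - p) \<bullet> b) \<alpha>) has_sum g z) UNIV" if "z \<in> ball p r" for z
      using has_sum_reindex_bij_betw[OF bij_betw_expo, of "\<lambda>\<alpha>. C \<alpha> * mi_power (z - p) \<alpha>" "g z"] C[OF that]
      by (simp add: mi_power_expo)
    define R where "R = r / (2 * real DIM('a))"
    have "R > 0" using \<open>r > 0\<close> by (simp add: R_def)
    have small: "z \<in> ball p r" if "\<And>b. b \<in> Basis \<Longrightarrow> \<bar>(z - p) \<bullet> b\<bar> \<le> R" for z
      using norm_le_box[of "z - p" R] that \<open>r > 0\<close> by (simp add: R_def dist_norm norm_minus_commute)
    define z where "z = p + R *\<^sub>R (\<Sum>b\<in>Basis. b)"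
    have zb: "(z - p) \<bullet> b = R" if "b \<in> Basis" for b
      using that by (simp add: z_def inner_sum_left inner_Basis if_distrib cong: if_cong)
    then have "mpow (\<lambda>b. (z - p) \<bullet> b) \<alpha> = R ^ deg \<alpha>" for \<alpha>
      by (metis mpow_cong mpow_const)
    moreover have "z \<in> ball p r" by (rule small) (use zb \<open>R > 0\<close> in simp)
    ultimately have "(\<lambda>\<alpha>. C (expo \<alpha>) * R ^ deg \<alpha>) summable_on UNIV"
      using has_sum_imp_summable[OF hs[of z]] by simp
    then have "(\<lambda>\<alpha>. \<bar>C (expo \<alpha>)\<bar> * R ^ deg \<alpha>) summable_on UNIV"
      using \<open>R > 0\<close> summable_on_iff_abs_summable_on_real[of "\<lambda>\<alpha>. C (expo \<alpha>) * R ^ deg \<alpha>" UNIV]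
      by (simp add: abs_mult)
    then have "expands (\<lambda>\<alpha>. C (expo \<alpha>)) R p g"
      unfolding expands_def using \<open>R > 0\<close> hs small by blast
    then show "analytic_at g p" unfolding analytic_at_def by blast
  next
    assume "analytic_at g p"
    then obtain C R where e: "expands C R p g" by (auto simp: analytic_at_def)
    have "((\<lambda>\<alpha>. C (Mindex \<alpha>) * mi_power (z - p) \<alpha>) has_sum g z) multi_indices" if "z \<in> ball p R" for z
    proof -
      have "((\<lambda>\<alpha>. C \<alpha> * mpow (\<lambda>b. (z - p) \<bullet> b) \<alpha>) has_sum g z) UNIV"
        using that by (intro expands_has_sum[OF e])
          (auto simp: dist_norm norm_minus_commute intro: order_trans[OF Basis_le_norm])
      then show ?thesis
        using has_sum_reindex_bij_betw[OF bij_betw_expo, of "\<lambda>\<alpha>. C (Mindex \<alpha>) * mi_power (z - p) \<alpha>" "g z"]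
        by (simp add: mi_power_expo expo_inverse)
    qed
    then show ?L using expands_pos[OF e] by (intro exI[of _ "\<lambda>\<alpha>. C (Mindex \<alpha>)"] exI[of _ R]) auto
  qed
  then show ?thesis by (simp add: real_analytic_on_def)
qed

lemma scaled_in_ebox:
  fixes w :: "'a::euclidean_space"
  assumes "d > 0" "\<And>b. b \<in> Basis \<Longrightarrow> \<bar>w \<bullet> b\<bar> \<le> d / DIM('a)"
  shows "(1 / d) *\<^sub>R w \<in> ebox"
  using assms by (simp add: ebox_def abs_mult field_simps)

lemma expands_ev:
  fixes u :: "'a::euclidean_space pser"
  assumes "d > 0"
  shows "expands (\<lambda>\<alpha>. coef u \<alpha> / d ^ deg \<alpha>) (d / DIM('a)) p (\<lambda>z. ev ((1 / d) *\<^sub>R (z - p)) u)"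
  unfolding expands_def
proof (intro conjI allI impI)
  show "d / DIM('a) > 0" using assms by simp
  show "(\<lambda>\<alpha>. \<bar>coef u \<alpha> / d ^ deg \<alpha>\<bar> * (d / DIM('a)) ^ deg \<alpha>) summable_on UNIV"
  proof (rule summable_on_comparison_test[OF coef_summable[of u]])
    fix \<alpha> :: "'a mindex"
    have "\<bar>coef u \<alpha> / d ^ deg \<alpha>\<bar> * (d / DIM('a)) ^ deg \<alpha> = (1 / real DIM('a) ^ deg \<alpha>) * \<bar>coef u \<alpha>\<bar>"
      using assms by (simp add: power_divide abs_mult)
    also have "\<dots> \<le> wt \<alpha> * \<bar>coef u \<alpha>\<bar>" by (intro mult_right_mono wt_ge) auto
    finally show "\<bar>coef u \<alpha> / d ^ deg \<alpha>\<bar> * (d / DIM('a)) ^ deg \<alpha> \<le> wt \<alpha> * \<bar>coef u \<alpha>\<bar>" .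
  qed (use assms in auto)
  fix z assume z: "\<forall>b\<in>Basis. \<bar>(z - p) \<bullet> b\<bar> \<le> d / DIM('a)"
  have "mpow (\<lambda>b. ((1 / d) *\<^sub>R (z - p)) \<bullet> b) \<alpha> = mpow (\<lambda>b. (z - p) \<bullet> b) \<alpha> / d ^ deg \<alpha>" for \<alpha>
    unfolding inner_scaleR_left mpow_mult mpow_const by (simp add: power_one_over field_simps)
  moreover have "(1 / d) *\<^sub>R (z - p) \<in> ebox"
    using z assms by (intro scaled_in_ebox) auto
  from ev_has_sum[OF this, of u]
  have "((\<lambda>\<alpha>. coef u \<alpha> * mpow (\<lambda>b. ((1 / d) *\<^sub>R (z - p)) \<bullet> b) \<alpha>) has_sum ev ((1 / d) *\<^sub>R (z - p)) u) UNIV" .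
  ultimately show "((\<lambda>\<alpha>. coef u \<alpha> / d ^ deg \<alpha> * mpow (\<lambda>b. (z - p) \<bullet> b) \<alpha>) has_sum
      ev ((1 / d) *\<^sub>R (z - p)) u) UNIV" by simp
qed

section \<open>Substitution into a power series\<close>

definition subst :: "('a::euclidean_space mindex \<Rightarrow> real) \<Rightarrow>
    ('a \<Rightarrow> 'e::{real_normed_algebra_1, comm_ring_1, banach}) \<Rightarrow> 'e" where
  "subst C Z = (\<Sum>\<^sub>\<infinity>\<alpha>. C \<alpha> *\<^sub>R mpow Z \<alpha>)"

lemma subst_has_sum:
  fixes C :: "'a::euclidean_space mindex \<Rightarrow> real"
    and Z :: "'a \<Rightarrow> 'e::{real_normed_algebra_1, comm_ring_1, banach}"
  assumes C: "(\<lambda>\<alpha>. \<bar>C \<alpha>\<bar> * R ^ deg \<alpha>) summable_on UNIV"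
    and Z: "\<And>b. b \<in> Basis \<Longrightarrow> norm (Z b) \<le> R"
  shows "((\<lambda>\<alpha>. C \<alpha> *\<^sub>R mpow Z \<alpha>) has_sum subst C Z) UNIV"
proof -
  have le: "norm (C \<alpha> *\<^sub>R mpow Z \<alpha>) \<le> \<bar>C \<alpha>\<bar> * R ^ deg \<alpha>" for \<alpha>
    using norm_mpow_le[of Z R \<alpha>] Z by (simp add: mult_left_mono)
  have "(\<lambda>\<alpha>. norm (C \<alpha> *\<^sub>R mpow Z \<alpha>)) summable_on UNIV"
    by (rule summable_on_comparison_test[OF C]) (use le in auto)
  then have "(\<lambda>\<alpha>. C \<alpha> *\<^sub>R mpow Z \<alpha>) summable_on UNIV" by (rule abs_summable_summable)
  then show "((\<lambda>\<alpha>. C \<alpha> *\<^sub>R mpow Z \<alpha>) has_sum subst C Z) UNIV"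
    unfolding subst_def by (rule has_sum_infsum)
qed

text \<open>Every term other than the constant one contains at least one factor of norm at most \<open>r\<close>.\<close>

lemma norm_subst_diff_le:
  fixes C :: "'a::euclidean_space mindex \<Rightarrow> real"
    and Z :: "'a \<Rightarrow> 'e::{real_normed_algebra_1, comm_ring_1, banach}"
  assumes C: "(\<lambda>\<alpha>. \<bar>C \<alpha>\<bar> * R ^ deg \<alpha>) summable_on UNIV" and R: "R > 0"
    and r: "0 \<le> r" "r \<le> R" and Z: "\<And>b. b \<in> Basis \<Longrightarrow> norm (Z b) \<le> r"
  shows "norm (subst C Z - of_real (C 0)) \<le> r / R * (\<Sum>\<^sub>\<infinity>\<alpha>. \<bar>C \<alpha>\<bar> * R ^ deg \<alpha>)"
proof -
  have "((\<lambda>\<alpha>. C \<alpha> *\<^sub>R mpow Z \<alpha>) has_sum subst C Z) UNIV"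
    by (rule subst_has_sum[OF summable_radius_mono[OF C r] Z])
  moreover have "((\<lambda>\<alpha>. (if \<alpha> = 0 then - (C 0 *\<^sub>R 1) else 0 :: 'e)) has_sum - (C 0 *\<^sub>R 1)) UNIV"
    by (rule has_sum_finite_neutralI[of "{0}"]) auto
  ultimately have "((\<lambda>\<alpha>. C \<alpha> *\<^sub>R mpow Z \<alpha> + (if \<alpha> = 0 then - (C 0 *\<^sub>R 1) else 0)) has_sum
      subst C Z + - (C 0 *\<^sub>R 1)) UNIV" by (rule has_sum_add)
  moreover have "((\<lambda>\<alpha>. r / R * (\<bar>C \<alpha>\<bar> * R ^ deg \<alpha>)) has_sum r / R * (\<Sum>\<^sub>\<infinity>\<alpha>. \<bar>C \<alpha>\<bar> * R ^ deg \<alpha>)) UNIV"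
    by (intro has_sum_cmult_right has_sum_infsum C)
  ultimately have "norm (subst C Z + - (C 0 *\<^sub>R 1)) \<le> r / R * (\<Sum>\<^sub>\<infinity>\<alpha>. \<bar>C \<alpha>\<bar> * R ^ deg \<alpha>)"
  proof (rule norm_infsum_le)
    fix \<alpha> :: "'a mindex"
    show "norm (C \<alpha> *\<^sub>R mpow Z \<alpha> + (if \<alpha> = 0 then - (C 0 *\<^sub>R 1) else 0)) \<le> r / R * (\<bar>C \<alpha>\<bar> * R ^ deg \<alpha>)"
    proof (cases "\<alpha> = 0")
      case False
      then have deg: "1 \<le> deg \<alpha>" by (metis One_nat_def Suc_leI deg_eq_0_iff gr0I)
      have "norm (C \<alpha> *\<^sub>R mpow Z \<alpha>) \<le> \<bar>C \<alpha>\<bar> * r ^ deg \<alpha>"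
        using norm_mpow_le[of Z r \<alpha>] Z by (simp add: mult_left_mono)
      also have "r ^ deg \<alpha> = (r / R) ^ deg \<alpha> * R ^ deg \<alpha>" using R by (simp add: power_divide)
      also have "(r / R) ^ deg \<alpha> \<le> (r / R) ^ 1"
        using deg r R by (intro power_decreasing) auto
      finally show ?thesis using False R by (simp add: mult_left_mono mult_right_mono mult.left_commute)
    qed (use r R in auto)
  qed
  then show ?thesis by (simp add: of_real_def)
qed

text \<open>Evaluation is a continuous homomorphism, hence commutes with the series.\<close>

lemma ev_subst:
  fixes p :: "'a::euclidean_space" and W :: "'a \<Rightarrow> 'b::euclidean_space pser"
  assumes e: "expands C R p g" and W: "\<And>b. b \<in> Basis \<Longrightarrow> norm (W b) \<le> R" and z: "z \<in> ebox"
    and evW: "\<And>b. b \<in> Basis \<Longrightarrow> ev z (W b) = (y - p) \<bullet> b"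
  shows "ev z (subst C W) = g y"
proof -
  have "((\<lambda>\<alpha>. ev z (C \<alpha> *\<^sub>R mpow W \<alpha>)) has_sum ev z (subst C W)) UNIV"
    by (rule has_sum_bounded_linear[OF bounded_linear_ev[OF z] subst_has_sum[OF expands_summable[OF e] W]])
  moreover have "ev z (C \<alpha> *\<^sub>R mpow W \<alpha>) = C \<alpha> * mpow (\<lambda>b. (y - p) \<bullet> b) \<alpha>" for \<alpha>
    unfolding ev_scaleR[OF z] ev_mpow[OF z] by (subst mpow_cong[OF evW]) auto
  moreover have "((\<lambda>\<alpha>. C \<alpha> * mpow (\<lambda>b. (y - p) \<bullet> b) \<alpha>) has_sum g y) UNIV"
  proof (rule expands_has_sum[OF e])
    fix b :: 'a assume b: "b \<in> Basis"
    show "\<bar>(y - p) \<bullet> b\<bar> \<le> R"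
      using abs_ev_le[OF z, of "W b"] W[OF b] unfolding evW[OF b] by linarith
  qed
  ultimately show ?thesis using has_sum_unique by auto
qed

text \<open>Near \<open>q\<close>, and in coordinates magnified by \<open>1 / d\<close>, the function \<open>G\<close> is the evaluation of \<open>e d\<close>. The magnified function
tends to the constant \<open>G q\<close>, and the limit is required in the norm of the algebra: it is what turns
the coefficients of a differential equation into constants as \<open>d\<close> tends to \<open>0\<close>.\<close>

definition lifts :: "(real \<Rightarrow> 'a::euclidean_space pser) \<Rightarrow> ('a \<Rightarrow> real) \<Rightarrow> 'a \<Rightarrow> bool" where
  "lifts e G q \<longleftrightarrow> (e \<longlongrightarrow> of_real (G q)) (at_right 0) \<and>
     (\<forall>\<^sub>F d in at_right 0. \<forall>z\<in>ebox. ev z (e d) = G (q + d *\<^sub>R z))"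

lemma lifts_const: "lifts (\<lambda>_. of_real c) (\<lambda>_. c) q"
  by (simp add: lifts_def ev_of_real)

lemma lifts_coord:
  assumes "b \<in> Basis"
  shows "lifts (\<lambda>d. of_real (q \<bullet> b) + d *\<^sub>R Coord b) (\<lambda>z. z \<bullet> b) q"
proof -
  have "((\<lambda>d. of_real (q \<bullet> b) + d *\<^sub>R Coord b) \<longlongrightarrow> of_real (q \<bullet> b) + 0 *\<^sub>R Coord b) (at_right 0)"
    by (intro tendsto_intros) 
  then show ?thesis using assms by (simp add: lifts_def ev_simps ev_Coord inner_add_left)
qed

lemma lifts_add: "lifts e G q \<Longrightarrow> lifts e' G' q \<Longrightarrow> lifts (\<lambda>d. e d + e' d) (\<lambda>z. G z + G' z) q"
proof -
  assume a: "lifts e G q" and b: "lifts e' G' q"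
  then have "\<forall>\<^sub>F d in at_right 0. \<forall>z\<in>ebox. ev z (e d) = G (q + d *\<^sub>R z)"
    "\<forall>\<^sub>F d in at_right 0. \<forall>z\<in>ebox. ev z (e' d) = G' (q + d *\<^sub>R z)"
    by (auto simp: lifts_def)
  then have "\<forall>\<^sub>F d in at_right 0. \<forall>z\<in>ebox. ev z (e d + e' d) = G (q + d *\<^sub>R z) + G' (q + d *\<^sub>R z)"
    by eventually_elim (simp add: ev_simps)
  then show ?thesis using a b by (auto simp: lifts_def intro!: tendsto_add)
qed

lemma lifts_mult: "lifts e G q \<Longrightarrow> lifts e' G' q \<Longrightarrow> lifts (\<lambda>d. e d * e' d) (\<lambda>z. G z * G' z) q"
proof -
  assume a: "lifts e G q" and b: "lifts e' G' q"
  then have "\<forall>\<^sub>F d in at_right 0. \<forall>z\<in>ebox. ev z (e d) = G (q + d *\<^sub>R z)"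
    "\<forall>\<^sub>F d in at_right 0. \<forall>z\<in>ebox. ev z (e' d) = G' (q + d *\<^sub>R z)"
    by (auto simp: lifts_def)
  then have "\<forall>\<^sub>F d in at_right 0. \<forall>z\<in>ebox. ev z (e d * e' d) = G (q + d *\<^sub>R z) * G' (q + d *\<^sub>R z)"
    by eventually_elim (simp add: ev_simps)
  then show ?thesis using a b by (auto simp: lifts_def intro!: tendsto_mult)
qed

text \<open>Substitute the lifts of the components of \<open>H\<close>, shifted by their limits, into the power series of \<open>g\<close> at \<open>H q\<close>.
The shifted lifts tend to \<open>0\<close>, so eventually they lie within the radius of convergence.\<close>

lemma lifts_compose:
  fixes H :: "'b::euclidean_space \<Rightarrow> 'a::euclidean_space"
  assumes g: "analytic_at g (H q)" and Z: "\<And>b. b \<in> Basis \<Longrightarrow> lifts (Z b) (\<lambda>z. H z \<bullet> b) q"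
  shows "\<exists>e. lifts e (\<lambda>z. g (H z)) q"
proof -
  from g obtain C R where e: "expands C R (H q) g" by (auto simp: analytic_at_def)
  note R = expands_pos[OF e] and C = expands_summable[OF e]
  define W where "W d b = Z b d - of_real (H q \<bullet> b)" for d b
  define r where "r d = (\<Sum>b\<in>Basis. norm (W d b))" for d
  define M where "M = (\<Sum>\<^sub>\<infinity>\<alpha>. \<bar>C \<alpha>\<bar> * R ^ deg \<alpha>)"
  have W: "((\<lambda>d. W d b) \<longlongrightarrow> 0) (at_right 0)" if "b \<in> Basis" for b
    unfolding W_def using Z[OF that] by (simp add: lifts_def LIM_zero)
  have "(r \<longlongrightarrow> (\<Sum>b\<in>(Basis :: 'a set). 0)) (at_right 0)"
    unfolding r_def by (intro tendsto_sum tendsto_norm_zero W)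
  then have r: "(r \<longlongrightarrow> 0) (at_right 0)" by simp
  then have ev_r: "\<forall>\<^sub>F d in at_right 0. r d < R" using R by (rule order_tendstoD)
  have W_le: "norm (W d b) \<le> r d" if "b \<in> Basis" for b d
    unfolding r_def by (rule member_le_sum) (use that in auto)
  have r0: "r d \<ge> 0" for d by (simp add: r_def sum_nonneg)
  have "lifts (\<lambda>d. subst C (W d)) (\<lambda>z. g (H z)) q"
    unfolding lifts_def
  proof
    have "((\<lambda>d. r d / R * M) \<longlongrightarrow> 0 / R * M) (at_right 0)"
      by (intro tendsto_intros r) (use R in simp)
    moreover have "\<forall>\<^sub>F d in at_right 0. norm (subst C (W d) - of_real (C 0)) \<le> r d / R * M"
      using ev_r
    proof eventually_elim
      case (elim d)
      then show ?case
        unfolding M_def by (intro norm_subst_diff_le C R r0 W_le) auto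
    qed
    ultimately have "((\<lambda>d. subst C (W d) - of_real (C 0)) \<longlongrightarrow> 0) (at_right 0)"
      by (intro Lim_null_comparison[of "\<lambda>d. subst C (W d) - of_real (C 0)" "\<lambda>d. r d / R * M"]) auto
    then show "((\<lambda>d. subst C (W d)) \<longlongrightarrow> of_real (g (H q))) (at_right 0)"
      by (simp add: expands_center[OF e] LIM_zero_iff)
    have "\<forall>\<^sub>F d in at_right 0. \<forall>b\<in>Basis. \<forall>z\<in>ebox. ev z (Z b d) = H (q + d *\<^sub>R z) \<bullet> b"
      using Z unfolding lifts_def by (intro eventually_ball_finite) auto
    then show "\<forall>\<^sub>F d in at_right 0. \<forall>z\<in>ebox. ev z (subst C (W d)) = g (H (q + d *\<^sub>R z))"
      using ev_r
    proof eventually_elim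
      case (elim d)
      show ?case
      proof
        fix z :: 'b assume z: "z \<in> ebox"
        show "ev z (subst C (W d)) = g (H (q + d *\<^sub>R z))"
        proof (rule ev_subst[OF e _ z])
          fix b :: 'a assume b: "b \<in> Basis"
          show "norm (W d b) \<le> R" using W_le[OF b, of d] elim by simp
          show "ev z (W d b) = (H (q + d *\<^sub>R z) - H q) \<bullet> b"
            using elim z b by (simp add: W_def ev_simps inner_diff_left)
        qed
      qed
    qed
  qed
  then show ?thesis by blast
qed

lemma expands_cong:
  assumes "expands C R p g" "\<And>z. (\<And>b. b \<in> Basis \<Longrightarrow> \<bar>(z - p) \<bullet> b\<bar> \<le> R) \<Longrightarrow> g z = g' z"
  shows "expands C R p g'"
  using assms unfolding expands_def by metis

lemma analytic_at_if_ev: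
  fixes G :: "'a::euclidean_space \<Rightarrow> real"
  assumes "\<forall>\<^sub>F d in at_right 0. \<forall>z\<in>ebox. ev z (e d) = G (q + d *\<^sub>R z)"
  shows "analytic_at G q"
proof -
  have "\<forall>\<^sub>F d in at_right 0. (0::real) < d" by (simp add: eventually_at_right_less)
  with assms have "\<forall>\<^sub>F d in at_right 0. (0::real) < d \<and> (\<forall>z\<in>ebox. ev z (e d) = G (q + d *\<^sub>R z))"
    by eventually_elim simp
  then have "\<exists>d. (0::real) < d \<and> (\<forall>z\<in>ebox. ev z (e d) = G (q + d *\<^sub>R z))"
    by (rule eventually_happens'[rotated]) simp
  then obtain d where d: "d > 0" "\<And>z. z \<in> ebox \<Longrightarrow> ev z (e d) = G (q + d *\<^sub>R z)"
    by blast
  have "expands (\<lambda>\<alpha>. coef (e d) \<alpha> / d ^ deg \<alpha>) (d / DIM('a)) q G"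
  proof (rule expands_cong[OF expands_ev[OF d(1)]])
    fix z assume "\<And>b. b \<in> Basis \<Longrightarrow> \<bar>(z - q) \<bullet> b\<bar> \<le> d / DIM('a)"
    then have "(1 / d) *\<^sub>R (z - q) \<in> ebox" using d(1) by (intro scaled_in_ebox) auto
    from d(2)[OF this] show "ev ((1 / d) *\<^sub>R (z - q)) (e d) = G z" using d(1) by simp
  qed
  then show ?thesis by (auto simp: analytic_at_def)
qed

lemma lifts_imp_analytic: "lifts e G q \<Longrightarrow> analytic_at G q"
  by (rule analytic_at_if_ev[of e]) (simp add: lifts_def)

text \<open>One direction lifts the composition with the identity, whose components lift to the coordinates.\<close>

lemma analytic_at_iff_lifts: "analytic_at G q \<longleftrightarrow> (\<exists>e. lifts e G q)"
  using lifts_imp_analytic lifts_compose[of G "\<lambda>z. z" q, OF _ lifts_coord] by blast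

lemma analytic_at_const [simp]: "analytic_at (\<lambda>_. c) q"
  using lifts_const lifts_imp_analytic by blast

lemma analytic_at_coord: "b \<in> Basis \<Longrightarrow> analytic_at (\<lambda>z. z \<bullet> b) q"
  using lifts_coord lifts_imp_analytic by blast

lemma analytic_at_add: "analytic_at f q \<Longrightarrow> analytic_at g q \<Longrightarrow> analytic_at (\<lambda>z. f z + g z) q"
  unfolding analytic_at_iff_lifts using lifts_add by blast

lemma analytic_at_mult: "analytic_at f q \<Longrightarrow> analytic_at g q \<Longrightarrow> analytic_at (\<lambda>z. f z * g z) q"
  unfolding analytic_at_iff_lifts using lifts_mult by blast

lemma analytic_at_minus: "analytic_at f q \<Longrightarrow> analytic_at (\<lambda>z. - f z) q"
  using analytic_at_mult[OF analytic_at_const[of "-1"]] by simp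

lemma analytic_at_diff: "analytic_at f q \<Longrightarrow> analytic_at g q \<Longrightarrow> analytic_at (\<lambda>z. f z - g z) q"
  using analytic_at_add[OF _ analytic_at_minus] by fastforce

lemma analytic_at_power: "analytic_at f q \<Longrightarrow> analytic_at (\<lambda>z. f z ^ n) q"
  by (induction n) (simp_all add: analytic_at_mult)

lemma analytic_at_sum: "(\<And>i. i \<in> I \<Longrightarrow> analytic_at (f i) q) \<Longrightarrow> analytic_at (\<lambda>z. \<Sum>i\<in>I. f i z) q"
  by (induction I rule: infinite_finite_induct) (simp_all add: analytic_at_add)

lemma analytic_at_compose:
  assumes "analytic_at g (H q)" "\<And>b. b \<in> Basis \<Longrightarrow> analytic_at (\<lambda>z. H z \<bullet> b) q"
  shows "analytic_at (\<lambda>z. g (H z)) q"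
proof -
  from assms(2) obtain Z where "\<And>b. b \<in> Basis \<Longrightarrow> lifts (Z b) (\<lambda>z. H z \<bullet> b) q"
    unfolding analytic_at_iff_lifts by metis
  from lifts_compose[OF assms(1) this] show ?thesis unfolding analytic_at_iff_lifts by blast
qed

text \<open>The series in the shifted variables \<open>p' - p + (R / 2) w\<close> is again an element of the algebra. Its radius
depends on \<open>R\<close> only and not on the new center; the gluing of local solutions relies on this.\<close>

lemma expands_recenter:
  fixes p :: "'a::euclidean_space"
  assumes e: "expands C R p g" and p': "\<And>b. b \<in> Basis \<Longrightarrow> \<bar>(p' - p) \<bullet> b\<bar> \<le> R / 2"
  shows "\<exists>C'. expands C' (R / (2 * DIM('a))) p' g"
proof -
  note R = expands_pos[OF e]
  define W where "W b = of_real ((p' - p) \<bullet> b) + (R / 2) *\<^sub>R Coord b" for b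
  have W_R: "norm (W b) \<le> R" if "b \<in> Basis" for b
  proof -
    have "norm (W b) \<le> \<bar>(p' - p) \<bullet> b\<bar> + R / 2 * norm (Coord b)"
      unfolding W_def using R by (intro order_trans[OF norm_triangle_ineq]) auto
    also have "\<dots> \<le> R / 2 + R / 2 * 1" using R by (intro add_mono p' that mult_left_mono norm_Coord_le) auto
    finally show ?thesis by simp
  qed
  have ev_g: "ev z (subst C W) = g (p' + (R / 2) *\<^sub>R z)" if z: "z \<in> ebox" for z
    by (rule ev_subst[OF e W_R z])
      (use z in \<open>simp_all add: W_def ev_simps ev_Coord inner_diff_left inner_add_left\<close>)
  have "expands (\<lambda>\<alpha>. coef (subst C W) \<alpha> / (R / 2) ^ deg \<alpha>) (R / 2 / DIM('a)) p' g"
  proof (rule expands_cong[OF expands_ev])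
    fix z assume "\<And>b. b \<in> Basis \<Longrightarrow> \<bar>(z - p') \<bullet> b\<bar> \<le> R / 2 / DIM('a)"
    then have "(1 / (R / 2)) *\<^sub>R (z - p') \<in> ebox"
      using R by (intro scaled_in_ebox) auto
    from ev_g[OF this] show "ev ((1 / (R / 2)) *\<^sub>R (z - p')) (subst C W) = g z" using R by simp
  qed (use R in simp)
  then show ?thesis by (auto simp: field_simps)
qed

section \<open>Termwise differentiation\<close>

definition dir_deriv :: "'a::real_normed_vector \<Rightarrow> ('a \<Rightarrow> real) \<Rightarrow> 'a \<Rightarrow> real" where
  "dir_deriv b g z = deriv (\<lambda>h. g (z + h *\<^sub>R b)) 0"

lemma dir_deriv_eqI: "((\<lambda>h. g (z + h *\<^sub>R b)) has_real_derivative D) (at 0) \<Longrightarrow> dir_deriv b g z = D"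
  unfolding dir_deriv_def by (rule DERIV_imp_deriv)

text \<open>The remainder contains only binomial terms of order at least two in \<open>h\<close>. Comparing it with the remainder for \<open>\<bar>w\<bar>\<close> and
\<open>\<rho>\<close>, where all terms are nonnegative, gives the factor \<open>(h / \<rho>)\<^sup>2\<close> uniformly in \<open>n\<close>.\<close>

lemma power_remainder_le:
  fixes w h \<rho> :: real
  assumes "\<rho> > 0" "\<bar>h\<bar> \<le> \<rho>"
  shows "\<bar>(w + h) ^ n - w ^ n - real n * h * w ^ (n - 1)\<bar>
    \<le> (h / \<rho>)\<^sup>2 * ((\<bar>w\<bar> + \<rho>) ^ n - \<bar>w\<bar> ^ n - real n * \<rho> * \<bar>w\<bar> ^ (n - 1))"
proof (induction n)
  case (Suc n)
  define E where "E = (w + h) ^ n - w ^ n - real n * h * w ^ (n - 1)"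
  define E' where "E' = (\<bar>w\<bar> + \<rho>) ^ n - \<bar>w\<bar> ^ n - real n * \<rho> * \<bar>w\<bar> ^ (n - 1)"
  have "(w + h) ^ Suc n - w ^ Suc n - real (Suc n) * h * w ^ (Suc n - 1) = (w + h) * E + real n * w ^ (n - 1) * h\<^sup>2"
    unfolding E_def by (cases n) (simp_all add: power2_eq_square algebra_simps)
  also have "\<bar>\<dots>\<bar> \<le> (\<bar>w\<bar> + \<rho>) * \<bar>E\<bar> + real n * \<bar>w\<bar> ^ (n - 1) * h\<^sup>2"
  proof -
    have "\<bar>(w + h) * E\<bar> \<le> (\<bar>w\<bar> + \<rho>) * \<bar>E\<bar>"
      unfolding abs_mult using assms by (intro mult_right_mono) auto
    moreover have "\<bar>real n * w ^ (n - 1) * h\<^sup>2\<bar> = real n * \<bar>w\<bar> ^ (n - 1) * h\<^sup>2"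
      by (simp add: abs_mult power_abs)
    ultimately show ?thesis by linarith
  qed
  also have "\<dots> \<le> (\<bar>w\<bar> + \<rho>) * ((h / \<rho>)\<^sup>2 * E') + real n * \<bar>w\<bar> ^ (n - 1) * h\<^sup>2"
    using Suc assms unfolding E_def E'_def by (intro add_mono mult_left_mono) auto
  also have "\<dots> = (h / \<rho>)\<^sup>2 * ((\<bar>w\<bar> + \<rho>) * E' + real n * \<bar>w\<bar> ^ (n - 1) * \<rho>\<^sup>2)"
    using assms by (simp add: field_simps)
  also have "(\<bar>w\<bar> + \<rho>) * E' + real n * \<bar>w\<bar> ^ (n - 1) * \<rho>\<^sup>2
      = (\<bar>w\<bar> + \<rho>) ^ Suc n - \<bar>w\<bar> ^ Suc n - real (Suc n) * \<rho> * \<bar>w\<bar> ^ (Suc n - 1)"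
    unfolding E'_def by (cases n) (simp_all add: power2_eq_square algebra_simps)
  finally show ?case .
qed simp

text \<open>The right hand side of the preceding estimate is nonnegative.\<close>

lemma power_derivative_le:
  fixes w \<rho> :: real
  assumes "\<rho> > 0"
  shows "real n * \<bar>w\<bar> ^ (n - 1) * \<rho> \<le> (\<bar>w\<bar> + \<rho>) ^ n"
proof -
  have "0 \<le> \<bar>(w + \<rho>) ^ n - w ^ n - real n * \<rho> * w ^ (n - 1)\<bar>" by simp
  also have "\<dots> \<le> (\<rho> / \<rho>)\<^sup>2 * ((\<bar>w\<bar> + \<rho>) ^ n - \<bar>w\<bar> ^ n - real n * \<rho> * \<bar>w\<bar> ^ (n - 1))"
    using assms by (intro power_remainder_le) auto
  finally have "0 \<le> (\<bar>w\<bar> + \<rho>) ^ n - \<bar>w\<bar> ^ n - real n * \<rho> * \<bar>w\<bar> ^ (n - 1)" using assms by simp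
  moreover have "0 \<le> \<bar>w\<bar> ^ n" by simp
  moreover have "real n * \<bar>w\<bar> ^ (n - 1) * \<rho> = real n * \<rho> * \<bar>w\<bar> ^ (n - 1)" by (simp add: ac_simps)
  ultimately show ?thesis by linarith
qed

lemma mpow_split:
  assumes "b \<in> Basis"
  shows "mpow Z \<alpha> = Z b ^ expo \<alpha> b * mpow (Z(b := 1)) \<alpha>"
proof -
  have "mpow (Z(b := 1)) \<alpha> = (\<Prod>c\<in>Basis - {b}. Z c ^ expo \<alpha> c)"
    unfolding mpow_def prod.remove[OF finite_Basis assms] by (auto intro!: prod.cong)
  then show ?thesis unfolding mpow_def[of Z] prod.remove[OF finite_Basis assms] by simp
qed

lemma inj_plus_index: "inj (\<lambda>\<alpha> :: 'a::euclidean_space mindex. \<alpha> + \<beta>)"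
  by (rule injI) simp

definition dcoef :: "'a \<Rightarrow> ('a::euclidean_space mindex \<Rightarrow> real) \<Rightarrow> 'a mindex \<Rightarrow> real" where
  "dcoef b C \<alpha> = (real (expo \<alpha> b) + 1) * C (\<alpha> + unit_index b)"

lemma dcoef_summable:
  fixes C :: "'a::euclidean_space mindex \<Rightarrow> real"
  assumes C: "(\<lambda>\<alpha>. \<bar>C \<alpha>\<bar> * R ^ deg \<alpha>) summable_on UNIV" and r: "0 < r" "r < R" and b: "b \<in> Basis"
  shows "(\<lambda>\<alpha>. \<bar>dcoef b C \<alpha>\<bar> * r ^ deg \<alpha>) summable_on UNIV"
proof -
  have "(\<lambda>\<alpha>. \<bar>C \<alpha>\<bar> * R ^ deg \<alpha>) summable_on range (\<lambda>\<alpha>. \<alpha> + unit_index b)"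
    using C by (rule summable_on_subset_banach) auto
  then have "(\<lambda>\<alpha>. \<bar>C (\<alpha> + unit_index b)\<bar> * R ^ deg (\<alpha> + unit_index b)) summable_on UNIV"
    by (subst (asm) summable_on_reindex[OF inj_plus_index]) (simp add: o_def)
  then have "(\<lambda>\<alpha>. 1 / (R - r) * (\<bar>C (\<alpha> + unit_index b)\<bar> * R ^ deg (\<alpha> + unit_index b))) summable_on UNIV"
    by (rule summable_on_cmult_right)
  then show ?thesis
  proof (rule summable_on_comparison_test)
    fix \<alpha> :: "'a mindex"
    have "(real (expo \<alpha> b) + 1) * r ^ deg \<alpha> * (R - r) \<le> real (deg \<alpha> + 1) * r ^ (deg \<alpha> + 1 - 1) * (R - r)"
      using expo_le_deg[OF b, of \<alpha>] r by (intro mult_right_mono) auto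
    also have "\<dots> \<le> R ^ (deg \<alpha> + 1)"
      using power_derivative_le[of "R - r" "deg \<alpha> + 1" r] r by simp
    finally have "(real (expo \<alpha> b) + 1) * r ^ deg \<alpha> \<le> R ^ (deg \<alpha> + 1) / (R - r)"
      using r by (simp add: field_simps)
    then have "\<bar>C (\<alpha> + unit_index b)\<bar> * ((real (expo \<alpha> b) + 1) * r ^ deg \<alpha>)
        \<le> \<bar>C (\<alpha> + unit_index b)\<bar> * (R ^ (deg \<alpha> + 1) / (R - r))"
      by (rule mult_left_mono) simp
    then show "\<bar>dcoef b C \<alpha>\<bar> * r ^ deg \<alpha>
        \<le> 1 / (R - r) * (\<bar>C (\<alpha> + unit_index b)\<bar> * R ^ deg (\<alpha> + unit_index b))"
      using b by (simp add: dcoef_def abs_mult ac_simps)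
  qed (use r in auto)
qed

text \<open>The remainders of the terms add up to at most \<open>(h / \<rho>)\<^sup>2\<close> times the absolute sum of the series at radius \<open>R\<close>.\<close>

lemma expands_DERIV:
  fixes p :: "'a::euclidean_space"
  assumes e: "expands C R p g" and r: "0 < r" "r < R" and b: "b \<in> Basis"
    and z: "\<And>c. c \<in> Basis \<Longrightarrow> \<bar>(z - p) \<bullet> c\<bar> \<le> r"
    and S: "((\<lambda>\<alpha>. dcoef b C \<alpha> * mpow (\<lambda>c. (z - p) \<bullet> c) \<alpha>) has_sum S) UNIV"
  shows "((\<lambda>h. g (z + h *\<^sub>R b)) has_real_derivative S) (at 0)"
proof -
  \<comment> \<open>The room between the point and the boundary of the box bounds the increments.\<close>
  define \<rho> where "\<rho> = R - r"
  have \<rho>: "\<rho> > 0" using r by (simp add: \<rho>_def)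
  define w where "w c = (z - p) \<bullet> c" for c
  define Q where "Q \<alpha> = C \<alpha> * mpow (w(b := 1)) \<alpha>" for \<alpha>
  define M where "M = (\<Sum>\<^sub>\<infinity>\<alpha>. \<bar>C \<alpha>\<bar> * R ^ deg \<alpha>)"
  \<comment> \<open>The termwise derivatives, indexed by the exponents before differentiation; those with exponent \<open>0\<close> vanish.\<close>
  have "((\<lambda>\<alpha>. Q \<alpha> * (real (expo \<alpha> b) * w b ^ (expo \<alpha> b - 1))) has_sum S) UNIV
      \<longleftrightarrow> ((\<lambda>\<alpha>. Q \<alpha> * (real (expo \<alpha> b) * w b ^ (expo \<alpha> b - 1))) has_sum S) (range (\<lambda>\<alpha>. \<alpha> + unit_index b))"
  proof (rule has_sum_cong_neutral)
    fix \<alpha> assume "\<alpha> \<in> UNIV - range (\<lambda>\<alpha>. \<alpha> + unit_index b)"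
    then have "expo \<alpha> b = 0" using unit_index_decompose[OF b, of \<alpha>] by (metis DiffD2 gr0I rangeI)
    then show "Q \<alpha> * (real (expo \<alpha> b) * w b ^ (expo \<alpha> b - 1)) = 0" by simp
  qed auto
  also have "\<dots> \<longleftrightarrow> ((\<lambda>\<alpha>. dcoef b C \<alpha> * mpow w \<alpha>) has_sum S) UNIV"
    unfolding has_sum_reindex[OF inj_plus_index]
    by (rule has_sum_cong) 
      (use b in \<open>simp add: Q_def dcoef_def mpow_plus mpow_split[OF b, of w]\<close>)
  finally have D: "((\<lambda>\<alpha>. Q \<alpha> * (real (expo \<alpha> b) * w b ^ (expo \<alpha> b - 1))) has_sum S) UNIV"
    using S unfolding w_def by blast
  have wb: "\<bar>w b\<bar> + \<rho> \<le> R" using z[OF b] by (simp add: w_def \<rho>_def)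
  have remainder: "\<bar>g (z + h *\<^sub>R b) - g z - h * S\<bar> \<le> (h / \<rho>)\<^sup>2 * M" if h: "\<bar>h\<bar> \<le> \<rho>" for h
  proof -
    have term_eq: "C \<alpha> * mpow (\<lambda>c. (z + x *\<^sub>R b - p) \<bullet> c) \<alpha> = Q \<alpha> * (w b + x) ^ expo \<alpha> b" for \<alpha> x
    proof -
      have "mpow (\<lambda>c. (z + x *\<^sub>R b - p) \<bullet> c) \<alpha> = mpow (w(b := w b + x)) \<alpha>"
        by (rule mpow_cong) (use b in \<open>auto simp: w_def algebra_simps inner_Basis\<close>)
      also have "\<dots> = (w b + x) ^ expo \<alpha> b * mpow (w(b := 1)) \<alpha>"
        by (subst mpow_split[OF b]) simp
      finally show ?thesis by (simp add: Q_def)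
    qed
    have hs: "((\<lambda>\<alpha>. Q \<alpha> * (w b + x) ^ expo \<alpha> b) has_sum g (z + x *\<^sub>R b)) UNIV" if "\<bar>x\<bar> \<le> \<rho>" for x
      unfolding term_eq[symmetric]
    proof (rule expands_has_sum[OF e])
      fix c :: 'a assume c: "c \<in> Basis"
      have "\<bar>x *\<^sub>R b \<bullet> c\<bar> \<le> \<bar>x\<bar>" using b c by (simp add: inner_Basis)
      moreover have "(z + x *\<^sub>R b - p) \<bullet> c = (z - p) \<bullet> c + x *\<^sub>R b \<bullet> c" by (simp add: algebra_simps)
      ultimately show "\<bar>(z + x *\<^sub>R b - p) \<bullet> c\<bar> \<le> R" using z[OF c] that by (simp add: \<rho>_def)
    qed
    have "((\<lambda>\<alpha>. Q \<alpha> * (w b + h) ^ expo \<alpha> b + - (Q \<alpha> * (w b + 0) ^ expo \<alpha> b)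
        + - h * (Q \<alpha> * (real (expo \<alpha> b) * w b ^ (expo \<alpha> b - 1)))) has_sum
        g (z + h *\<^sub>R b) + - g (z + 0 *\<^sub>R b) + - h * S) UNIV"
      by (intro has_sum_add has_sum_cmult_right D hs has_sum_uminusI h) (use \<rho> in auto)
    moreover have "((\<lambda>\<alpha>. (h / \<rho>)\<^sup>2 * (\<bar>C \<alpha>\<bar> * R ^ deg \<alpha>)) has_sum (h / \<rho>)\<^sup>2 * M) UNIV"
      unfolding M_def by (intro has_sum_cmult_right has_sum_infsum expands_summable[OF e])
    ultimately have "norm (g (z + h *\<^sub>R b) + - g (z + 0 *\<^sub>R b) + - h * S) \<le> (h / \<rho>)\<^sup>2 * M"
    proof (rule norm_infsum_le)
      fix \<alpha> :: "'a mindex"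
      let ?n = "expo \<alpha> b"
      have "norm (Q \<alpha> * (w b + h) ^ ?n + - (Q \<alpha> * (w b + 0) ^ ?n) + - h * (Q \<alpha> * (real ?n * w b ^ (?n - 1))))
          = \<bar>Q \<alpha>\<bar> * \<bar>(w b + h) ^ ?n - w b ^ ?n - real ?n * h * w b ^ (?n - 1)\<bar>"
        by (simp add: algebra_simps flip: abs_mult)
      also have "\<dots> \<le> \<bar>Q \<alpha>\<bar> * ((h / \<rho>)\<^sup>2 * (\<bar>w b\<bar> + \<rho>) ^ ?n)"
      proof (intro mult_left_mono)
        have "(\<bar>w b\<bar> + \<rho>) ^ ?n - \<bar>w b\<bar> ^ ?n - real ?n * \<rho> * \<bar>w b\<bar> ^ (?n - 1) \<le> (\<bar>w b\<bar> + \<rho>) ^ ?n"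
        proof -
          have "0 \<le> \<bar>w b\<bar> ^ ?n" "0 \<le> real ?n * \<rho> * \<bar>w b\<bar> ^ (?n - 1)" using \<rho> by simp_all
          then show ?thesis by linarith
        qed
        from order_trans[OF power_remainder_le[OF \<rho> h] mult_left_mono[OF this]]
        show "\<bar>(w b + h) ^ ?n - w b ^ ?n - real ?n * h * w b ^ (?n - 1)\<bar> \<le> (h / \<rho>)\<^sup>2 * (\<bar>w b\<bar> + \<rho>) ^ ?n"
          by simp
      qed simp
      also have "\<dots> = (h / \<rho>)\<^sup>2 * (\<bar>C \<alpha>\<bar> * \<bar>mpow (w(b := \<bar>w b\<bar> + \<rho>)) \<alpha>\<bar>)"
      proof -
        have "mpow (w(b := \<bar>w b\<bar> + \<rho>)) \<alpha> = (\<bar>w b\<bar> + \<rho>) ^ ?n * mpow (w(b := 1)) \<alpha>"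
          by (subst mpow_split[OF b]) simp
        then show ?thesis using \<rho> by (simp add: Q_def abs_mult)
      qed
      also have "\<dots> \<le> (h / \<rho>)\<^sup>2 * (\<bar>C \<alpha>\<bar> * R ^ deg \<alpha>)"
      proof (intro mult_left_mono)
        have "norm (mpow (w(b := \<bar>w b\<bar> + \<rho>)) \<alpha>) \<le> R ^ deg \<alpha>"
        proof (rule norm_mpow_le)
          fix c :: 'a assume "c \<in> Basis"
          then show "norm ((w(b := \<bar>w b\<bar> + \<rho>)) c) \<le> R" using wb \<rho> z[of c] r by (auto simp: w_def)
        qed
        then show "\<bar>mpow (w(b := \<bar>w b\<bar> + \<rho>)) \<alpha>\<bar> \<le> R ^ deg \<alpha>" by simp
      qed auto
      finally show "norm (Q \<alpha> * (w b + h) ^ ?n + - (Q \<alpha> * (w b + 0) ^ ?n)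
          + - h * (Q \<alpha> * (real ?n * w b ^ (?n - 1)))) \<le> (h / \<rho>)\<^sup>2 * (\<bar>C \<alpha>\<bar> * R ^ deg \<alpha>)" .
    qed
    then show ?thesis by simp
  qed
  have "((\<lambda>h. (g (z + (0 + h) *\<^sub>R b) - g (z + 0 *\<^sub>R b)) / h - S) \<longlongrightarrow> 0) (at 0)"
  proof (rule Lim_null_comparison)
    have "((\<lambda>h. \<bar>h\<bar> * (M / \<rho>\<^sup>2)) \<longlongrightarrow> \<bar>0\<bar> * (M / \<rho>\<^sup>2)) (at 0)" by (intro tendsto_intros) 
    then show "((\<lambda>h. \<bar>h\<bar> * (M / \<rho>\<^sup>2)) \<longlongrightarrow> 0) (at 0)" by simp
    have "\<forall>\<^sub>F h in at 0. \<bar>h\<bar> < \<rho> \<and> h \<noteq> 0"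
      using \<rho> unfolding eventually_at by (auto intro!: exI[of _ \<rho>])
    then show "\<forall>\<^sub>F h in at 0. norm ((g (z + (0 + h) *\<^sub>R b) - g (z + 0 *\<^sub>R b)) / h - S) \<le> \<bar>h\<bar> * (M / \<rho>\<^sup>2)"
    proof eventually_elim
      case (elim h)
      then have "norm ((g (z + (0 + h) *\<^sub>R b) - g (z + 0 *\<^sub>R b)) / h - S)
          = \<bar>g (z + h *\<^sub>R b) - g z - h * S\<bar> / \<bar>h\<bar>"
        by (simp add: field_simps flip: abs_divide)
      also have "\<dots> \<le> (h / \<rho>)\<^sup>2 * M / \<bar>h\<bar>"
        using elim by (intro divide_right_mono remainder) auto
      also have "\<dots> = \<bar>h\<bar> * (M / \<rho>\<^sup>2)"
        using elim by (simp add: power_divide field_simps power2_eq_square) (simp add: abs_if)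
      finally show ?case .
    qed
  qed
  then show ?thesis by (simp add: has_field_derivative_iff LIM_zero_iff)
qed

lemma expands_dir_deriv:
  assumes e: "expands C R p g" and r: "0 < r" "r < R" and b: "b \<in> Basis"
  shows "expands (dcoef b C) r p (dir_deriv b g)"
    and "\<And>z. (\<And>c. c \<in> Basis \<Longrightarrow> \<bar>(z - p) \<bullet> c\<bar> \<le> r) \<Longrightarrow>
      ((\<lambda>h. g (z + h *\<^sub>R b)) has_real_derivative dir_deriv b g z) (at 0)"
proof -
  note s = dcoef_summable[OF expands_summable[OF e] r b]
  have *: "((\<lambda>\<alpha>. dcoef b C \<alpha> * mpow (\<lambda>c. (z - p) \<bullet> c) \<alpha>) has_sum dir_deriv b g z) UNIV"
    "((\<lambda>h. g (z + h *\<^sub>R b)) has_real_derivative dir_deriv b g z) (at 0)"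
    if z: "\<And>c. c \<in> Basis \<Longrightarrow> \<bar>(z - p) \<bullet> c\<bar> \<le> r" for z
  proof -
    have "((\<lambda>\<alpha>. dcoef b C \<alpha> *\<^sub>R mpow (\<lambda>c. (z - p) \<bullet> c) \<alpha>) has_sum subst (dcoef b C) (\<lambda>c. (z - p) \<bullet> c)) UNIV"
      by (rule subst_has_sum[OF s]) (use z in auto)
    then have S: "((\<lambda>\<alpha>. dcoef b C \<alpha> * mpow (\<lambda>c. (z - p) \<bullet> c) \<alpha>) has_sum subst (dcoef b C) (\<lambda>c. (z - p) \<bullet> c)) UNIV"
      by simp
    note D = expands_DERIV[OF e r b z S]
    show "((\<lambda>\<alpha>. dcoef b C \<alpha> * mpow (\<lambda>c. (z - p) \<bullet> c) \<alpha>) has_sum dir_deriv b g z) UNIV"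
      using S dir_deriv_eqI[OF D] by simp
    show "((\<lambda>h. g (z + h *\<^sub>R b)) has_real_derivative dir_deriv b g z) (at 0)"
      using D dir_deriv_eqI[OF D] by simp
  qed
  show "expands (dcoef b C) r p (dir_deriv b g)"
    unfolding expands_def using s r *(1) by blast
  show "\<And>z. (\<And>c. c \<in> Basis \<Longrightarrow> \<bar>(z - p) \<bullet> c\<bar> \<le> r) \<Longrightarrow>
      ((\<lambda>h. g (z + h *\<^sub>R b)) has_real_derivative dir_deriv b g z) (at 0)"
    by (rule *(2))
qed

lemma analytic_at_dir_deriv: "analytic_at g p \<Longrightarrow> b \<in> Basis \<Longrightarrow> analytic_at (dir_deriv b g) p"
  using expands_dir_deriv(1)[of _ _ p g _ b] expands_pos unfolding analytic_at_def
  by (metis dense)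

lemma analytic_at_DERIV:
  assumes "analytic_at g p" "b \<in> Basis"
  shows "((\<lambda>h. g (p + h *\<^sub>R b)) has_real_derivative dir_deriv b g p) (at 0)"
proof -
  from assms(1) obtain C R where e: "expands C R p g" by (auto simp: analytic_at_def)
  show ?thesis
    by (rule expands_dir_deriv(2)[OF e _ _ assms(2), of "R / 2"]) (use expands_pos[OF e] in auto)
qed

lemma dir_deriv_center: "expands C R p g \<Longrightarrow> b \<in> Basis \<Longrightarrow> dir_deriv b g p = C (unit_index b)"
  using expands_center[OF expands_dir_deriv(1)[of C R p g "R / 2" b]] expands_pos[of C R p g]
  by (simp add: dcoef_def)

text \<open>Both sides equal the same multiple of the coefficient of the monomial in the directions \<open>b\<close> and \<open>c\<close>.\<close>

lemma dir_deriv_commute: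
  assumes g: "analytic_at g p" and b: "b \<in> Basis" "c \<in> Basis"
  shows "dir_deriv b (dir_deriv c g) p = dir_deriv c (dir_deriv b g) p"
proof -
  from g obtain C R where e: "expands C R p g" by (auto simp: analytic_at_def)
  have *: "dir_deriv b (dir_deriv c g) p = (if b = c then 2 else 1) * C (unit_index b + unit_index c)"
    if "b \<in> Basis" "c \<in> Basis" for b c
    using dir_deriv_center[OF expands_dir_deriv(1)[OF e, of "R / 2" c] that(1)] expands_pos[OF e] that
    by (auto simp: dcoef_def)
  show ?thesis unfolding *[OF b] *[OF b(2) b(1)] by (simp add: add.commute)
qed

text \<open>At the center of an expansion, the terms of degree at least two are bounded by a multiple of the squared distance.\<close>

lemma analytic_at_has_derivative:
  fixes p :: "'a::euclidean_space"
  assumes "analytic_at g p"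
  shows "(g has_derivative (\<lambda>z. \<Sum>b\<in>Basis. dir_deriv b g p * (z \<bullet> b))) (at p)"
proof -
  from assms obtain C R where e: "expands C R p g" by (auto simp: analytic_at_def)
  note R = expands_pos[OF e] and s = expands_summable[OF e]
  define M where "M = (\<Sum>\<^sub>\<infinity>\<alpha>. \<bar>C \<alpha>\<bar> * R ^ deg \<alpha>)"
  \<comment> \<open>The multi-indices of degree at most one.\<close>
  define L where "L = insert 0 (unit_index ` (Basis :: 'a set))"
  have inj: "inj_on unit_index (Basis :: 'a set)"
    by (rule inj_onI) (metis expo_unit_index zero_neq_one)
  have not0: "0 \<notin> unit_index ` (Basis :: 'a set)"
  proof
    assume "0 \<in> unit_index ` (Basis :: 'a set)"
    then obtain b :: 'a where "b \<in> Basis" "0 = unit_index b" by blast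
    then show False by (metis deg_0 deg_unit_index zero_neq_one)
  qed
  have deg_L: "\<alpha> \<in> L" if "deg \<alpha> \<le> 1" for \<alpha> :: "'a mindex"
  proof (cases "deg \<alpha> = 0")
    case True
    then have "\<alpha> = 0" by simp
    then show ?thesis by (simp add: L_def)
  next
    case False
    then have "(\<Sum>b\<in>Basis. expo \<alpha> b) \<noteq> 0" by (metis deg_def)
    then obtain b where b: "b \<in> Basis" "expo \<alpha> b > 0" by (metis gr0I sum.neutral)
    have "deg (\<alpha> - unit_index b) = 0"
      using arg_cong[OF unit_index_decompose[OF b], of deg] that b(1)
      unfolding deg_plus deg_unit_index[OF b(1)] by linarith
    then have "\<alpha> = unit_index b" using unit_index_decompose[OF b] by simp
    then show ?thesis using b by (simp add: L_def)
  qed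
  have bound: "\<bar>g y - g p - (\<Sum>b\<in>Basis. dir_deriv b g p * ((y - p) \<bullet> b))\<bar> \<le> (norm (y - p) / R)\<^sup>2 * M"
    if y: "norm (y - p) \<le> R" for y
  proof -
    let ?m = "mpow (\<lambda>b. (y - p) \<bullet> b)"
    have comp: "\<bar>(y - p) \<bullet> b\<bar> \<le> norm (y - p)" if "b \<in> Basis" for b by (rule Basis_le_norm[OF that])
    have "((\<lambda>\<alpha>. C \<alpha> * ?m \<alpha>) has_sum g y) UNIV"
      by (rule expands_has_sum[OF e]) (use comp y in \<open>force intro: order_trans\<close>)
    moreover have "((\<lambda>\<alpha>. if \<alpha> \<in> L then - (C \<alpha> * ?m \<alpha>) else 0) has_sum (\<Sum>\<alpha>\<in>L. - (C \<alpha> * ?m \<alpha>))) UNIV"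
      by (rule has_sum_finite_neutralI[of L]) (auto simp: L_def)
    ultimately have "((\<lambda>\<alpha>. C \<alpha> * ?m \<alpha> + (if \<alpha> \<in> L then - (C \<alpha> * ?m \<alpha>) else 0)) has_sum
        g y + (\<Sum>\<alpha>\<in>L. - (C \<alpha> * ?m \<alpha>))) UNIV" by (rule has_sum_add)
    moreover have "((\<lambda>\<alpha>. (norm (y - p) / R)\<^sup>2 * (\<bar>C \<alpha>\<bar> * R ^ deg \<alpha>)) has_sum (norm (y - p) / R)\<^sup>2 * M) UNIV"
      unfolding M_def by (intro has_sum_cmult_right has_sum_infsum s)
    ultimately have "norm (g y + (\<Sum>\<alpha>\<in>L. - (C \<alpha> * ?m \<alpha>))) \<le> (norm (y - p) / R)\<^sup>2 * M"
    proof (rule norm_infsum_le)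
      fix \<alpha> :: "'a mindex"
      show "norm (C \<alpha> * ?m \<alpha> + (if \<alpha> \<in> L then - (C \<alpha> * ?m \<alpha>) else 0))
          \<le> (norm (y - p) / R)\<^sup>2 * (\<bar>C \<alpha>\<bar> * R ^ deg \<alpha>)"
      proof (cases "\<alpha> \<in> L")
        case False
        then have deg: "2 \<le> deg \<alpha>" using deg_L[of \<alpha>] by linarith
        have "\<bar>C \<alpha> * ?m \<alpha>\<bar> \<le> \<bar>C \<alpha>\<bar> * norm (y - p) ^ deg \<alpha>" by (rule abs_term_le) (rule comp)
        also have "norm (y - p) ^ deg \<alpha> = (norm (y - p) / R) ^ deg \<alpha> * R ^ deg \<alpha>"
          using R by (simp add: power_divide)
        also have "(norm (y - p) / R) ^ deg \<alpha> \<le> (norm (y - p) / R)\<^sup>2"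
          using deg y R by (intro power_decreasing) auto
        finally show ?thesis using False R by (simp add: mult_left_mono mult_right_mono mult.left_commute)
      qed (use R in auto)
    qed
    moreover have "(\<Sum>\<alpha>\<in>L. - (C \<alpha> * ?m \<alpha>)) = - g p - (\<Sum>b\<in>Basis. dir_deriv b g p * ((y - p) \<bullet> b))"
      using not0 by (simp add: L_def sum.reindex[OF inj] sum_negf expands_center[OF e] dir_deriv_center[OF e])
    ultimately show ?thesis by (simp add: algebra_simps)
  qed
  show ?thesis
  proof (rule has_derivativeI_sandwich[of R])
    show "bounded_linear (\<lambda>z. \<Sum>b\<in>Basis. dir_deriv b g p * (z \<bullet> b))"
      by (intro bounded_linear_sum bounded_linear_const_mult bounded_linear_inner_left)
    fix y assume y: "y \<noteq> p" "dist y p < R"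
    have "norm (g y - g p - (\<Sum>b\<in>Basis. dir_deriv b g p * ((y - p) \<bullet> b))) / norm (y - p)
        \<le> (norm (y - p) / R)\<^sup>2 * M / norm (y - p)"
      using bound[of y] y by (intro divide_right_mono) (auto simp: dist_norm)
    also have "\<dots> = norm (y - p) * (M / R\<^sup>2)"
      using y(1) by (simp add: power_divide power2_eq_square)
    finally show "norm (g y - g p - (\<Sum>b\<in>Basis. dir_deriv b g p * ((y - p) \<bullet> b))) / norm (y - p)
        \<le> norm (y - p) * (M / R\<^sup>2)" .
  next
    have "((\<lambda>y. norm (y - p) * (M / R\<^sup>2)) \<longlongrightarrow> norm (p - p) * (M / R\<^sup>2)) (at p)"
      by (intro tendsto_intros)
    then show "((\<lambda>y. norm (y - p) * (M / R\<^sup>2)) \<longlongrightarrow> 0) (at p)" by simp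
  qed (use R in auto)
qed

lemma analytic_at_isCont: "analytic_at g p \<Longrightarrow> isCont g p"
  using analytic_at_has_derivative has_derivative_continuous by blast

lemma analytic_at_chain:
  assumes g: "analytic_at g (\<gamma> t)" and \<gamma>: "(\<gamma> has_vector_derivative v) (at t)"
  shows "((\<lambda>h. g (\<gamma> h)) has_real_derivative (\<Sum>b\<in>Basis. dir_deriv b g (\<gamma> t) * (v \<bullet> b))) (at t)"
proof -
  have "((\<lambda>h. g (\<gamma> h)) has_derivative (\<lambda>h. \<Sum>b\<in>Basis. dir_deriv b g (\<gamma> t) * ((h *\<^sub>R v) \<bullet> b))) (at t)"
    using has_derivative_compose[OF \<gamma>[unfolded has_vector_derivative_def]
        analytic_at_has_derivative[OF g]] .
  then show ?thesis
    unfolding has_field_derivative_def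
    by (rule has_derivative_eq_rhs) (auto simp: sum_distrib_left ac_simps)
qed

section \<open>The identity theorem\<close>

lemma dir_deriv_eventually_eq:
  assumes "\<forall>\<^sub>F z in nhds p. g z = g' z"
  shows "\<forall>\<^sub>F z in nhds p. dir_deriv b g z = dir_deriv b g' z"
proof -
  from assms have "\<forall>\<^sub>F z in nhds p. \<forall>\<^sub>F z' in nhds z. g z' = g' z'"
    by (simp add: eventually_eventually)
  then show ?thesis
  proof eventually_elim
    case (elim z)
    have "((\<lambda>h. z + h *\<^sub>R b) \<longlongrightarrow> z + 0 *\<^sub>R b) (nhds 0)"
      by (intro tendsto_intros filterlim_ident)
    then have "\<forall>\<^sub>F h in nhds 0. g (z + h *\<^sub>R b) = g' (z + h *\<^sub>R b)"
      using elim by (auto dest: eventually_compose_filterlim)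
    then show ?case unfolding dir_deriv_def by (intro deriv_cong_ev) auto
  qed
qed

text \<open>The constant coefficient is the value at the center. All other coefficients are reached by differentiation, which keeps
the function zero near the center.\<close>

lemma expands_zero:
  assumes "expands C R p g" "\<forall>\<^sub>F z in nhds p. g z = 0"
  shows "C \<alpha> = 0"
  using assms
proof (induction \<alpha> arbitrary: C R g rule: mindex_induct)
  case zero
  from eventually_nhds_x_imp_x[OF zero(2)] show ?case using expands_center[OF zero(1)] by simp
next
  case (add \<alpha> b)
  have "dir_deriv b (\<lambda>_. 0) z = 0" for z :: 'a by (simp add: dir_deriv_def)
  then have "\<forall>\<^sub>F z in nhds p. dir_deriv b g z = 0"
    using dir_deriv_eventually_eq[OF add.prems(2), of b] by simp
  then have "dcoef b C \<alpha> = 0"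
    using add.IH[OF expands_dir_deriv(1)[OF add.prems(1), of "R / 2" b]] expands_pos[OF add.prems(1)] add.hyps
    by simp
  then show ?case by (simp add: dcoef_def)
qed

lemma expands_unique:
  assumes e: "expands C R p g" "expands C' R' p g'" and "\<forall>\<^sub>F z in nhds p. g z = g' z"
  shows "C = C'"
proof
  fix \<alpha>
  define r where "r = min R R'"
  have "r > 0" using e expands_pos by (auto simp: r_def)
  then have e1: "expands C r p g" and e2: "expands C' r p g'"
    using e by (auto intro: expands_mono simp: r_def)
  have "expands (\<lambda>\<alpha>. C \<alpha> + - C' \<alpha>) r p (\<lambda>z. g z + - g' z)"
    unfolding expands_def
  proof (intro conjI allI impI)
    have "(\<lambda>\<alpha>. \<bar>C \<alpha>\<bar> * r ^ deg \<alpha> + \<bar>C' \<alpha>\<bar> * r ^ deg \<alpha>) summable_on UNIV"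
      by (intro summable_on_add expands_summable[OF e1] expands_summable[OF e2])
    then show "(\<lambda>\<alpha>. \<bar>C \<alpha> + - C' \<alpha>\<bar> * r ^ deg \<alpha>) summable_on UNIV"
      by (rule summable_on_comparison_test)
        (use \<open>r > 0\<close> in \<open>auto simp flip: distrib_right intro!: mult_right_mono\<close>)
    fix z assume z: "\<forall>b\<in>Basis. \<bar>(z - p) \<bullet> b\<bar> \<le> r"
    show "((\<lambda>\<alpha>. (C \<alpha> + - C' \<alpha>) * mpow (\<lambda>b. (z - p) \<bullet> b) \<alpha>) has_sum g z + - g' z) UNIV"
      unfolding distrib_right mult_minus_left
      by (intro has_sum_add has_sum_uminusI expands_has_sum[OF e1] expands_has_sum[OF e2]) (use z in auto)
  qed (rule \<open>r > 0\<close>)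
  from expands_zero[OF this] assms(3) have "C \<alpha> + - C' \<alpha> = 0" by simp
  then show "C \<alpha> = C' \<alpha>" by simp
qed

lemma ev_inject:
  fixes u v :: "'a::euclidean_space pser"
  assumes "\<forall>\<^sub>F z in nhds 0. ev z u = ev z v"
  shows "u = v"
proof -
  have e: "expands (coef u) (1 / DIM('a)) 0 (\<lambda>z. ev z u)" for u :: "'a pser"
    using expands_ev[of 1 u 0] by simp
  from expands_unique[OF e e assms] show ?thesis by (simp add: coef_inject)
qed

section \<open>Contractions depending on a small parameter\<close>

text \<open>The regime in which a parameter \<open>d\<close> and two points of the space are small. Two points occur because the
estimates concern differences.\<close>

definition small_scale :: "(real \<times> 'e::real_normed_vector \<times> 'e) filter" where
  "small_scale = at_right 0 \<times>\<^sub>F (nhds 0 \<times>\<^sub>F nhds 0)"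

text \<open>The bound holds for the values at both points and for their difference, so that it is stable under products.\<close>

definition lip_bound :: "(real \<Rightarrow> 'e \<Rightarrow> 'e::real_normed_vector) \<Rightarrow> real \<Rightarrow> real \<Rightarrow> real \<times> 'e \<times> 'e \<Rightarrow> bool"
  where "lip_bound T M N = (\<lambda>(d, h, h'). norm (T d h) \<le> M \<and> norm (T d h') \<le> M \<and>
    norm (T d h - T d h') \<le> N * norm (h - h'))"

definition lip :: "(real \<Rightarrow> 'e::real_normed_vector \<Rightarrow> 'e) \<Rightarrow> bool" where
  "lip T \<longleftrightarrow> (\<exists>M. eventually (lip_bound T M M) small_scale)"

text \<open>Small in value, but with a Lipschitz constant that need not become small: the linear part of an equation is of this kind.\<close>

definition vanishing :: "(real \<Rightarrow> 'e::real_normed_vector \<Rightarrow> 'e) \<Rightarrow> bool" where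
  "vanishing T \<longleftrightarrow> (\<exists>N. \<forall>\<epsilon>>0. eventually (lip_bound T \<epsilon> N) small_scale)"

definition small :: "(real \<Rightarrow> 'e::real_normed_vector \<Rightarrow> 'e) \<Rightarrow> bool" where
  "small T \<longleftrightarrow> (\<forall>\<epsilon>>0. eventually (lip_bound T \<epsilon> \<epsilon>) small_scale)"

lemma lip_bound_mono: "lip_bound T M N p \<Longrightarrow> M \<le> M' \<Longrightarrow> N \<le> N' \<Longrightarrow> lip_bound T M' N' p"
proof -
  assume *: "lip_bound T M N p" "M \<le> M'" "N \<le> N'"
  obtain d h h' where p: "p = (d, h, h')" by (cases p)
  have "N * norm (h - h') \<le> N' * norm (h - h')" using *(3) by (intro mult_right_mono) auto
  with * show ?thesis by (simp add: lip_bound_def p)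
qed

lemma lip_bound_add:
  "lip_bound T M N p \<Longrightarrow> lip_bound S M' N' p \<Longrightarrow> lip_bound (\<lambda>d h. T d h + S d h) (M + M') (N + N') p"
  unfolding lip_bound_def
  by (auto simp: add_diff_add distrib_right intro!: norm_triangle_mono)

lemma lip_bound_mult:
  fixes T S :: "real \<Rightarrow> 'e \<Rightarrow> 'e::real_normed_algebra"
  assumes "lip_bound T M N p" "lip_bound S M' N' p"
  shows "lip_bound (\<lambda>d h. T d h * S d h) (M * M') (M * N' + N * M') p"
proof -
  obtain d h h' where p: "p = (d, h, h')" by (cases p)
  have T: "norm (T d h) \<le> M" "norm (T d h') \<le> M" "norm (T d h - T d h') \<le> N * norm (h - h')"
    and S: "norm (S d h) \<le> M'" "norm (S d h') \<le> M'" "norm (S d h - S d h') \<le> N' * norm (h - h')"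
    using assms by (auto simp: lip_bound_def p)
  have M: "0 \<le> M" "0 \<le> M'" using T(1) S(1) norm_ge_zero order_trans by blast+
  have prod: "norm (x * y) \<le> X * Y" if "norm x \<le> X" "norm y \<le> Y" for x y :: 'e and X Y
    using that by (intro order_trans[OF norm_mult_ineq] mult_mono) (auto intro: order_trans[OF norm_ge_zero])
  have "T d h * S d h - T d h' * S d h' = T d h * (S d h - S d h') + (T d h - T d h') * S d h'"
    by (simp add: algebra_simps)
  also have "norm \<dots> \<le> M * (N' * norm (h - h')) + N * norm (h - h') * M'"
    by (intro norm_triangle_mono prod T S)
  also have "\<dots> = (M * N' + N * M') * norm (h - h')" by (simp add: algebra_simps)
  finally show ?thesis using prod[OF T(1) S(1)] prod[OF T(2) S(2)] by (simp add: lip_bound_def p)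
qed

lemma small_imp_vanishing: "small T \<Longrightarrow> vanishing T"
  unfolding vanishing_def
proof (intro exI allI impI)
  fix \<epsilon> :: real
  assume "small T" "\<epsilon> > 0"
  then have "eventually (lip_bound T (min \<epsilon> 1) (min \<epsilon> 1)) small_scale" by (simp add: small_def)
  then show "eventually (lip_bound T \<epsilon> 1) small_scale"
    by (rule eventually_mono) (auto intro: lip_bound_mono)
qed

lemma vanishing_imp_lip: "vanishing T \<Longrightarrow> lip T"
proof -
  assume "vanishing T"
  then obtain N where "\<forall>\<epsilon>>0. eventually (lip_bound T \<epsilon> N) small_scale" unfolding vanishing_def ..
  then have "eventually (lip_bound T 1 N) small_scale" by simp
  then have "eventually (lip_bound T (max 1 N) (max 1 N)) small_scale"
    by (rule eventually_mono) (auto intro: lip_bound_mono)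
  then show ?thesis by (auto simp: lip_def)
qed

lemma small_imp_lip: "small T \<Longrightarrow> lip T"
  by (intro vanishing_imp_lip small_imp_vanishing)

lemma lip_add: "lip T \<Longrightarrow> lip S \<Longrightarrow> lip (\<lambda>d h. T d h + S d h)"
  unfolding lip_def
proof (elim exE)
  fix M M' assume "eventually (lip_bound T M M) small_scale" "eventually (lip_bound S M' M') small_scale"
  then have "eventually (lip_bound (\<lambda>d h. T d h + S d h) (M + M') (M + M')) small_scale"
    by eventually_elim (rule lip_bound_add)
  then show "\<exists>M. eventually (lip_bound (\<lambda>d h. T d h + S d h) M M) small_scale" ..
qed

lemma lip_mult:
  fixes T S :: "real \<Rightarrow> 'e \<Rightarrow> 'e::real_normed_algebra"
  shows "lip T \<Longrightarrow> lip S \<Longrightarrow> lip (\<lambda>d h. T d h * S d h)"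
  unfolding lip_def
proof (elim exE)
  fix M M' assume "eventually (lip_bound T M M) small_scale" "eventually (lip_bound S M' M') small_scale"
  then have "eventually (lip_bound (\<lambda>d h. T d h * S d h) (max (M * M') (M * M' + M * M'))
      (max (M * M') (M * M' + M * M'))) small_scale"
    by eventually_elim (rule lip_bound_mono[OF lip_bound_mult], auto)
  then show "\<exists>M. eventually (lip_bound (\<lambda>d h. T d h * S d h) M M) small_scale" ..
qed

lemma small_add: "small T \<Longrightarrow> small S \<Longrightarrow> small (\<lambda>d h. T d h + S d h)"
  unfolding small_def
proof (intro allI impI)
  fix \<epsilon> :: real
  assume *: "\<forall>\<epsilon>>0. eventually (lip_bound T \<epsilon> \<epsilon>) small_scale" "\<forall>\<epsilon>>0. eventually (lip_bound S \<epsilon> \<epsilon>) small_scale"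
    "\<epsilon> > 0"
  then have "eventually (lip_bound T (\<epsilon>/2) (\<epsilon>/2)) small_scale" "eventually (lip_bound S (\<epsilon>/2) (\<epsilon>/2)) small_scale"
    by simp_all
  then show "eventually (lip_bound (\<lambda>d h. T d h + S d h) \<epsilon> \<epsilon>) small_scale"
    by eventually_elim (drule (1) lip_bound_add, simp)
qed

lemma small_mult_lip:
  fixes T S :: "real \<Rightarrow> 'e \<Rightarrow> 'e::real_normed_algebra"
  assumes "small T" "lip S"
  shows "small (\<lambda>d h. T d h * S d h)"
  unfolding small_def
proof (intro allI impI)
  fix \<epsilon> :: real assume \<epsilon>: "\<epsilon> > 0"
  from assms(2) obtain M where M: "eventually (lip_bound S M M) small_scale" by (auto simp: lip_def)
  define \<delta> where "\<delta> = \<epsilon> / (2 * (\<bar>M\<bar> + 1))"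
  have \<delta>: "\<delta> > 0" using \<epsilon> by (simp add: \<delta>_def add_nonneg_pos)
  have "\<delta> * M \<le> \<delta> * (\<bar>M\<bar> + 1)" using \<delta> by (intro mult_left_mono) auto
  also have "\<dots> = \<epsilon> / 2" by (simp add: \<delta>_def field_simps add_nonneg_eq_0_iff)
  finally have "\<delta> * M \<le> \<epsilon> / 2" .
  then have le: "\<delta> * M \<le> \<epsilon>" "\<delta> * M + \<delta> * M \<le> \<epsilon>" using \<epsilon> by linarith+
  have "eventually (lip_bound T \<delta> \<delta>) small_scale" using assms(1) \<delta> by (simp add: small_def)
  then show "eventually (lip_bound (\<lambda>d h. T d h * S d h) \<epsilon> \<epsilon>) small_scale"
    using M by eventually_elim (rule lip_bound_mono[OF lip_bound_mult], assumption+, (rule le)+)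
qed

text \<open>Quadratic terms are small: in the Lipschitz estimate of a product each summand keeps one small factor.\<close>

lemma small_mult_vanishing:
  fixes T S :: "real \<Rightarrow> 'e \<Rightarrow> 'e::real_normed_algebra"
  assumes "vanishing T" "vanishing S"
  shows "small (\<lambda>d h. T d h * S d h)"
  unfolding small_def
proof (intro allI impI)
  fix \<epsilon> :: real assume \<epsilon>: "\<epsilon> > 0"
  from assms obtain N N' where N: "\<And>\<epsilon>. \<epsilon> > 0 \<Longrightarrow> eventually (lip_bound T \<epsilon> N) small_scale"
    and N': "\<And>\<epsilon>. \<epsilon> > 0 \<Longrightarrow> eventually (lip_bound S \<epsilon> N') small_scale"
    unfolding vanishing_def by blast
  define \<delta> where "\<delta> = min 1 (\<epsilon> / (\<bar>N\<bar> + \<bar>N'\<bar> + 1))"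
  have \<delta>: "\<delta> > 0" using \<epsilon> by (simp add: \<delta>_def add_nonneg_pos)
  have "\<delta> * x \<le> \<epsilon>" if "x \<le> \<bar>N\<bar> + \<bar>N'\<bar> + 1" for x
  proof -
    have "\<delta> * x \<le> \<delta> * (\<bar>N\<bar> + \<bar>N'\<bar> + 1)" using \<delta> that by (intro mult_left_mono) auto
    also have "\<dots> \<le> \<epsilon> / (\<bar>N\<bar> + \<bar>N'\<bar> + 1) * (\<bar>N\<bar> + \<bar>N'\<bar> + 1)"
      by (intro mult_right_mono) (auto simp: \<delta>_def)
    also have "\<dots> = \<epsilon>" by (simp add: add_nonneg_eq_0_iff)
    finally show ?thesis .
  qed
  note le = this
  have "\<delta> \<le> 1" by (simp add: \<delta>_def)
  then have le1: "\<delta> * \<delta> \<le> \<epsilon>" by (intro le) linarith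
  have "\<delta> * (N' + N) \<le> \<epsilon>" by (intro le) linarith
  then have le2: "\<delta> * N' + N * \<delta> \<le> \<epsilon>" by (simp add: algebra_simps)
  from N[OF \<delta>] N'[OF \<delta>] show "eventually (lip_bound (\<lambda>d h. T d h * S d h) \<epsilon> \<epsilon>) small_scale"
    by eventually_elim (rule lip_bound_mono[OF lip_bound_mult], assumption+, rule le1, rule le2)
qed

lemma eventually_small_scale_parameter:
  assumes "eventually P (at_right (0::real))"
  shows "eventually (\<lambda>(d, h, h'). P d) (small_scale :: (real \<times> 'e::real_normed_vector \<times> 'e) filter)"
  unfolding small_scale_def using eventually_prod1[of "nhds 0 \<times>\<^sub>F nhds (0::'e)" P "at_right 0"] assms
  by (simp add: prod_filter_eq_bot case_prod_unfold)

lemma eventually_small_scale_norm: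
  assumes "\<epsilon> > 0"
  shows "eventually (\<lambda>(d, h, h'). norm h \<le> \<epsilon> \<and> norm h' \<le> \<epsilon>)
    (small_scale :: (real \<times> 'e::real_normed_vector \<times> 'e) filter)"
proof -
  have n: "eventually (\<lambda>h :: 'e. norm h \<le> \<epsilon>) (nhds 0)"
    unfolding eventually_nhds_metric using assms by (intro exI[of _ \<epsilon>]) auto
  have "eventually (\<lambda>(h :: 'e, h'). norm h \<le> \<epsilon> \<and> norm h' \<le> \<epsilon>) (nhds 0 \<times>\<^sub>F nhds (0::'e))"
    using eventually_prodI[OF n n] by (simp add: case_prod_unfold)
  then show ?thesis
    unfolding small_scale_def
    using eventually_prod2[of "at_right (0::real)" "\<lambda>q. norm (fst q) \<le> \<epsilon> \<and> norm (snd q) \<le> \<epsilon>"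
        "nhds (0::'e) \<times>\<^sub>F nhds (0::'e)"] by (simp add: case_prod_unfold)
qed

lemma small_tendsto_0:
  assumes "(e \<longlongrightarrow> 0) (at_right 0)"
  shows "small (\<lambda>d h. e d)"
  unfolding small_def
proof (intro allI impI)
  fix \<epsilon> :: real assume "\<epsilon> > 0"
  then have "\<forall>\<^sub>F d in at_right 0. norm (e d) < \<epsilon>" using assms by (simp add: tendsto_iff)
  from eventually_small_scale_parameter[OF this]
  show "eventually (lip_bound (\<lambda>d h. e d) \<epsilon> \<epsilon>) small_scale"
    by (rule eventually_mono) (use \<open>\<epsilon> > 0\<close> in \<open>auto simp: lip_bound_def\<close>)
qed

lemma lip_const: "lip (\<lambda>d h. c)"
  unfolding lip_def by (intro exI[of _ "norm c"] always_eventually) (auto simp: lip_bound_def)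

lemma vanishing_linear:
  assumes "\<And>h. norm (L h) \<le> K * norm h" "\<And>h h'. L h - L h' = L (h - h')"
  shows "vanishing (\<lambda>d h. L h)"
  unfolding vanishing_def
proof (intro exI[of _ "\<bar>K\<bar> + 1"] allI impI)
  fix \<epsilon> :: real assume "\<epsilon> > 0"
  then have "\<epsilon> / (\<bar>K\<bar> + 1) > 0" by (simp add: add_nonneg_pos)
  from eventually_small_scale_norm[OF this]
  show "eventually (lip_bound (\<lambda>d h. L h) \<epsilon> (\<bar>K\<bar> + 1)) small_scale"
  proof (rule eventually_mono, clarify)
    fix d and h h' :: 'a
    assume h: "norm h \<le> \<epsilon> / (\<bar>K\<bar> + 1)" "norm h' \<le> \<epsilon> / (\<bar>K\<bar> + 1)"
    have K: "norm (L x) \<le> (\<bar>K\<bar> + 1) * norm x" for x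
      using assms(1)[of x] by (rule order_trans) (intro mult_right_mono, auto)
    have "norm (L x) \<le> \<epsilon>" if "norm x \<le> \<epsilon> / (\<bar>K\<bar> + 1)" for x
      using K[of x] mult_left_mono[OF that, of "\<bar>K\<bar> + 1"] by (simp add: add_nonneg_eq_0_iff)
    with h K show "lip_bound (\<lambda>d h. L h) \<epsilon> (\<bar>K\<bar> + 1) (d, h, h')"
      by (simp add: lip_bound_def assms(2))
  qed
qed

text \<open>Small maps form an ideal in the algebra of Lipschitz maps. Computing modulo this ideal extracts the linear part
of an equation at the limit \<open>d = 0\<close>.\<close>

definition cong_small :: "(real \<Rightarrow> 'e \<Rightarrow> 'e::real_normed_algebra_1) \<Rightarrow> (real \<Rightarrow> 'e \<Rightarrow> 'e) \<Rightarrow> bool" where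
  "cong_small T S \<longleftrightarrow> small (\<lambda>d h. T d h - S d h) \<and> lip S"

lemma small_scaleR: 
  fixes T :: "real \<Rightarrow> 'e \<Rightarrow> 'e::real_normed_algebra_1"
  shows "small T \<Longrightarrow> small (\<lambda>d h. c *\<^sub>R T d h)"
  using small_mult_lip[OF _ lip_const[of "of_real c"], of T] by (simp add: of_real_def)

lemma cong_small_lip: "cong_small T S \<Longrightarrow> lip T"
  using lip_add[OF small_imp_lip[of "\<lambda>d h. T d h - S d h"], of S] by (simp add: cong_small_def)

lemma cong_small_refl: "lip T \<Longrightarrow> cong_small T T"
  using small_tendsto_0[OF tendsto_const] by (simp add: cong_small_def)

lemma cong_small_add: "cong_small T T' \<Longrightarrow> cong_small S S' \<Longrightarrow>
    cong_small (\<lambda>d h. T d h + S d h) (\<lambda>d h. T' d h + S' d h)"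
  unfolding cong_small_def using small_add[of "\<lambda>d h. T d h - T' d h" "\<lambda>d h. S d h - S' d h"]
  by (simp add: lip_add algebra_simps)

lemma cong_small_mult:
  fixes T :: "real \<Rightarrow> 'e \<Rightarrow> 'e::{real_normed_algebra_1, comm_ring_1}"
  assumes "cong_small T T'" "cong_small S S'"
  shows "cong_small (\<lambda>d h. T d h * S d h) (\<lambda>d h. T' d h * S' d h)"
proof -
  have "small (\<lambda>d h. (T d h - T' d h) * S d h + (S d h - S' d h) * T' d h)"
    using assms cong_small_lip[OF assms(2)]
    by (intro small_add small_mult_lip) (auto simp: cong_small_def)
  moreover have "(T d h - T' d h) * S d h + (S d h - S' d h) * T' d h = T d h * S d h - T' d h * S' d h" for d h
    by (simp add: algebra_simps)
  ultimately show ?thesis using assms by (simp add: cong_small_def lip_mult)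
qed

lemma lip_scaleR:
  fixes T :: "real \<Rightarrow> 'e \<Rightarrow> 'e::real_normed_algebra_1"
  shows "lip T \<Longrightarrow> lip (\<lambda>d h. c *\<^sub>R T d h)"
  using lip_mult[OF lip_const[of "of_real c"], of T] by (simp add: scaleR_conv_of_real)

lemma cong_small_scaleR:
  assumes "cong_small T T'"
  shows "cong_small (\<lambda>d h. c *\<^sub>R T d h) (\<lambda>d h. c *\<^sub>R T' d h)"
  using assms small_scaleR[of "\<lambda>d h. T d h - T' d h" c]
  by (simp add: cong_small_def scaleR_diff_right lip_scaleR)

lemma cong_small_sum:
  "(\<And>i. i \<in> I \<Longrightarrow> cong_small (T i) (T' i)) \<Longrightarrow>
    cong_small (\<lambda>d h. \<Sum>i\<in>I. T i d h) (\<lambda>d h. \<Sum>i\<in>I. T' i d h)"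
  by (induction I rule: infinite_finite_induct) (auto intro!: cong_small_add cong_small_refl lip_const)

lemma cong_small_prod:
  fixes T :: "'i \<Rightarrow> real \<Rightarrow> 'e \<Rightarrow> 'e::{real_normed_algebra_1, comm_ring_1}"
  shows "(\<And>i. i \<in> I \<Longrightarrow> cong_small (T i) (T' i)) \<Longrightarrow>
    cong_small (\<lambda>d h. \<Prod>i\<in>I. T i d h) (\<lambda>d h. \<Prod>i\<in>I. T' i d h)"
  by (induction I rule: infinite_finite_induct) (auto intro!: cong_small_mult cong_small_refl lip_const)

lemma cong_small_power:
  fixes T :: "real \<Rightarrow> 'e \<Rightarrow> 'e::{real_normed_algebra_1, comm_ring_1}"
  shows "cong_small T T' \<Longrightarrow> cong_small (\<lambda>d h. T d h ^ n) (\<lambda>d h. T' d h ^ n)"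
  by (induction n) (auto intro!: cong_small_mult cong_small_refl lip_const)

lemma cong_small_trans:
  assumes "cong_small T S" "cong_small S Q"
  shows "cong_small T Q"
  using small_add[of "\<lambda>d h. T d h - S d h" "\<lambda>d h. S d h - Q d h"] assms
  by (simp add: cong_small_def)

lemma cong_small_tendsto:
  assumes "(e \<longlongrightarrow> l) (at_right 0)"
  shows "cong_small (\<lambda>d h. e d) (\<lambda>d h. l)"
  using assms by (simp add: cong_small_def lip_const small_tendsto_0 LIM_zero)

text \<open>In the binomial expansion the terms from the square of \<open>T\<close> on are small.\<close>

lemma cong_small_power_linearize:
  fixes T :: "real \<Rightarrow> 'e \<Rightarrow> 'e::{real_normed_algebra_1, comm_ring_1}"
  assumes T: "vanishing T"
  shows "cong_small (\<lambda>d h. (of_real c + T d h) ^ n)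
    (\<lambda>d h. of_real (c ^ n) + (real n * c ^ (n - 1)) *\<^sub>R T d h)"
proof (induction n)
  case (Suc n)
  have lT: "lip T" using T by (rule vanishing_imp_lip)
  have lS: "lip (\<lambda>d h. k *\<^sub>R T d h)" for k
    using lT by (rule lip_scaleR)
  have step: "cong_small (\<lambda>d h. (of_real c + T d h) * (of_real c + T d h) ^ n)
      (\<lambda>d h. (of_real c + T d h) * (of_real (c ^ n) + (real n * c ^ (n - 1)) *\<^sub>R T d h))"
    by (intro cong_small_mult cong_small_refl lip_add lip_const lT Suc)
  have "small (\<lambda>d h. (real n * c ^ (n - 1)) *\<^sub>R (T d h * T d h))"
    by (intro small_scaleR small_mult_vanishing T)
  moreover have "(of_real c + T d h) * (of_real (c ^ n) + (real n * c ^ (n - 1)) *\<^sub>R T d h)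
      - (of_real (c ^ Suc n) + (real (Suc n) * c ^ (Suc n - 1)) *\<^sub>R T d h)
      = (real n * c ^ (n - 1)) *\<^sub>R (T d h * T d h)" for d h
    by (cases n) (simp_all add: scaleR_conv_of_real algebra_simps)
  ultimately have "cong_small (\<lambda>d h. (of_real c + T d h) * (of_real (c ^ n) + (real n * c ^ (n - 1)) *\<^sub>R T d h))
      (\<lambda>d h. of_real (c ^ Suc n) + (real (Suc n) * c ^ (Suc n - 1)) *\<^sub>R T d h)"
    unfolding cong_small_def by (simp only: lip_add lip_const lS simp_thms)
  from cong_small_trans[OF step this] show ?case by simp
qed (simp add: cong_small_refl lip_const)

text \<open>On a fixed small ball the maps are contractions with constant \<open>1 / 2\<close>; for small \<open>d\<close> they move the center so little
that they preserve the ball. The ball may be taken arbitrarily small, which is used for the solution to be close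
to its initial value.\<close>

lemma small_fixed_point:
  fixes T :: "real \<Rightarrow> 'e \<Rightarrow> 'e::banach"
  assumes T: "small T"
  shows "\<exists>\<eta>0>0. \<forall>\<eta>. 0 < \<eta> \<and> \<eta> \<le> \<eta>0 \<longrightarrow> (\<forall>\<^sub>F d in at_right 0. \<exists>!h. norm h \<le> \<eta> \<and> T d h = h)"
proof -
  have ex: "\<exists>d1>0. \<exists>r>0. \<forall>d h h'. 0 < d \<and> d < d1 \<and> norm h < r \<and> norm h' < r \<longrightarrow> lip_bound T \<epsilon> \<epsilon> (d, h, h')"
    if "\<epsilon> > 0" for \<epsilon>
  proof -
    have ev: "eventually (lip_bound T \<epsilon> \<epsilon>) small_scale" using T that by (simp add: small_def)
    obtain P Q where P: "eventually P (at_right (0::real))"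
      and Q: "eventually Q (nhds 0 \<times>\<^sub>F nhds (0::'e))"
      and PQ: "\<And>d q. P d \<Longrightarrow> Q q \<Longrightarrow> lip_bound T \<epsilon> \<epsilon> (d, q)"
      using eventually_prod_filter[THEN iffD1, OF ev[unfolded small_scale_def]] by blast
    from Q obtain Q1 Q2 where Q1: "eventually Q1 (nhds (0::'e))" and Q2: "eventually Q2 (nhds (0::'e))"
      and Q12: "\<And>h h'. Q1 h \<Longrightarrow> Q2 h' \<Longrightarrow> Q (h, h')"
      using eventually_prod_filter[THEN iffD1, OF Q] by blast
    from eventually_conj[OF Q1 Q2] obtain r where "r > 0" and r: "\<And>h. norm h < r \<Longrightarrow> Q1 h \<and> Q2 h"
      unfolding eventually_nhds_metric by auto
    from P obtain d1 where "d1 > 0" "\<And>d. 0 < d \<Longrightarrow> d < d1 \<Longrightarrow> P d"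
      unfolding eventually_at_right_field by auto
    with PQ Q12 r \<open>r > 0\<close> show ?thesis by (intro exI[of _ d1] exI[of _ r] conjI) auto
  qed
  from ex[of "1/2"] obtain d1 r where d1: "d1 > 0" and r: "r > 0"
    and L: "\<And>d h h'. 0 < d \<Longrightarrow> d < d1 \<Longrightarrow> norm h < r \<Longrightarrow> norm h' < r \<Longrightarrow> lip_bound T (1/2) (1/2) (d, h, h')"
    by auto
  show ?thesis
  proof (intro exI[of _ "r / 2"] conjI allI impI)
    fix \<eta> assume \<eta>: "0 < \<eta> \<and> \<eta> \<le> r / 2"
    from ex[of "\<eta> / 2"] obtain d2 r2 where d2: "d2 > 0" and r2: "r2 > 0"
      and L2: "\<And>d h h'. 0 < d \<Longrightarrow> d < d2 \<Longrightarrow> norm h < r2 \<Longrightarrow> norm h' < r2 \<Longrightarrow> lip_bound T (\<eta>/2) (\<eta>/2) (d, h, h')"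
      using \<eta> by auto
    have "\<exists>!h. norm h \<le> \<eta> \<and> T d h = h" if d: "0 < d" "d < min d1 d2" for d
    proof -
      have T0: "norm (T d 0) \<le> \<eta> / 2" using L2[of d 0 0] d r2 by (simp add: lip_bound_def)
      have c: "norm (T d h - T d h') \<le> 1/2 * norm (h - h')" if "norm h \<le> \<eta>" "norm h' \<le> \<eta>" for h h'
        using L[of d h h'] that d \<eta> r by (simp add: lip_bound_def)
      have "\<exists>!h\<in>cball 0 \<eta>. T d h = h"
      proof (rule Banach_fix[where c = "1/2"])
        show "T d ` cball 0 \<eta> \<subseteq> cball 0 \<eta>"
        proof clarsimp
          fix h :: 'e assume h: "norm h \<le> \<eta>"
          have "norm (T d h) \<le> norm (T d h - T d 0) + norm (T d 0)"
            using norm_triangle_ineq[of "T d h - T d 0" "T d 0"] by simp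
          also have "\<dots> \<le> 1/2 * norm (h - 0) + \<eta> / 2" using c[OF h, of 0] T0 \<eta> by (intro add_mono) auto
          finally show "norm (T d h) \<le> \<eta>" using h by simp
        qed
      qed (use c \<eta> in \<open>auto simp: complete_eq_closed dist_norm\<close>)
      then show ?thesis by simp
    qed
    then show "\<forall>\<^sub>F d in at_right 0. \<exists>!h. norm h \<le> \<eta> \<and> T d h = h"
      unfolding eventually_at_right_field using d1 d2 by (intro exI[of _ "min d1 d2"]) auto
  qed (use r in simp)
qed

section \<open>Operators on power series\<close>

definition power_index :: "'a::euclidean_space \<Rightarrow> nat \<Rightarrow> 'a mindex" where
  "power_index c j = Mindex (\<lambda>b\<in>Basis. if b = c then j else 0)"

lemma expo_power_index [simp]: "b \<in> Basis \<Longrightarrow> expo (power_index c j) b = (if b = c then j else 0)"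
  unfolding power_index_def by (subst expo_Mindex) auto

lemma mpow_power_index [simp]: 
  assumes "c \<in> Basis" shows "mpow W (power_index c j) = W c ^ j"
proof -
  have "mpow W (power_index c j) = (\<Prod>b\<in>Basis. if b = c then W b ^ j else 1)"
    unfolding mpow_def by (rule prod.cong) auto
  then show ?thesis using assms by simp
qed

lemma power_index_1: "power_index c 1 = unit_index c"
  by (rule mindex_eqI) auto

lemma power_index_decompose:
  assumes "c \<in> Basis" "j \<le> expo \<alpha> c"
  shows "(\<alpha> - power_index c j) + power_index c j = \<alpha>"
  using assms by (intro mindex_eqI) auto

text \<open>Operators that move coefficients by an injection and rescale them are bounded as soon as they are bounded on monomials.\<close>

lemma coef_op_bound:
  fixes u :: "'a::euclidean_space pser"
  assumes c: "\<And>\<alpha>. \<bar>c \<alpha>\<bar> * wt \<alpha> \<le> K * wt (\<tau> \<alpha>)" and inj: "inj_on \<tau> {\<alpha>. c \<alpha> \<noteq> 0}" and K: "0 \<le> K"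
  shows "coef (Pser (\<lambda>\<alpha>. c \<alpha> * coef u (\<tau> \<alpha>))) = (\<lambda>\<alpha>. c \<alpha> * coef u (\<tau> \<alpha>))"
    and "norm (Pser (\<lambda>\<alpha>. c \<alpha> * coef u (\<tau> \<alpha>))) \<le> K * norm u"
proof -
  have fin: "(\<Sum>\<alpha>\<in>F. wt \<alpha> * \<bar>c \<alpha> * coef u (\<tau> \<alpha>)\<bar>) \<le> K * norm u" if F: "finite F" for F
  proof -
    let ?G = "F \<inter> {\<alpha>. c \<alpha> \<noteq> 0}"
    have "(\<Sum>\<alpha>\<in>F. wt \<alpha> * \<bar>c \<alpha> * coef u (\<tau> \<alpha>)\<bar>) = (\<Sum>\<alpha>\<in>?G. wt \<alpha> * \<bar>c \<alpha> * coef u (\<tau> \<alpha>)\<bar>)"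
      using F by (intro sum.mono_neutral_right) auto
    also have "\<dots> \<le> (\<Sum>\<alpha>\<in>?G. K * (wt (\<tau> \<alpha>) * \<bar>coef u (\<tau> \<alpha>)\<bar>))"
    proof (rule sum_mono)
      fix \<alpha>
      have "\<bar>c \<alpha>\<bar> * wt \<alpha> * \<bar>coef u (\<tau> \<alpha>)\<bar> \<le> K * wt (\<tau> \<alpha>) * \<bar>coef u (\<tau> \<alpha>)\<bar>"
        by (intro mult_right_mono c) auto
      then show "wt \<alpha> * \<bar>c \<alpha> * coef u (\<tau> \<alpha>)\<bar> \<le> K * (wt (\<tau> \<alpha>) * \<bar>coef u (\<tau> \<alpha>)\<bar>)"
        by (simp add: abs_mult ac_simps)
    qed
    also have "\<dots> = K * (\<Sum>\<beta>\<in>\<tau> ` ?G. wt \<beta> * \<bar>coef u \<beta>\<bar>)"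
      using inj by (subst sum.reindex) (auto simp: sum_distrib_left intro: inj_on_subset)
    also have "\<dots> \<le> K * norm u"
      unfolding norm_pser_def using F K
      by (intro mult_left_mono finite_sum_le_infsum coef_summable) auto
    finally show ?thesis .
  qed
  show "coef (Pser (\<lambda>\<alpha>. c \<alpha> * coef u (\<tau> \<alpha>))) = (\<lambda>\<alpha>. c \<alpha> * coef u (\<tau> \<alpha>))"
    by (rule coef_Pser, rule norm_pser_le(1)[OF fin])
  show "norm (Pser (\<lambda>\<alpha>. c \<alpha> * coef u (\<tau> \<alpha>))) \<le> K * norm u"
    by (rule norm_pser_le(2)[OF fin])
qed

definition diag :: "'a \<Rightarrow> (nat \<Rightarrow> real) \<Rightarrow> 'a::euclidean_space pser \<Rightarrow> 'a pser" where
  "diag s \<phi> u = Pser (\<lambda>\<alpha>. \<phi> (expo \<alpha> s) * coef u \<alpha>)"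

lemma
  assumes "\<And>k. \<bar>\<phi> k\<bar> \<le> K"
  shows coef_diag: "coef (diag s \<phi> u) \<alpha> = \<phi> (expo \<alpha> s) * coef u \<alpha>"
    and norm_diag_le: "norm (diag s \<phi> u) \<le> K * norm u"
proof -
  have K: "0 \<le> K" using assms[of 0] by (rule order_trans[OF abs_ge_zero])
  note * = coef_op_bound[where c = "\<lambda>\<alpha>. \<phi> (expo \<alpha> s)" and \<tau> = "\<lambda>\<alpha>. \<alpha>" and K = K and u = u]
  show "coef (diag s \<phi> u) \<alpha> = \<phi> (expo \<alpha> s) * coef u \<alpha>"
    unfolding diag_def by (subst *(1)) (auto intro: mult_right_mono assms K)
  show "norm (diag s \<phi> u) \<le> K * norm u"
    unfolding diag_def by (rule *(2)) (auto intro: mult_right_mono assms K)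
qed

lemma diag_diff:
  assumes "\<And>k. \<bar>\<phi> k\<bar> \<le> K"
  shows "diag s \<phi> u - diag s \<phi> v = diag s \<phi> (u - v)"
  by (rule pser_eqI) (simp add: coef_diag[OF assms] algebra_simps)

text \<open>The differential operator \<open>z\<^sub>s\<^sup>m \<partial>\<^sub>b\<close> on coefficients. On general elements it is unbounded, and then the right hand side need
not have finite norm; its coefficients are known only where \<open>coef_pow_deriv\<close> applies.\<close>

definition pow_deriv :: "'a \<Rightarrow> nat \<Rightarrow> 'a \<Rightarrow> 'a::euclidean_space pser \<Rightarrow> 'a pser" where
  "pow_deriv s m b u =
    Pser (\<lambda>\<alpha>. if m \<le> expo \<alpha> s then dcoef b (coef u) (\<alpha> - power_index s m) else 0)"

text \<open>Multiplying a monomial by a further power of \<open>s\<close> decreases its weight, so a single factor \<open>s\<close> is the worst case.\<close>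

lemma wt_unit_plus_power_le:
  assumes s: "s \<in> Basis" and m: "m \<ge> 1"
  shows "(real (deg \<gamma>) + 1) * wt (\<gamma> + power_index s m) \<le> (real (expo \<gamma> s) + 1) * wt \<gamma>"
proof -
  have "\<gamma> + power_index s m = (\<gamma> + unit_index s) + power_index s (m - 1)"
    using m by (intro mindex_eqI) auto
  then have "wt (\<gamma> + power_index s m) \<le> wt (\<gamma> + unit_index s) * wt (power_index s (m - 1))"
    using wt_plus_le[of "\<gamma> + unit_index s" "power_index s (m - 1)"] by simp
  also have "\<dots> \<le> wt (\<gamma> + unit_index s) * 1"
    by (intro mult_left_mono wt_le_1) auto
  finally have "(real (deg \<gamma>) + 1) * wt (\<gamma> + power_index s m) \<le> (real (deg \<gamma>) + 1) * wt (\<gamma> + unit_index s)"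
    by (intro mult_left_mono) auto
  also have "\<dots> = (real (expo \<gamma> s) + 1) * wt \<gamma>"
    using wt_unit_plus[OF s, of \<gamma>] by (simp add: mult.commute)
  finally show ?thesis .
qed

text \<open>The factor \<open>\<gamma>\<^sub>b + 1\<close> produced by the derivative is the one by which the weight grows in the direction \<open>b\<close>, and the
decay of \<open>\<phi>\<close> matches the factor \<open>\<gamma>\<^sub>s + 1\<close> by which it grows in the direction \<open>s\<close>; the degrees cancel.\<close>

lemma
  fixes u :: "'a::euclidean_space pser"
  assumes s: "s \<in> Basis" and b: "b \<in> Basis" "b \<noteq> s" and m: "m \<ge> 1"
    and \<phi>: "\<And>k. \<bar>\<phi> k\<bar> \<le> K / (real k + 1)"
  shows coef_pow_deriv: "coef (pow_deriv s m b (diag s \<phi> u)) \<alpha> =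
      (if m \<le> expo \<alpha> s then dcoef b (coef (diag s \<phi> u)) (\<alpha> - power_index s m) else 0)"
    and norm_pow_deriv_le: "norm (pow_deriv s m b (diag s \<phi> u)) \<le> K * norm u"
proof -
  have K: "0 \<le> K" using \<phi>[of 0] by simp
  have \<phi>K: "\<bar>\<phi> k\<bar> \<le> K" for k
    using \<phi>[of k] divide_left_mono[of 1 "real k + 1" K] K by simp
  define c where "c \<alpha> = (if m \<le> expo \<alpha> s then (real (expo \<alpha> b) + 1) * \<phi> (expo \<alpha> s - m) else 0)" for \<alpha> :: "'a mindex"
  define \<tau> where "\<tau> \<alpha> = \<alpha> - power_index s m + unit_index b" for \<alpha> :: "'a mindex"
  have eq: "(\<lambda>\<alpha>. if m \<le> expo \<alpha> s then dcoef b (coef (diag s \<phi> u)) (\<alpha> - power_index s m) else 0)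
      = (\<lambda>\<alpha>. c \<alpha> * coef u (\<tau> \<alpha>))"
    using s b by (auto simp: fun_eq_iff c_def \<tau>_def dcoef_def coef_diag[OF \<phi>K])
  have bound: "\<bar>c \<alpha>\<bar> * wt \<alpha> \<le> K * wt (\<tau> \<alpha>)" for \<alpha>
  proof (cases "m \<le> expo \<alpha> s")
    case True
    define \<gamma> where "\<gamma> = \<alpha> - power_index s m"
    have \<alpha>: "\<alpha> = \<gamma> + power_index s m" unfolding \<gamma>_def using power_index_decompose[OF s True] by simp
    have c: "\<bar>c \<alpha>\<bar> = (real (expo \<gamma> b) + 1) * \<bar>\<phi> (expo \<gamma> s)\<bar>"
      using True s b by (simp add: c_def \<gamma>_def abs_mult)
    have "\<bar>c \<alpha>\<bar> * wt \<alpha> * (real (deg \<gamma>) + 1)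
        = (real (expo \<gamma> b) + 1) * \<bar>\<phi> (expo \<gamma> s)\<bar> * ((real (deg \<gamma>) + 1) * wt (\<gamma> + power_index s m))"
      unfolding c by (subst \<alpha>) (simp add: ac_simps)
    also have "\<dots> \<le> (real (expo \<gamma> b) + 1) * (K / (real (expo \<gamma> s) + 1)) * ((real (expo \<gamma> s) + 1) * wt \<gamma>)"
      by (intro mult_mono wt_unit_plus_power_le s m \<phi>) (auto intro!: mult_nonneg_nonneg divide_nonneg_nonneg K)
    also have "\<dots> = K * (wt \<gamma> * (real (expo \<gamma> b) + 1))" by (simp add: field_simps)
    also have "\<dots> = K * wt (\<tau> \<alpha>) * (real (deg \<gamma>) + 1)"
      using wt_unit_plus[OF b(1), of \<gamma>] by (simp add: \<tau>_def flip: \<gamma>_def)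
    finally show ?thesis by (rule mult_right_le_imp_le) simp
  qed (simp add: c_def K)
  have inj: "inj_on \<tau> {\<alpha>. c \<alpha> \<noteq> 0}"
  proof (rule inj_onI)
    fix \<alpha> \<beta> assume *: "\<alpha> \<in> {\<alpha>. c \<alpha> \<noteq> 0}" "\<beta> \<in> {\<alpha>. c \<alpha> \<noteq> 0}" "\<tau> \<alpha> = \<tau> \<beta>"
    then have "m \<le> expo \<alpha> s" "m \<le> expo \<beta> s" "\<alpha> - power_index s m = \<beta> - power_index s m"
      by (auto simp: c_def \<tau>_def split: if_splits)
    then show "\<alpha> = \<beta>" using power_index_decompose[OF s] by metis
  qed
  show "coef (pow_deriv s m b (diag s \<phi> u)) \<alpha> =
      (if m \<le> expo \<alpha> s then dcoef b (coef (diag s \<phi> u)) (\<alpha> - power_index s m) else 0)"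
    using coef_op_bound(1)[OF bound inj K, of u] fun_cong[OF eq] by (simp add: pow_deriv_def eq)
  show "norm (pow_deriv s m b (diag s \<phi> u)) \<le> K * norm u"
    unfolding pow_deriv_def eq by (rule coef_op_bound(2)[OF bound inj K])
qed

lemma pow_deriv_diff:
  fixes u v :: "'a::euclidean_space pser"
  assumes s: "s \<in> Basis" and b: "b \<in> Basis" "b \<noteq> s" and m: "m \<ge> 1"
    and \<phi>: "\<And>k. \<bar>\<phi> k\<bar> \<le> K / (real k + 1)"
  shows "pow_deriv s m b (diag s \<phi> u) - pow_deriv s m b (diag s \<phi> v) = pow_deriv s m b (diag s \<phi> (u - v))"
proof (rule pser_eqI)
  have K: "0 \<le> K" using \<phi>[of 0] by simp
  have \<phi>K: "\<bar>\<phi> k\<bar> \<le> K" for k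
    using \<phi>[of k] divide_left_mono[of 1 "real k + 1" K] K by simp
  fix \<alpha>
  show "coef (pow_deriv s m b (diag s \<phi> u) - pow_deriv s m b (diag s \<phi> v)) \<alpha>
      = coef (pow_deriv s m b (diag s \<phi> (u - v))) \<alpha>"
    by (simp add: coef_pow_deriv[OF s b m \<phi>] dcoef_def coef_diag[OF \<phi>K] algebra_simps)
qed

lemma interior_radius:
  fixes z :: "'a::euclidean_space"
  assumes "\<And>b. b \<in> Basis \<Longrightarrow> \<bar>z \<bullet> b\<bar> < R"
  shows "\<exists>r. 0 < r \<and> r < R \<and> (\<forall>b\<in>Basis. \<bar>z \<bullet> b\<bar> \<le> r)"
proof -
  obtain c :: 'a where c: "c \<in> Basis" using nonempty_Basis by blast
  have R: "0 < R" using assms[OF c] by (rule order_le_less_trans[OF abs_ge_zero])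
  let ?M = "Max ((\<lambda>b. \<bar>z \<bullet> b\<bar>) ` Basis)"
  have "?M < R" using assms by (subst Max_less_iff) auto
  then show ?thesis using R
    by (intro exI[of _ "max (R / 2) ?M"]) (auto simp: le_max_iff_disj)
qed

text \<open>The relation between coefficients that defines \<open>pow_deriv\<close> is the differential operator for the evaluated functions.
For \<open>j = 1\<close> and \<open>b = s\<close> it is the Euler operator \<open>z\<^sub>s \<partial>\<^sub>s\<close>, see \<open>dcoef_self\<close>.\<close>

lemma ev_pow_deriv:
  fixes u v :: "'a::euclidean_space pser"
  assumes s: "s \<in> Basis" and b: "b \<in> Basis"
    and v: "\<And>\<alpha>. coef v \<alpha> = (if j \<le> expo \<alpha> s then dcoef b (coef u) (\<alpha> - power_index s j) else 0)"
    and w: "\<And>c. c \<in> Basis \<Longrightarrow> \<bar>w \<bullet> c\<bar> < 1 / DIM('a)"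
  shows "ev w v = (w \<bullet> s) ^ j * dir_deriv b (\<lambda>z. ev z u) w"
    and "((\<lambda>h. ev (w + h *\<^sub>R b) u) has_real_derivative dir_deriv b (\<lambda>z. ev z u) w) (at 0)"
proof -
  have e: "expands (coef u) (1 / DIM('a)) 0 (\<lambda>z. ev z u)"
    using expands_ev[of 1 u 0] by simp
  obtain r where r: "0 < r" "r < 1 / DIM('a)" "\<And>c. c \<in> Basis \<Longrightarrow> \<bar>w \<bullet> c\<bar> \<le> r"
    using interior_radius[OF w] by blast
  have wbox: "w \<in> ebox" using w by (auto simp: ebox_def less_imp_le)
  show "((\<lambda>h. ev (w + h *\<^sub>R b) u) has_real_derivative dir_deriv b (\<lambda>z. ev z u) w) (at 0)"
    by (rule expands_dir_deriv(2)[OF e r(1,2) b]) (use r in simp)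
  have "((\<lambda>\<gamma>. dcoef b (coef u) \<gamma> * mpow (\<lambda>c. (w - 0) \<bullet> c) \<gamma>) has_sum dir_deriv b (\<lambda>z. ev z u) w) UNIV"
    by (rule expands_has_sum[OF expands_dir_deriv(1)[OF e r(1,2) b]]) (use r in simp)
  then have "((\<lambda>\<gamma>. (w \<bullet> s) ^ j * (dcoef b (coef u) \<gamma> * mpow (\<lambda>c. w \<bullet> c) \<gamma>)) has_sum
      (w \<bullet> s) ^ j * dir_deriv b (\<lambda>z. ev z u) w) UNIV"
    by (intro has_sum_cmult_right) simp
  also have "?this \<longleftrightarrow> ((\<lambda>\<alpha>. coef v \<alpha> * mpow (\<lambda>c. w \<bullet> c) \<alpha>) has_sum
      (w \<bullet> s) ^ j * dir_deriv b (\<lambda>z. ev z u) w) (range (\<lambda>\<gamma>. \<gamma> + power_index s j))"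
    unfolding has_sum_reindex[OF inj_plus_index]
    by (rule has_sum_cong) (use s in \<open>simp add: v mpow_plus\<close>)
  also have "\<dots> \<longleftrightarrow> ((\<lambda>\<alpha>. coef v \<alpha> * mpow (\<lambda>c. w \<bullet> c) \<alpha>) has_sum
      (w \<bullet> s) ^ j * dir_deriv b (\<lambda>z. ev z u) w) UNIV"
  proof (rule has_sum_cong_neutral)
    fix \<alpha> assume "\<alpha> \<in> UNIV - range (\<lambda>\<gamma>. \<gamma> + power_index s j)"
    then have "\<not> j \<le> expo \<alpha> s" using power_index_decompose[OF s, of j \<alpha>] by (metis DiffD2 rangeI)
    then show "coef v \<alpha> * mpow (\<lambda>c. w \<bullet> c) \<alpha> = 0" by (simp add: v)
  qed auto
  finally show "ev w v = (w \<bullet> s) ^ j * dir_deriv b (\<lambda>z. ev z u) w"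
    using ev_has_sum[OF wbox, of v] by (rule has_sum_unique[rotated])
qed

section \<open>Rescaled functions on boxes\<close>

definition scaled :: "'a::euclidean_space \<Rightarrow> real \<Rightarrow> 'a pser \<Rightarrow> 'a \<Rightarrow> real" where
  "scaled p d u z = ev ((1 / d) *\<^sub>R (z - p)) u"

definition open_box :: "'a::euclidean_space \<Rightarrow> real \<Rightarrow> 'a set" where
  "open_box p R = {z. \<forall>b\<in>Basis. \<bar>(z - p) \<bullet> b\<bar> < R}"

lemma open_open_box [simp]: "open (open_box p R)"
proof -
  have "open {z. \<bar>(z - p) \<bullet> b\<bar> < R}" for b
    by (intro open_Collect_less continuous_intros)
  then have "open (\<Inter>b\<in>Basis. {z. \<bar>(z - p) \<bullet> b\<bar> < R})" by (intro open_INT) auto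
  moreover have "open_box p R = (\<Inter>b\<in>Basis. {z. \<bar>(z - p) \<bullet> b\<bar> < R})" by (auto simp: open_box_def)
  ultimately show ?thesis by simp
qed

lemma open_box_center [simp]: "R > 0 \<Longrightarrow> p \<in> open_box p R"
  by (simp add: open_box_def)

lemma eventually_open_box: "R > 0 \<Longrightarrow> \<forall>\<^sub>F z in nhds p. z \<in> open_box p R"
  using eventually_nhds_in_open[OF open_open_box open_box_center] by blast

lemma eventually_open_box': "z \<in> open_box p R \<Longrightarrow> \<forall>\<^sub>F z' in nhds z. z' \<in> open_box p R"
  using eventually_nhds_in_open[OF open_open_box] by blast

lemma open_box_scaled:
  fixes p :: "'a::euclidean_space"
  assumes "d > 0" "z \<in> open_box p (d / DIM('a))"
  shows "\<And>c. c \<in> Basis \<Longrightarrow> \<bar>((1 / d) *\<^sub>R (z - p)) \<bullet> c\<bar> < 1 / DIM('a)"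
    and "(1 / d) *\<^sub>R (z - p) \<in> ebox"
proof -
  show *: "\<bar>((1 / d) *\<^sub>R (z - p)) \<bullet> c\<bar> < 1 / DIM('a)" if "c \<in> Basis" for c
  proof -
    have "\<bar>(z - p) \<bullet> c\<bar> < d / DIM('a)" using assms(2) that by (simp add: open_box_def)
    then show ?thesis using assms(1) by (simp only: inner_scaleR_left abs_mult) (simp add: field_simps)
  qed
  show "(1 / d) *\<^sub>R (z - p) \<in> ebox" using * by (auto simp: ebox_def intro: less_imp_le)
qed

lemma expands_scaled:
  "d > 0 \<Longrightarrow> expands (\<lambda>\<alpha>. coef u \<alpha> / d ^ deg \<alpha>) (d / DIM('a)) p (scaled p d u)"
  for p :: "'a::euclidean_space"
  using expands_ev[of d u p] by (simp add: scaled_def[abs_def])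

text \<open>Each factor \<open>z\<^sub>s\<close> contributes \<open>d\<close> and the derivative contributes \<open>1 / d\<close>. The hypothesis on \<open>p\<close> puts the center on
the hyperplane where \<open>z\<^sub>s\<close> vanishes.\<close>

lemma scaled_pow_deriv:
  fixes u v :: "'a::euclidean_space pser"
  assumes s: "s \<in> Basis" and b: "b \<in> Basis" and d: "d > 0" and p: "p \<bullet> s = 0"
    and v: "\<And>\<alpha>. coef v \<alpha> = (if j \<le> expo \<alpha> s then dcoef b (coef u) (\<alpha> - power_index s j) else 0)"
    and z: "z \<in> open_box p (d / DIM('a))"
  shows "(z \<bullet> s) ^ j * dir_deriv b (scaled p d u) z = d ^ j / d * scaled p d v z"
proof -
  define w where "w = (1 / d) *\<^sub>R (z - p)"
  note ev = ev_pow_deriv[OF s b v open_box_scaled(1)[OF d z], folded w_def]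
  have "((\<lambda>h. ev (w + (h / d) *\<^sub>R b) u) has_real_derivative dir_deriv b (\<lambda>z. ev z u) w * (1 / d)) (at 0)"
    by (rule DERIV_chain2[where g = "\<lambda>h. h / d"]) (use ev(2) d in \<open>auto intro!: derivative_eq_intros\<close>)
  moreover have "ev (w + (h / d) *\<^sub>R b) u = scaled p d u (z + h *\<^sub>R b)" for h
  proof -
    have "w + (h / d) *\<^sub>R b = (1 / d) *\<^sub>R (z + h *\<^sub>R b - p)"
      using d by (simp add: w_def algebra_simps)
    then show ?thesis by (simp add: scaled_def)
  qed
  ultimately have "dir_deriv b (scaled p d u) z = dir_deriv b (\<lambda>z. ev z u) w * (1 / d)"
    by (intro dir_deriv_eqI) simp
  moreover have "z \<bullet> s = d * (w \<bullet> s)" using d p by (simp add: w_def inner_diff_left)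
  moreover have "scaled p d v z = (w \<bullet> s) ^ j * dir_deriv b (\<lambda>z. ev z u) w"
    unfolding scaled_def by (fold w_def) (rule ev(1))
  ultimately show ?thesis by (simp add: power_mult_distrib)
qed

lemma finite_deg_le: "finite {\<alpha> :: 'a::euclidean_space mindex. deg \<alpha> \<le> n}"
proof (rule finite_subset)
  show "finite (Mindex ` (\<Pi>\<^sub>E b\<in>(Basis :: 'a set). {..n}))" by (intro finite_imageI finite_PiE) auto
  show "{\<alpha> :: 'a mindex. deg \<alpha> \<le> n} \<subseteq> Mindex ` (\<Pi>\<^sub>E b\<in>Basis. {..n})"
  proof
    fix \<alpha> :: "'a mindex" assume "\<alpha> \<in> {\<alpha>. deg \<alpha> \<le> n}"
    then have "expo \<alpha> \<in> (\<Pi>\<^sub>E b\<in>Basis. {..n})"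
      using expo[of \<alpha>] expo_le_deg[of _ \<alpha>] by (auto simp: multi_indices_def PiE_iff intro: order_trans)
    then show "\<alpha> \<in> Mindex ` (\<Pi>\<^sub>E b\<in>Basis. {..n})" by (metis expo_inverse image_eqI)
  qed
qed

lemma eventually_nhds_open_box:
  fixes p :: "'a::euclidean_space"
  assumes "eventually P (nhds p)"
  shows "\<exists>R>0. \<forall>z\<in>open_box p R. P z"
proof -
  obtain e where e: "e > 0" "\<And>z. dist z p < e \<Longrightarrow> P z"
    using assms unfolding eventually_nhds_metric by blast
  have "P z" if "z \<in> open_box p (e / (2 * DIM('a)))" for z
  proof (rule e(2))
    have "norm (z - p) \<le> real DIM('a) * (e / (2 * DIM('a)))"
      using that by (intro norm_le_box) (auto simp: open_box_def intro: less_imp_le)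
    then show "dist z p < e" using e(1) by (simp add: dist_norm)
  qed
  then show ?thesis using e(1) by (intro exI[of _ "e / (2 * DIM('a))"]) auto
qed

lemma open_box_mono: "r \<le> R \<Longrightarrow> open_box p r \<subseteq> open_box p R"
  by (force simp: open_box_def)

lemma expands_open_box_DERIV:
  assumes e: "expands C R p g" and b: "b \<in> Basis" and z: "z \<in> open_box p R"
  shows "((\<lambda>h. g (z + h *\<^sub>R b)) has_real_derivative dir_deriv b g z) (at 0)"
    and "((\<lambda>h. dir_deriv b g (z + h *\<^sub>R b)) has_real_derivative dir_deriv b (dir_deriv b g) z) (at 0)"
proof -
  obtain r where r: "0 < r" "r < R" "\<forall>c\<in>Basis. \<bar>(z - p) \<bullet> c\<bar> \<le> r"
    using interior_radius[of "z - p" R] z by (auto simp: open_box_def)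
  show "((\<lambda>h. g (z + h *\<^sub>R b)) has_real_derivative dir_deriv b g z) (at 0)"
    by (rule expands_dir_deriv(2)[OF e r(1,2) b]) (use r in auto)
  obtain r' where r': "r < r'" "r' < R" using dense[OF r(2)] by blast
  have e': "expands (dcoef b C) r' p (dir_deriv b g)" by (rule expands_dir_deriv(1)[OF e _ r'(2) b]) (use r r' in simp)
  show "((\<lambda>h. dir_deriv b g (z + h *\<^sub>R b)) has_real_derivative dir_deriv b (dir_deriv b g) z) (at 0)"
    by (rule expands_dir_deriv(2)[OF e' r(1) r'(1) b]) (use r in auto)
qed

lemma dcoef_self:
  assumes "s \<in> Basis"
  shows "(if 1 \<le> expo \<alpha> s then dcoef s C (\<alpha> - power_index s 1) else 0) = real (expo \<alpha> s) * C \<alpha>"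
  using assms power_index_decompose[OF assms, of 1 \<alpha>] by (auto simp: dcoef_def power_index_1[simplified])

lemma
  fixes p :: "'a::euclidean_space"
  assumes "d > 0" "z \<in> open_box p (d / DIM('a))"
  shows scaled_add: "scaled p d (u + v) z = scaled p d u z + scaled p d v z"
    and scaled_diff: "scaled p d (u - v) z = scaled p d u z - scaled p d v z"
    and scaled_mult: "scaled p d (u * v) z = scaled p d u z * scaled p d v z"
    and scaled_scaleR: "scaled p d (c *\<^sub>R u) z = c * scaled p d u z"
    and scaled_of_real: "scaled p d (of_real c) z = c"
    and scaled_0: "scaled p d 0 z = 0"
    and scaled_sum: "scaled p d (\<Sum>i\<in>I. f i) z = (\<Sum>i\<in>I. scaled p d (f i) z)"
    and scaled_mpow: "scaled p d (mpow W \<alpha>) z = mpow (\<lambda>b. scaled p d (W b) z) \<alpha>"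
    and scaled_le: "\<bar>scaled p d u z\<bar> \<le> norm u"
  using open_box_scaled(2)[OF assms] unfolding scaled_def
  by (rule ev_add ev_diff ev_mult ev_scaleR ev_of_real ev_0 ev_sum ev_mpow abs_ev_le)+

lemma lifts_scaled:
  fixes p :: "'a::euclidean_space"
  assumes "lifts e G p"
  shows "\<forall>\<^sub>F d in at_right 0. \<forall>z\<in>open_box p (d / DIM('a)). scaled p d (e d) z = G z"
proof -
  have "\<forall>\<^sub>F d in at_right 0. \<forall>z\<in>ebox. ev z (e d) = G (p + d *\<^sub>R z)" using assms by (simp add: lifts_def)
  moreover have "\<forall>\<^sub>F d :: real in at_right 0. d > 0" by (simp add: eventually_at_right_less)
  ultimately show ?thesis
  proof eventually_elim
    case (elim d)
    show ?case
    proof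
      fix z assume "z \<in> open_box p (d / DIM('a))"
      from bspec[OF elim(1) open_box_scaled(2)[OF elim(2) this]] elim(2)
      show "scaled p d (e d) z = G z" by (simp add: scaled_def)
    qed
  qed
qed

lemma eventually_open_box_at_right:
  fixes p :: "'a::euclidean_space"
  assumes "eventually P (nhds p)"
  shows "\<forall>\<^sub>F d in at_right 0. \<forall>z\<in>open_box p (d / DIM('a)). P z"
proof -
  obtain R where R: "R > 0" "\<And>z. z \<in> open_box p R \<Longrightarrow> P z" using eventually_nhds_open_box[OF assms] by blast
  have "P z" if "d < R * DIM('a)" "z \<in> open_box p (d / DIM('a))" for d z
    using that open_box_mono[of "d / DIM('a)" R p] by (intro R(2)) (auto simp: field_simps)
  then show ?thesis unfolding eventually_at_right_field using R(1)
    by (intro exI[of _ "R * DIM('a)"]) auto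
qed

lemma quadratic_le_exponential: "(real n + x)\<^sup>2 \<le> (x + 3)\<^sup>2 * 2 ^ n" if "x \<ge> 0"
proof -
  have "(real n + x + 3)\<^sup>2 \<le> (x + 3)\<^sup>2 * 2 ^ n"
  proof (induction n)
    case (Suc n)
    have "(y + 1)\<^sup>2 \<le> 2 * y\<^sup>2" if "y \<ge> 3" for y :: real
    proof -
      have "0 \<le> (y - 3) * (y + 1) + 2" using that by simp
      then show ?thesis by (simp add: power2_eq_square algebra_simps)
    qed
    from this[of "real n + x + 3"] Suc that show ?case by (simp add: algebra_simps)
  qed simp
  moreover have "(real n + x)\<^sup>2 \<le> (real n + x + 3)\<^sup>2" using that by (intro power_mono) auto
  ultimately show ?thesis by linarith
qed

section \<open>A Fuchsian equation\<close>

text \<open>The equation for the profile \<open>Y\<close>, freed from its origin. The singular variable is the coordinate along \<open>e0\<close>, the other basis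
vectors are the space directions, \<open>q\<close> is the vector \<open>(1, - \<nabla>\<psi>)\<close> and \<open>K \<alpha>\<close> is the coefficient of the monomial \<open>\<alpha>\<close> in the
polynomial \<open>f\<close>, multiplied by \<open>s\<^sup>m\<^sup>+\<^sup>1\<^sup>-\<^sup>|\<^sup>\<alpha>\<^sup>|\<close>. This power is why \<open>K \<alpha>\<close> vanishes on \<open>s = 0\<close> in degrees at most \<open>m\<close>. The set \<open>Z\<close>
is the part of the hyperplane \<open>s = 0\<close> from which the solution starts; it is open in the hyperplane. The identity for the
top degree says that \<open>\<Gamma> = 0\<close> solves the equation on \<open>Z\<close>.\<close>

locale fuchsian =
  fixes e0 :: "'a::euclidean_space" and m :: nat and g0 :: real
    and A lap :: "'a \<Rightarrow> real" and q :: "'a \<Rightarrow> 'a" and K :: "'a mindex \<Rightarrow> 'a \<Rightarrow> real"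
    and Z :: "'a set"
  assumes e0: "e0 \<in> Basis" and m: "2 \<le> m" and g0: "g0 \<noteq> 0"
    and Z0: "p \<in> Z \<Longrightarrow> p \<bullet> e0 = 0"
    and Z_open: "p \<in> Z \<Longrightarrow> \<forall>\<^sub>F p' in nhds p. p' \<bullet> e0 = 0 \<longrightarrow> p' \<in> Z"
    and A_an: "p \<in> Z \<Longrightarrow> analytic_at A p" and lap_an: "p \<in> Z \<Longrightarrow> analytic_at lap p"
    and q_an: "p \<in> Z \<Longrightarrow> b \<in> Basis \<Longrightarrow> analytic_at (\<lambda>z. q z \<bullet> b) p"
    and K_an: "p \<in> Z \<Longrightarrow> deg \<alpha> \<le> m + 1 \<Longrightarrow> analytic_at (K \<alpha>) p"
    and A_nz: "p \<in> Z \<Longrightarrow> A p \<noteq> 0"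
    and K_low: "p \<in> Z \<Longrightarrow> deg \<alpha> \<le> m \<Longrightarrow> K \<alpha> p = 0"
    and K_top: "p \<in> Z \<Longrightarrow> (\<Sum>\<alpha> | deg \<alpha> = m + 1. K \<alpha> p * mpow (\<lambda>b. q p \<bullet> b) \<alpha>) = - A p / (real m * g0 ^ m)"
begin

text \<open>\<open>g0 + Gam Y\<close> is \<open>s\<close> times the time derivative of the solution.\<close>

definition Gam :: "('a \<Rightarrow> real) \<Rightarrow> 'a \<Rightarrow> real" where
  "Gam Y z = ((real m - 1) * Y z + z \<bullet> e0 * dir_deriv e0 Y z) / real m"

text \<open>\<open>s\<close> times the space-time gradient of the solution.\<close>

definition zeta :: "('a \<Rightarrow> real) \<Rightarrow> 'a \<Rightarrow> 'a \<Rightarrow> real" where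
  "zeta Y z b = (g0 + Gam Y z) * (q z \<bullet> b) + (if b = e0 then 0 else (z \<bullet> e0) ^ m * dir_deriv b Y z)"

text \<open>\<open>s\<^sup>m\<^sup>+\<^sup>1\<close> times the difference of the two sides of the wave equation.\<close>

definition Res :: "('a \<Rightarrow> real) \<Rightarrow> 'a \<Rightarrow> real" where
  "Res Y z = A z / real m * (z \<bullet> e0 * dir_deriv e0 (Gam Y) z - Gam Y z - g0)
    + (z \<bullet> e0) ^ m * lap z * (g0 + Gam Y z)
    - 2 * (\<Sum>b\<in>Basis - {e0}. (q z \<bullet> b) * ((z \<bullet> e0) ^ m * dir_deriv b (Gam Y) z))
    - (\<Sum>b\<in>Basis - {e0}. (z \<bullet> e0) ^ (2 * m) * dir_deriv b (dir_deriv b Y) z)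
    - (\<Sum>\<alpha> | deg \<alpha> \<le> m + 1. K \<alpha> z * mpow (zeta Y z) \<alpha>)"

lemma Res_cong:
  assumes "\<forall>\<^sub>F z' in nhds z. Y z' = Y' z'"
  shows "Res Y z = Res Y' z"
proof -
  note d = dir_deriv_eventually_eq[OF assms]
  have G: "\<forall>\<^sub>F z' in nhds z. Gam Y z' = Gam Y' z'"
    using assms d[of e0] by eventually_elim (simp add: Gam_def)
  have "Gam Y z = Gam Y' z" "dir_deriv b (Gam Y) z = dir_deriv b (Gam Y') z" "dir_deriv b (dir_deriv b Y) z = dir_deriv b (dir_deriv b Y') z"
    "dir_deriv b Y z = dir_deriv b Y' z" for b
    using eventually_nhds_x_imp_x[OF G] eventually_nhds_x_imp_x[OF dir_deriv_eventually_eq[OF G, of b]]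
      eventually_nhds_x_imp_x[OF dir_deriv_eventually_eq[OF d[of b], of b]] eventually_nhds_x_imp_x[OF d[of b]]
    by simp_all
  moreover from this have "zeta Y z = zeta Y' z" by (intro ext) (simp add: zeta_def)
  ultimately show ?thesis by (simp add: Res_def)
qed

text \<open>The unknown of the fixed point problem is \<open>h = (s \<partial>\<^sub>s + m) \<Gamma>\<close>. Then \<open>\<Gamma>\<close> and \<open>Y\<close> are recovered from \<open>h\<close> by inverting
\<open>s \<partial>\<^sub>s + m\<close> and \<open>(s \<partial>\<^sub>s + m - 1) / m\<close>, which is division of the coefficients of \<open>s\<^sup>k\<close>.\<close>

abbreviation GamE :: "'a pser \<Rightarrow> 'a pser" where
  "GamE \<equiv> diag e0 (\<lambda>k. 1 / (real k + real m))"

abbreviation YE :: "'a pser \<Rightarrow> 'a pser" where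
  "YE \<equiv> diag e0 (\<lambda>k. real m / ((real k + real m) * (real k + real m - 1)))"

lemma GamE_weight: "\<bar>1 / (real k + real m)\<bar> \<le> 1 / (real k + 1)"
  using m by (simp add: frac_le)

lemma GamE_weight': "\<bar>1 / (real k + real m)\<bar> \<le> 1"
  using m by simp

lemma YE_weight: "\<bar>real m / ((real k + real m) * (real k + real m - 1))\<bar> \<le> 1 / (real k + 1)"
proof -
  have "real m / (real k + real m) * (1 / (real k + real m - 1)) \<le> 1 * (1 / (real k + 1))"
    using m by (intro mult_mono) (auto simp: frac_le)
  then show ?thesis using m by (simp add: abs_mult)
qed

lemma YE_weight': "\<bar>real m / ((real k + real m) * (real k + real m - 1))\<bar> \<le> 1"
  by (rule order_trans[OF YE_weight]) simp

lemmas coef_GamE = coef_diag[OF GamE_weight', of e0]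
lemmas coef_YE = coef_diag[OF YE_weight', of e0]

text \<open>In rescaled variables these are \<open>s\<^sup>m \<partial>\<^sub>b \<Gamma>\<close>, \<open>s\<^sup>m \<partial>\<^sub>b Y\<close> and \<open>s\<^sup>2\<^sup>m \<partial>\<^sub>b\<^sup>2 Y\<close>.\<close>

abbreviation M1 :: "'a \<Rightarrow> 'a pser \<Rightarrow> 'a pser" where "M1 b h \<equiv> pow_deriv e0 m b (GamE h)"
abbreviation M2 :: "'a \<Rightarrow> 'a pser \<Rightarrow> 'a pser" where "M2 b h \<equiv> pow_deriv e0 m b (YE h)"
abbreviation M3 :: "'a \<Rightarrow> 'a pser \<Rightarrow> 'a pser" where "M3 b h \<equiv> pow_deriv e0 m b (M2 b h)"

lemma m_ge_1: "m \<ge> 1" using m by simp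

text \<open>Two derivatives of \<open>Y\<close> need two factors of decay, which \<open>YE\<close> has. They are distributed over the two derivatives by
writing \<open>M2\<close> as \<open>M1\<close> followed by a diagonal operator with the decay required for the second derivative. The values at
\<open>k < 2\<close> are irrelevant because \<open>M1\<close> produces only powers \<open>s\<^sup>k\<close> with \<open>k \<ge> m\<close>.\<close>

definition M2_weight :: "nat \<Rightarrow> real" where
  "M2_weight k = (if 2 \<le> k then real m / (real k - 1) else 0)"

lemma M2_weight_le: "\<bar>M2_weight k\<bar> \<le> 3 * real m / (real k + 1)"
proof (cases "2 \<le> k")
  case True
  then have "real m * (real k + 1) \<le> real m * (3 * (real k - 1))" by (intro mult_left_mono) auto
  with True show ?thesis by (simp add: M2_weight_def divide_simps) (simp add: algebra_simps)
qed (simp add: M2_weight_def)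

lemma M2_eq_diag:
  assumes b: "b \<in> Basis" "b \<noteq> e0"
  shows "M2 b h = diag e0 M2_weight (M1 b h)"
proof (rule pser_eqI)
  fix \<alpha>
  have bd: "\<bar>M2_weight k\<bar> \<le> 3 * real m" for k
    using M2_weight_le[of k] divide_left_mono[of 1 "real k + 1" "3 * real m"] by simp
  show "coef (M2 b h) \<alpha> = coef (diag e0 M2_weight (M1 b h)) \<alpha>"
    using b e0 m
    by (auto simp: coef_diag[OF bd] coef_pow_deriv[OF e0 b m_ge_1 YE_weight] coef_pow_deriv[OF e0 b m_ge_1 GamE_weight]
        dcoef_def coef_GamE coef_YE M2_weight_def of_nat_diff mult.commute mult.left_commute)
qed

lemma coef_M3:
  assumes b: "b \<in> Basis" "b \<noteq> e0"
  shows "coef (M3 b h) \<alpha> = (if m \<le> expo \<alpha> e0 then dcoef b (coef (M2 b h)) (\<alpha> - power_index e0 m) else 0)"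
  unfolding M2_eq_diag[OF b] by (rule coef_pow_deriv[OF e0 b m_ge_1 M2_weight_le])

lemma vanishing_ops:
  shows "vanishing (\<lambda>d h. GamE h)"
    and "b \<in> Basis \<Longrightarrow> b \<noteq> e0 \<Longrightarrow> vanishing (\<lambda>d h. M1 b h)"
    and "b \<in> Basis \<Longrightarrow> b \<noteq> e0 \<Longrightarrow> vanishing (\<lambda>d h. M2 b h)"
    and "b \<in> Basis \<Longrightarrow> b \<noteq> e0 \<Longrightarrow> vanishing (\<lambda>d h. M3 b h)"
proof -
  show "vanishing (\<lambda>d h. GamE h)"
    by (rule vanishing_linear[OF norm_diag_le[OF GamE_weight'] diag_diff[OF GamE_weight']])
  assume b: "b \<in> Basis" "b \<noteq> e0"
  note n1 = norm_pow_deriv_le[OF e0 b m_ge_1 GamE_weight] and d1 = pow_deriv_diff[OF e0 b m_ge_1 GamE_weight]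
  show "vanishing (\<lambda>d h. M1 b h)" by (rule vanishing_linear[OF n1 d1])
  show "vanishing (\<lambda>d h. M2 b h)"
    by (rule vanishing_linear[OF norm_pow_deriv_le[OF e0 b m_ge_1 YE_weight] pow_deriv_diff[OF e0 b m_ge_1 YE_weight]])
  show "vanishing (\<lambda>d h. M3 b h)"
    unfolding M2_eq_diag[OF b]
  proof (rule vanishing_linear)
    fix h h'
    have "norm (pow_deriv e0 m b (diag e0 M2_weight (M1 b h))) \<le> 3 * real m * norm (M1 b h)"
      by (rule norm_pow_deriv_le[OF e0 b m_ge_1 M2_weight_le])
    also have "\<dots> \<le> 3 * real m * (1 * norm h)" by (intro mult_left_mono n1) auto
    finally show "norm (pow_deriv e0 m b (diag e0 M2_weight (M1 b h))) \<le> 3 * real m * norm h" by simp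
    show "pow_deriv e0 m b (diag e0 M2_weight (M1 b h)) - pow_deriv e0 m b (diag e0 M2_weight (M1 b h'))
        = pow_deriv e0 m b (diag e0 M2_weight (M1 b (h - h')))"
      unfolding pow_deriv_diff[OF e0 b m_ge_1 M2_weight_le] d1 by simp
  qed
qed

text \<open>The counterparts of \<open>zeta\<close> and \<open>Res\<close> in the algebra of power series, with lifts in place of the coefficients. The powers of
\<open>d\<close> are those of \<open>scaled_pow_deriv\<close>, and \<open>el\<close> lifts the product \<open>s\<^sup>m lap\<close>.\<close>

definition zetaE :: "('a \<Rightarrow> real \<Rightarrow> 'a pser) \<Rightarrow> real \<Rightarrow> 'a pser \<Rightarrow> 'a \<Rightarrow> 'a pser" where
  "zetaE eq d h b = (of_real g0 + GamE h) * eq b d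
    + (if b = e0 then 0 else of_real (d ^ (m - 1)) * M2 b h)"

definition resE :: "(real \<Rightarrow> 'a pser) \<Rightarrow> (real \<Rightarrow> 'a pser) \<Rightarrow> ('a \<Rightarrow> real \<Rightarrow> 'a pser) \<Rightarrow>
    ('a mindex \<Rightarrow> real \<Rightarrow> 'a pser) \<Rightarrow> real \<Rightarrow> 'a pser \<Rightarrow> 'a pser" where
  "resE eA el eq eK d h =
    (1 / real m) *\<^sub>R (eA d * (h + (- (real m + 1)) *\<^sub>R GamE h + of_real (- g0)))
    + el d * (of_real g0 + GamE h)
    + (\<Sum>b\<in>Basis - {e0}. of_real (- 2 * d ^ (m - 1)) * (eq b d * M1 b h))
    + (\<Sum>b\<in>Basis - {e0}. of_real (- (d ^ (2 * (m - 1)))) * M3 b h)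
    + (\<Sum>\<alpha> | deg \<alpha> \<le> m + 1. (- 1) *\<^sub>R (eK \<alpha> d * mpow (zetaE eq d h) \<alpha>))"

text \<open>The linear part of the equation. The terms with space derivatives carry positive powers of \<open>d\<close> and drop out, the coefficients
become their values at \<open>p\<close>, and of the polynomial only the top degree \<open>- (A / (m g0\<^sup>m)) (g0 + \<Gamma>)\<^sup>m\<^sup>+\<^sup>1\<close> survives. Its linearization
cancels the multiple \<open>m + 1\<close> of \<open>\<Gamma>\<close> that comes from \<open>s \<partial>\<^sub>s \<Gamma> - \<Gamma> = h - (m + 1) \<Gamma>\<close>, and \<open>(A / m) h\<close> is left.\<close>

lemma cong_small_resE:
  assumes p: "p \<in> Z" and eA: "(eA \<longlongrightarrow> of_real (A p)) (at_right 0)"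
    and el: "(el \<longlongrightarrow> 0) (at_right 0)"
    and eq: "\<And>b. b \<in> Basis \<Longrightarrow> (eq b \<longlongrightarrow> of_real (q p \<bullet> b)) (at_right 0)"
    and eK: "\<And>\<alpha>. deg \<alpha> \<le> m + 1 \<Longrightarrow> (eK \<alpha> \<longlongrightarrow> of_real (K \<alpha> p)) (at_right 0)"
  shows "cong_small (resE eA el eq eK) (\<lambda>d h. (A p / real m) *\<^sub>R h)"
proof -
  define G :: "real \<Rightarrow> 'a pser \<Rightarrow> 'a pser" where "G = (\<lambda>d h. of_real g0 + GamE h)"
  have lip_id: "lip (\<lambda>d h. h)" 
    by (rule vanishing_imp_lip[OF vanishing_linear[where K = 1]]) auto
  note lipL = vanishing_imp_lip[OF vanishing_ops(1)]
  have lipG: "lip G" unfolding G_def by (intro lip_add lip_const lipL)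
  have pow0: "((\<lambda>d. of_real (c * d ^ j)) \<longlongrightarrow> (0 :: 'a pser)) (at_right 0)" if "j \<ge> 1" for c :: real and j
  proof -
    have "((\<lambda>d. of_real (c * d ^ j)) \<longlongrightarrow> (of_real (c * 0 ^ j) :: 'a pser)) (at_right 0)"
      by (intro tendsto_intros)
    then show ?thesis using that by (cases j) simp_all
  qed
  have c1: "cong_small (\<lambda>d h. (1 / real m) *\<^sub>R (eA d * (h + (- (real m + 1)) *\<^sub>R GamE h + of_real (- g0))))
      (\<lambda>d h. (1 / real m) *\<^sub>R (of_real (A p) * (h + (- (real m + 1)) *\<^sub>R GamE h + of_real (- g0))))"
    by (intro cong_small_scaleR cong_small_mult cong_small_tendsto eA cong_small_refl lip_add lip_const
        lip_scaleR lipL lip_id)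
  have c2: "cong_small (\<lambda>d h. el d * (of_real g0 + GamE h)) (\<lambda>d h. 0 * (of_real g0 + GamE h))"
    by (intro cong_small_mult cong_small_tendsto el cong_small_refl lip_add lip_const lipL)
  have c3: "cong_small (\<lambda>d h. \<Sum>b\<in>Basis - {e0}. of_real (- 2 * d ^ (m - 1)) * (eq b d * M1 b h))
      (\<lambda>d h. \<Sum>b\<in>Basis - {e0}. 0 * (of_real (q p \<bullet> b) * M1 b h))"
    using m by (intro cong_small_sum cong_small_mult cong_small_tendsto pow0 eq cong_small_refl
        vanishing_imp_lip[OF vanishing_ops(2)]) auto
  have c4: "cong_small (\<lambda>d h. \<Sum>b\<in>Basis - {e0}. of_real (- (d ^ (2 * (m - 1)))) * M3 b h)
      (\<lambda>d h. \<Sum>b\<in>Basis - {e0}. 0 * M3 b h)"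
    using m pow0[of "2 * (m - 1)" "- 1"] by (intro cong_small_sum cong_small_mult cong_small_tendsto cong_small_refl
        vanishing_imp_lip[OF vanishing_ops(4)]) auto
  have cz: "cong_small (\<lambda>d h. zetaE eq d h b) (\<lambda>d h. G d h * of_real (q p \<bullet> b))" if b: "b \<in> Basis" for b
  proof -
    have "cong_small (\<lambda>d h. if b = e0 then 0 else of_real (d ^ (m - 1)) * M2 b h)
        (\<lambda>d h. if b = e0 then 0 else 0 * M2 b h)"
    proof (cases "b = e0")
      case False
      have "cong_small (\<lambda>d h. of_real (d ^ (m - 1)) * M2 b h) (\<lambda>d h. 0 * M2 b h)"
        using m b False pow0[of "m - 1" 1] by (intro cong_small_mult cong_small_tendsto cong_small_refl
            vanishing_imp_lip[OF vanishing_ops(3)]) auto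
      then show ?thesis using False by simp
    qed (simp add: cong_small_refl lip_const)
    moreover have "cong_small (\<lambda>d h. G d h * eq b d) (\<lambda>d h. G d h * of_real (q p \<bullet> b))"
      by (intro cong_small_mult cong_small_refl lipG cong_small_tendsto eq b)
    ultimately have "cong_small (\<lambda>d h. G d h * eq b d + (if b = e0 then 0 else of_real (d ^ (m - 1)) * M2 b h))
        (\<lambda>d h. G d h * of_real (q p \<bullet> b) + (if b = e0 then 0 else 0 * M2 b h))"
      by (intro cong_small_add)
    then show ?thesis by (simp add: zetaE_def G_def cong: if_cong)
  qed
  have cm: "cong_small (\<lambda>d h. mpow (zetaE eq d h) \<alpha>) (\<lambda>d h. of_real (mpow (\<lambda>b. q p \<bullet> b) \<alpha>) * G d h ^ deg \<alpha>)" for \<alpha>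
  proof -
    have "cong_small (\<lambda>d h. mpow (zetaE eq d h) \<alpha>) (\<lambda>d h. mpow (\<lambda>b. G d h * of_real (q p \<bullet> b)) \<alpha>)"
      unfolding mpow_def by (intro cong_small_prod cong_small_power cz)
    moreover have "mpow (\<lambda>b. of_real (q p \<bullet> b)) \<alpha> = (of_real (mpow (\<lambda>b. q p \<bullet> b) \<alpha>) :: 'a pser)"
      by (simp add: mpow_def)
    ultimately show ?thesis by (simp add: mpow_mult mpow_const mult.commute)
  qed
  have c5: "cong_small (\<lambda>d h. \<Sum>\<alpha> | deg \<alpha> \<le> m + 1. (- 1) *\<^sub>R (eK \<alpha> d * mpow (zetaE eq d h) \<alpha>))
     (\<lambda>d h. \<Sum>\<alpha> | deg \<alpha> \<le> m + 1. (- 1) *\<^sub>R (of_real (K \<alpha> p) * (of_real (mpow (\<lambda>b. q p \<bullet> b) \<alpha>) * G d h ^ deg \<alpha>)))"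
    by (intro cong_small_sum cong_small_scaleR cong_small_mult cm cong_small_tendsto eK) auto
  have top: "(\<Sum>\<alpha> | deg \<alpha> \<le> m + 1. (- 1) *\<^sub>R (of_real (K \<alpha> p) * (of_real (mpow (\<lambda>b. q p \<bullet> b) \<alpha>) * G d h ^ deg \<alpha>)))
      = (A p / (real m * g0 ^ m)) *\<^sub>R G d h ^ (m + 1)" for d h
  proof -
    have "(\<Sum>\<alpha> | deg \<alpha> \<le> m + 1. (- 1) *\<^sub>R (of_real (K \<alpha> p) * (of_real (mpow (\<lambda>b. q p \<bullet> b) \<alpha>) * G d h ^ deg \<alpha>)))
        = (\<Sum>\<alpha> | deg \<alpha> = m + 1. (- (K \<alpha> p * mpow (\<lambda>b. q p \<bullet> b) \<alpha>)) *\<^sub>R G d h ^ (m + 1))"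
    proof (rule sum.mono_neutral_cong_right)
      show "\<forall>\<alpha>\<in>{\<alpha>. deg \<alpha> \<le> m + 1} - {\<alpha>. deg \<alpha> = m + 1}.
          (- 1) *\<^sub>R (of_real (K \<alpha> p) * (of_real (mpow (\<lambda>b. q p \<bullet> b) \<alpha>) * G d h ^ deg \<alpha>)) = 0"
        using K_low[OF p] by auto
    qed (auto simp: finite_deg_le scaleR_conv_of_real mult.assoc)
    also have "\<dots> = (- (\<Sum>\<alpha> | deg \<alpha> = m + 1. K \<alpha> p * mpow (\<lambda>b. q p \<bullet> b) \<alpha>)) *\<^sub>R G d h ^ (m + 1)"
      by (simp add: sum_negf scaleR_sum_left[symmetric])
    finally show ?thesis unfolding K_top[OF p] by simp
  qed
  have lin: "cong_small (\<lambda>d h. (A p / (real m * g0 ^ m)) *\<^sub>R G d h ^ (m + 1))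
      (\<lambda>d h. (A p / (real m * g0 ^ m)) *\<^sub>R (of_real (g0 ^ (m + 1)) + (real (m + 1) * g0 ^ (m + 1 - 1)) *\<^sub>R GamE h))"
    unfolding G_def by (intro cong_small_scaleR cong_small_power_linearize vanishing_ops)
  have c5': "cong_small (\<lambda>d h. \<Sum>\<alpha> | deg \<alpha> \<le> m + 1. (- 1) *\<^sub>R (eK \<alpha> d * mpow (zetaE eq d h) \<alpha>))
      (\<lambda>d h. (A p / (real m * g0 ^ m)) *\<^sub>R (of_real (g0 ^ (m + 1)) + (real (m + 1) * g0 ^ (m + 1 - 1)) *\<^sub>R GamE h))"
    by (rule cong_small_trans[OF c5]) (unfold top, rule lin)
  have "(1 / real m) *\<^sub>R (of_real (A p) * (h + (- (real m + 1)) *\<^sub>R GamE h + of_real (- g0)))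
      + 0 * (of_real g0 + GamE h) + (\<Sum>b\<in>Basis - {e0}. 0 * (of_real (q p \<bullet> b) * M1 b h))
      + (\<Sum>b\<in>Basis - {e0}. 0 * M3 b h)
      + (A p / (real m * g0 ^ m)) *\<^sub>R (of_real (g0 ^ (m + 1)) + (real (m + 1) * g0 ^ (m + 1 - 1)) *\<^sub>R GamE h)
      = (A p / real m) *\<^sub>R h" for h
  proof -
    have gm: "A p * (g0 * g0 ^ m) / (real m * g0 ^ m) = A p * g0 / real m"
      "A p * ((real m + 1) * g0 ^ m) / (real m * g0 ^ m) = A p * (real m + 1) / real m"
      using g0 m by (simp_all add: field_simps)
    have "of_real (A p) * (h + (- (real m + 1)) *\<^sub>R GamE h + of_real (- g0))
        = A p *\<^sub>R h - (A p * (real m + 1)) *\<^sub>R GamE h - (A p * g0) *\<^sub>R 1"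
      by (simp add: of_real_def algebra_simps)
    moreover have "(A p / (real m * g0 ^ m)) *\<^sub>R (of_real (g0 ^ (m + 1)) + (real (m + 1) * g0 ^ (m + 1 - 1)) *\<^sub>R GamE h)
        = (A p * g0 / real m) *\<^sub>R 1 + (A p * (real m + 1) / real m) *\<^sub>R GamE h"
      using gm by (simp add: of_real_def scaleR_add_right add.commute)
    ultimately show ?thesis
      by (simp add: scaleR_diff_right)
  qed
  then show ?thesis
    using cong_small_add[OF cong_small_add[OF cong_small_add[OF cong_small_add[OF c1 c2] c3] c4] c5']
    unfolding resE_def[abs_def] by simp
qed


text \<open>Identities between coefficients: \<open>k\<close> times the coefficient of \<open>Y\<close> equals that of \<open>m \<Gamma> - (m - 1) Y\<close>, and
\<open>k\<close> times the coefficient of \<open>\<Gamma>\<close> equals that of \<open>h - m \<Gamma>\<close>.\<close>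

lemma scaled_YE:
  assumes p: "p \<in> Z" and d: "d > 0" and z: "z \<in> open_box p (d / DIM('a))"
  shows "Gam (scaled p d (YE h)) z = scaled p d (GamE h) z"
    and "z \<bullet> e0 * dir_deriv e0 (scaled p d (GamE h)) z = scaled p d h z - real m * scaled p d (GamE h) z"
proof -
  have "z \<bullet> e0 * dir_deriv e0 (scaled p d (YE h)) z
      = scaled p d (real m *\<^sub>R GamE h - (real m - 1) *\<^sub>R YE h) z"
  proof -
    have "coef (real m *\<^sub>R GamE h - (real m - 1) *\<^sub>R YE h) \<alpha>
        = (if 1 \<le> expo \<alpha> e0 then dcoef e0 (coef (YE h)) (\<alpha> - power_index e0 1) else 0)" for \<alpha>
    proof -
      define k where "k = real (expo \<alpha> e0)"
      have nz: "k + real m \<noteq> 0" "k + real m - 1 \<noteq> 0" using m by (auto simp: k_def)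
      have "real m / (k + real m) - (real m - 1) * (real m / ((k + real m) * (k + real m - 1)))
          = k * (real m / ((k + real m) * (k + real m - 1)))"
        using nz by (simp add: divide_simps) (simp add: algebra_simps)
      from arg_cong[OF this, of "\<lambda>x. x * coef h \<alpha>"] show ?thesis
        unfolding dcoef_self[OF e0] by (simp add: coef_GamE coef_YE flip: k_def) (simp add: algebra_simps)
    qed
    from scaled_pow_deriv[OF e0 e0 d Z0[OF p] this z] show ?thesis using d by simp
  qed
  then show "Gam (scaled p d (YE h)) z = scaled p d (GamE h) z"
    using m by (simp add: Gam_def scaled_diff[OF d z] scaled_scaleR[OF d z])
  have "coef (h - real m *\<^sub>R GamE h) \<alpha>
      = (if 1 \<le> expo \<alpha> e0 then dcoef e0 (coef (GamE h)) (\<alpha> - power_index e0 1) else 0)" for \<alpha>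
  proof -
    define k where "k = real (expo \<alpha> e0)"
    have nz: "k + real m \<noteq> 0" using m by (auto simp: k_def)
    have "1 - real m * (1 / (k + real m)) = k * (1 / (k + real m))"
      using nz by (simp add: divide_simps)
    from arg_cong[OF this, of "\<lambda>x. x * coef h \<alpha>"] show ?thesis
      unfolding dcoef_self[OF e0] by (simp add: coef_GamE flip: k_def) (simp add: algebra_simps)
  qed
  from scaled_pow_deriv[OF e0 e0 d Z0[OF p] this z]
  show "z \<bullet> e0 * dir_deriv e0 (scaled p d (GamE h)) z = scaled p d h z - real m * scaled p d (GamE h) z"
    using d by (simp add: scaled_diff[OF d z] scaled_scaleR[OF d z])
qed

lemma scaled_M:
  assumes p: "p \<in> Z" and d: "d > 0" and z: "z \<in> open_box p (d / DIM('a))" and b: "b \<in> Basis" "b \<noteq> e0"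
  shows "(z \<bullet> e0) ^ m * dir_deriv b (scaled p d (GamE h)) z = d ^ (m - 1) * scaled p d (M1 b h) z"
    and "(z \<bullet> e0) ^ m * dir_deriv b (scaled p d (YE h)) z = d ^ (m - 1) * scaled p d (M2 b h) z"
    and "(z \<bullet> e0) ^ (2 * m) * dir_deriv b (dir_deriv b (scaled p d (YE h))) z = d ^ (2 * (m - 1)) * scaled p d (M3 b h) z"
proof -
  have dm: "d ^ m / d = d ^ (m - 1)" using d m_ge_1 by (cases m) auto
  note scale = scaled_pow_deriv[where j = m, OF e0 b(1) d Z0[OF p], unfolded dm]
  show "(z \<bullet> e0) ^ m * dir_deriv b (scaled p d (GamE h)) z = d ^ (m - 1) * scaled p d (M1 b h) z"
    by (rule scale[OF coef_pow_deriv[OF e0 b m_ge_1 GamE_weight] z])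
  have 2: "(z' \<bullet> e0) ^ m * dir_deriv b (scaled p d (YE h)) z' = d ^ (m - 1) * scaled p d (M2 b h) z'"
    if "z' \<in> open_box p (d / DIM('a))" for z'
    by (rule scale[OF coef_pow_deriv[OF e0 b m_ge_1 YE_weight] that])
  then show "(z \<bullet> e0) ^ m * dir_deriv b (scaled p d (YE h)) z = d ^ (m - 1) * scaled p d (M2 b h) z" using z .
  have "\<forall>\<^sub>F z' in nhds z. (z' \<bullet> e0) ^ m * dir_deriv b (scaled p d (YE h)) z' = d ^ (m - 1) * scaled p d (M2 b h) z'"
    using eventually_open_box'[OF z] by eventually_elim (rule 2)
  from eventually_nhds_x_imp_x[OF dir_deriv_eventually_eq[OF this, of b]]
  have "dir_deriv b (\<lambda>z'. (z' \<bullet> e0) ^ m * dir_deriv b (scaled p d (YE h)) z') z = dir_deriv b (\<lambda>z'. d ^ (m - 1) * scaled p d (M2 b h) z') z" .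
  moreover have "dir_deriv b (\<lambda>z'. (z' \<bullet> e0) ^ m * dir_deriv b (scaled p d (YE h)) z') z
      = (z \<bullet> e0) ^ m * dir_deriv b (dir_deriv b (scaled p d (YE h))) z"
  proof (rule dir_deriv_eqI)
    have "(z + x *\<^sub>R b) \<bullet> e0 = z \<bullet> e0" for x using b e0 by (simp add: inner_add_left inner_Basis)
    then show "((\<lambda>h'. ((z + h' *\<^sub>R b) \<bullet> e0) ^ m * dir_deriv b (scaled p d (YE h)) (z + h' *\<^sub>R b))
        has_real_derivative (z \<bullet> e0) ^ m * dir_deriv b (dir_deriv b (scaled p d (YE h))) z) (at 0)"
      using DERIV_cmult[OF expands_open_box_DERIV(2)[OF expands_scaled[OF d] b(1) z]] by simp
  qed
  moreover have "dir_deriv b (\<lambda>z'. d ^ (m - 1) * scaled p d (M2 b h) z') z = d ^ (m - 1) * dir_deriv b (scaled p d (M2 b h)) z"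
    by (rule dir_deriv_eqI) (rule DERIV_cmult[OF expands_open_box_DERIV(1)[OF expands_scaled[OF d] b(1) z]])
  ultimately have "(z \<bullet> e0) ^ m * dir_deriv b (dir_deriv b (scaled p d (YE h))) z = d ^ (m - 1) * dir_deriv b (scaled p d (M2 b h)) z"
    by simp
  then have "(z \<bullet> e0) ^ (2 * m) * dir_deriv b (dir_deriv b (scaled p d (YE h))) z
      = d ^ (m - 1) * ((z \<bullet> e0) ^ m * dir_deriv b (scaled p d (M2 b h)) z)"
    by (simp add: mult_2 power_add)
  also have "\<dots> = d ^ (m - 1) * (d ^ (m - 1) * scaled p d (M3 b h) z)"
    by (simp only: scale[OF coef_M3[OF b] z])
  finally show "(z \<bullet> e0) ^ (2 * m) * dir_deriv b (dir_deriv b (scaled p d (YE h))) z = d ^ (2 * (m - 1)) * scaled p d (M3 b h) z"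
    by (simp add: mult_2 power_add)
qed

lemma scaled_resE:
  assumes p: "p \<in> Z" and d: "d > 0" and z: "z \<in> open_box p (d / DIM('a))"
    and eA: "scaled p d (eA d) z = A z" and el: "scaled p d (el d) z = (z \<bullet> e0) ^ m * lap z"
    and eq: "\<And>b. b \<in> Basis \<Longrightarrow> scaled p d (eq b d) z = q z \<bullet> b"
    and eK: "\<And>\<alpha>. deg \<alpha> \<le> m + 1 \<Longrightarrow> scaled p d (eK \<alpha> d) z = K \<alpha> z"
  shows "scaled p d (resE eA el eq eK d h) z = Res (scaled p d (YE h)) z"
proof -
  note sc = scaled_add[OF d z] scaled_mult[OF d z] scaled_scaleR[OF d z] scaled_of_real[OF d z] scaled_0[OF d z]
    scaled_sum[OF d z] scaled_mpow[OF d z]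
  have G: "\<forall>\<^sub>F z' in nhds z. Gam (scaled p d (YE h)) z' = scaled p d (GamE h) z'"
    using eventually_open_box'[OF z] by eventually_elim (rule scaled_YE(1)[OF p d])
  have deriv_G: "dir_deriv b (Gam (scaled p d (YE h))) z = dir_deriv b (scaled p d (GamE h)) z" for b
    by (rule eventually_nhds_x_imp_x[OF dir_deriv_eventually_eq[OF G]])
  have "scaled p d (zetaE eq d h b) z = zeta (scaled p d (YE h)) z b" if b: "b \<in> Basis" for b
    using scaled_M(2)[OF p d z b, of h] eq[OF b]
    by (auto simp: zetaE_def zeta_def sc scaled_YE(1)[OF p d z] simp del: of_real_power)
  then have mp: "mpow (\<lambda>b. scaled p d (zetaE eq d h b) z) \<alpha> = mpow (zeta (scaled p d (YE h)) z) \<alpha>" for \<alpha>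
    by (rule mpow_cong)
  have s5: "(\<Sum>\<alpha> | deg \<alpha> \<le> m + 1. - 1 * (scaled p d (eK \<alpha> d) z * mpow (\<lambda>b. scaled p d (zetaE eq d h b) z) \<alpha>))
      = - (\<Sum>\<alpha> | deg \<alpha> \<le> m + 1. K \<alpha> z * mpow (zeta (scaled p d (YE h)) z) \<alpha>)"
    unfolding sum_negf[symmetric] by (rule sum.cong) (auto simp: eK mp)
  have s3: "(\<Sum>b\<in>Basis - {e0}. - 2 * d ^ (m - 1) * (scaled p d (eq b d) z * scaled p d (M1 b h) z))
      = - (2 * (\<Sum>b\<in>Basis - {e0}. (q z \<bullet> b) * ((z \<bullet> e0) ^ m * dir_deriv b (Gam (scaled p d (YE h))) z)))"
    unfolding sum_distrib_left sum_negf[symmetric] deriv_G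
    by (rule sum.cong) (auto simp: eq scaled_M(1)[OF p d z])
  have s4: "(\<Sum>b\<in>Basis - {e0}. - (d ^ (2 * (m - 1))) * scaled p d (M3 b h) z)
      = - (\<Sum>b\<in>Basis - {e0}. (z \<bullet> e0) ^ (2 * m) * dir_deriv b (dir_deriv b (scaled p d (YE h))) z)"
    unfolding sum_negf[symmetric]
    by (rule sum.cong) (auto simp: scaled_M(3)[OF p d z])
  have s1: "1 / real m * (A z * (scaled p d h z + - (real m + 1) * scaled p d (GamE h) z + - g0))
      = A z / real m * (z \<bullet> e0 * dir_deriv e0 (Gam (scaled p d (YE h))) z - Gam (scaled p d (YE h)) z - g0)"
    unfolding deriv_G scaled_YE(2)[OF p d z] scaled_YE(1)[OF p d z] by (simp add: algebra_simps)
  show ?thesis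
    unfolding resE_def sc s5 s3 s4 s1 eA el Res_def scaled_YE(1)[OF p d z] by simp
qed

text \<open>The equation, divided by its linear part at \<open>p\<close>, differs from the identity by a small map. Since evaluation is injective, fixed points are
the same as solutions near \<open>p\<close>.\<close>

lemma fixed_point_problem:
  assumes p: "p \<in> Z"
  shows "\<exists>T :: real \<Rightarrow> 'a pser \<Rightarrow> 'a pser. small T \<and>
    (\<forall>\<^sub>F d in at_right 0. \<forall>h. (T d h = h \<longleftrightarrow> (\<forall>z\<in>open_box p (d / DIM('a)). Res (scaled p d (YE h)) z = 0)))"
proof -
  obtain eA where eA: "lifts eA A p" using A_an[OF p] by (auto simp: analytic_at_iff_lifts)
  have "analytic_at (\<lambda>z. (z \<bullet> e0) ^ m * lap z) p"
    by (intro analytic_at_mult analytic_at_power analytic_at_coord e0 lap_an p)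
  then obtain el where el: "lifts el (\<lambda>z. (z \<bullet> e0) ^ m * lap z) p" by (auto simp: analytic_at_iff_lifts)
  have "\<forall>b\<in>Basis. \<exists>e. lifts e (\<lambda>z. q z \<bullet> b) p" using q_an[OF p] by (auto simp: analytic_at_iff_lifts)
  then obtain eq where eq: "\<And>b. b \<in> Basis \<Longrightarrow> lifts (eq b) (\<lambda>z. q z \<bullet> b) p" by metis
  have "\<forall>\<alpha>\<in>{\<alpha>. deg \<alpha> \<le> m + 1}. \<exists>e. lifts e (K \<alpha>) p"
    using K_an[OF p] by (auto simp: analytic_at_iff_lifts)
  then obtain eK where eK: "\<And>\<alpha>. deg \<alpha> \<le> m + 1 \<Longrightarrow> lifts (eK \<alpha>) (K \<alpha>) p"
    by (metis (mono_tags, lifting) mem_Collect_eq)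
  define T where "T d h = h - (real m / A p) *\<^sub>R resE eA el eq eK d h" for d h
  have mA: "real m / A p \<noteq> 0" "real m / A p * (A p / real m) = 1" using A_nz[OF p] m by auto
  have "(el \<longlongrightarrow> 0) (at_right 0)"
    using el Z0[OF p] m by (simp add: lifts_def zero_power)
  then have "cong_small (resE eA el eq eK) (\<lambda>d h. (A p / real m) *\<^sub>R h)"
    using eA eq eK by (intro cong_small_resE p) (auto simp: lifts_def)
  then have "small (\<lambda>d h. (- (real m / A p)) *\<^sub>R (resE eA el eq eK d h - (A p / real m) *\<^sub>R h))"
    by (intro small_scaleR) (simp add: cong_small_def)
  moreover have "(- (real m / A p)) *\<^sub>R (resE eA el eq eK d h - (A p / real m) *\<^sub>R h) = T d h" for d h
  proof -
    have "(- (real m / A p)) *\<^sub>R (resE eA el eq eK d h - (A p / real m) *\<^sub>R h)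
        = (real m / A p * (A p / real m)) *\<^sub>R h - (real m / A p) *\<^sub>R resE eA el eq eK d h"
      by (simp add: scaleR_diff_right)
    then show ?thesis unfolding mA(2) T_def by simp
  qed
  ultimately have "small T" by simp
  moreover have "\<forall>\<^sub>F d in at_right 0. \<forall>h. (T d h = h \<longleftrightarrow>
      (\<forall>z\<in>open_box p (d / DIM('a)). Res (scaled p d (YE h)) z = 0))"
  proof -
    have "\<forall>\<^sub>F d in at_right 0. \<forall>b\<in>Basis. \<forall>z\<in>open_box p (d / DIM('a)). scaled p d (eq b d) z = q z \<bullet> b"
      using lifts_scaled[OF eq] by (intro eventually_ball_finite) auto
    moreover have "\<forall>\<^sub>F d in at_right 0. \<forall>\<alpha>\<in>{\<alpha>. deg \<alpha> \<le> m + 1}. \<forall>z\<in>open_box p (d / DIM('a)). scaled p d (eK \<alpha> d) z = K \<alpha> z"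
      using lifts_scaled[OF eK] by (intro eventually_ball_finite finite_deg_le) auto
    moreover have "\<forall>\<^sub>F d :: real in at_right 0. d > 0" by (simp add: eventually_at_right_less)
    ultimately show ?thesis
      using lifts_scaled[OF eA] lifts_scaled[OF el]
    proof eventually_elim
      case (elim d)
      show ?case
      proof
        fix h
        have R: "scaled p d (resE eA el eq eK d h) z = Res (scaled p d (YE h)) z"
          if "z \<in> open_box p (d / DIM('a))" for z
          by (rule scaled_resE[OF p elim(3) that]) (use elim that in auto)
        have "T d h = h \<longleftrightarrow> resE eA el eq eK d h = 0" using mA(1) by (simp add: T_def)
        also have "\<dots> \<longleftrightarrow> (\<forall>z\<in>open_box p (d / DIM('a)). scaled p d (resE eA el eq eK d h) z = 0)"
        proof
          assume *: "\<forall>z\<in>open_box p (d / DIM('a)). scaled p d (resE eA el eq eK d h) z = 0"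
          have "\<forall>\<^sub>F w :: 'a in nhds 0. w \<in> open_box 0 (1 / DIM('a))" by (rule eventually_open_box) simp
          then have "\<forall>\<^sub>F w in nhds 0. ev w (resE eA el eq eK d h) = ev w 0"
          proof eventually_elim
            case (elim w)
            then have "p + d *\<^sub>R w \<in> open_box p (d / DIM('a))"
              using \<open>d > 0\<close> by (simp add: open_box_def abs_mult field_simps)
            with * have "scaled p d (resE eA el eq eK d h) (p + d *\<^sub>R w) = 0" by blast
            moreover have "w \<in> ebox" using elim by (auto simp: open_box_def ebox_def less_imp_le)
            ultimately show ?case using \<open>d > 0\<close> by (simp add: scaled_def ev_0)
          qed
          then show "resE eA el eq eK d h = 0" by (rule ev_inject)
        qed (simp add: scaled_0[OF elim(3)])
        also have "\<dots> \<longleftrightarrow> (\<forall>z\<in>open_box p (d / DIM('a)). Res (scaled p d (YE h)) z = 0)"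
          by (simp add: R)
        finally show "T d h = h \<longleftrightarrow> (\<forall>z\<in>open_box p (d / DIM('a)). Res (scaled p d (YE h)) z = 0)" .
      qed
    qed
  qed
  ultimately show ?thesis by blast
qed

text \<open>On \<open>s = 0\<close> the equation reduces to \<open>(A / m) g (g\<^sup>m / g0\<^sup>m - 1) = 0\<close> for \<open>g = g0 + \<Gamma>\<close>. Other roots than \<open>g0\<close> are excluded by
the smallness of \<open>\<Gamma>\<close>, which keeps \<open>g\<close> nonzero and of the same sign as \<open>g0\<close>.\<close>

lemma Res_initial:
  assumes z: "z \<in> Z" and Y: "Res Y z = 0" and small: "\<bar>Gam Y z\<bar> < \<bar>g0\<bar>"
  shows "Y z = 0"
proof -
  note z0 = Z0[OF z]
  define g where "g = g0 + Gam Y z"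
  have zpow: "(z \<bullet> e0) ^ m = 0" "(z \<bullet> e0) ^ (2 * m) = 0" using m by (simp_all add: z0 zero_power)
  have "(\<Sum>\<alpha> | deg \<alpha> \<le> m + 1. K \<alpha> z * mpow (zeta Y z) \<alpha>)
      = (\<Sum>\<alpha> | deg \<alpha> = m + 1. g ^ (m + 1) * (K \<alpha> z * mpow (\<lambda>b. q z \<bullet> b) \<alpha>))"
  proof (rule sum.mono_neutral_cong_right)
    fix \<alpha> :: "'a mindex" assume "\<alpha> \<in> {\<alpha>. deg \<alpha> = m + 1}"
    moreover have "mpow (zeta Y z) \<alpha> = mpow (\<lambda>b. g * (q z \<bullet> b)) \<alpha>"
      by (rule mpow_cong) (simp add: zeta_def g_def zpow)
    ultimately show "K \<alpha> z * mpow (zeta Y z) \<alpha> = g ^ (m + 1) * (K \<alpha> z * mpow (\<lambda>b. q z \<bullet> b) \<alpha>)"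
      by (simp add: mpow_mult mpow_const)
  qed (use K_low[OF z] in \<open>auto simp: finite_deg_le\<close>)
  also have "\<dots> = g ^ (m + 1) * (- A z / (real m * g0 ^ m))"
    by (simp only: sum_distrib_left[symmetric] K_top[OF z])
  finally have sum: "(\<Sum>\<alpha> | deg \<alpha> \<le> m + 1. K \<alpha> z * mpow (zeta Y z) \<alpha>)
      = g ^ (m + 1) * (- A z / (real m * g0 ^ m))" .
  have "A z / real m * (0 - Gam Y z - g0) - g ^ (m + 1) * (- A z / (real m * g0 ^ m)) = 0"
    using Y unfolding Res_def z0 zpow[unfolded z0] sum by simp
  moreover have "0 - Gam Y z - g0 = - g" by (simp add: g_def)
  ultimately have "A z / real m * (- g) + g ^ (m + 1) * (A z / (real m * g0 ^ m)) = 0"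
    by simp
  then have "A z / real m * g * (g ^ m / g0 ^ m - 1) = 0" by (simp add: algebra_simps)
  moreover have "g \<noteq> 0" using small by (auto simp: g_def)
  ultimately have "(g / g0) ^ m = 1" using A_nz[OF z] m by (simp add: power_divide)
  moreover have "0 \<le> g / g0" using small g0 by (auto simp: g_def zero_le_divide_iff abs_if split: if_splits)
  ultimately have "g / g0 = 1" using m power_eq_iff_eq_base[of m "g / g0" 1] by simp
  then have "Gam Y z = 0" using g0 by (simp add: g_def)
  then show "Y z = 0" using m by (simp add: Gam_def z0)
qed

theorem local_solution:
  assumes p: "p \<in> Z"
  shows "\<exists>Y C R. expands C R p Y \<and> (\<forall>z\<in>open_box p R. Res Y z = 0 \<and> (z \<bullet> e0 = 0 \<longrightarrow> z \<in> Z \<and> Y z = 0))"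
proof -
  obtain T :: "real \<Rightarrow> 'a pser \<Rightarrow> 'a pser" where T: "small T"
    and fp_iff: "\<forall>\<^sub>F d in at_right 0. \<forall>h. (T d h = h \<longleftrightarrow>
      (\<forall>z\<in>open_box p (d / DIM('a)). Res (scaled p d (YE h)) z = 0))"
    using fixed_point_problem[OF p] by blast
  obtain \<eta>0 where "\<eta>0 > 0"
    and ex: "\<And>\<eta>. 0 < \<eta> \<Longrightarrow> \<eta> \<le> \<eta>0 \<Longrightarrow> \<forall>\<^sub>F d in at_right 0. \<exists>!h. norm h \<le> \<eta> \<and> T d h = h"
    using small_fixed_point[OF T] by blast
  \<comment> \<open>The radius is small enough for \<open>Res_initial\<close>.\<close>
  define \<eta> where "\<eta> = min \<eta>0 (\<bar>g0\<bar> / 2)"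
  have \<eta>: "0 < \<eta>" "\<eta> \<le> \<eta>0" "\<eta> < \<bar>g0\<bar>" using \<open>\<eta>0 > 0\<close> g0 by (auto simp: \<eta>_def)
  have "\<forall>\<^sub>F d :: real in at_right 0. d > 0" by (simp add: eventually_at_right_less)
  with fp_iff ex[OF \<eta>(1,2)] eventually_open_box_at_right[OF Z_open[OF p]]
  have "\<forall>\<^sub>F d in at_right 0. \<exists>h. norm h \<le> \<eta> \<and> d > 0 \<and> (\<forall>z\<in>open_box p (d / DIM('a)).
      Res (scaled p d (YE h)) z = 0 \<and> (z \<bullet> e0 = 0 \<longrightarrow> z \<in> Z))"
  proof eventually_elim
    case (elim d)
    from elim(2) obtain h where h: "norm h \<le> \<eta>" "T d h = h" by blast
    with elim(1) have "\<forall>z\<in>open_box p (d / DIM('a)). Res (scaled p d (YE h)) z = 0" by simp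
    with h(1) elim(3,4) show ?case by blast
  qed
  then have "\<exists>d h. norm h \<le> \<eta> \<and> d > 0 \<and> (\<forall>z\<in>open_box p (d / DIM('a)).
      Res (scaled p d (YE h)) z = 0 \<and> (z \<bullet> e0 = 0 \<longrightarrow> z \<in> Z))"
    by (rule eventually_happens'[rotated]) simp
  then obtain d h where h: "norm h \<le> \<eta>" and d: "d > 0"
    and R: "\<And>z. z \<in> open_box p (d / DIM('a)) \<Longrightarrow> Res (scaled p d (YE h)) z = 0"
    and inZ: "\<And>z. z \<in> open_box p (d / DIM('a)) \<Longrightarrow> z \<bullet> e0 = 0 \<Longrightarrow> z \<in> Z" by blast
  have "scaled p d (YE h) z = 0" if z: "z \<in> open_box p (d / DIM('a))" "z \<bullet> e0 = 0" for z
  proof (rule Res_initial[OF inZ[OF z] R[OF z(1)]])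
    have "\<bar>Gam (scaled p d (YE h)) z\<bar> \<le> norm (GamE h)"
      unfolding scaled_YE(1)[OF p d z(1)] by (rule scaled_le[OF d z(1)])
    also have "\<dots> \<le> 1 * norm h" by (rule norm_diag_le[OF GamE_weight'])
    finally show "\<bar>Gam (scaled p d (YE h)) z\<bar> < \<bar>g0\<bar>" using h \<eta> by simp
  qed
  then show ?thesis
    using expands_scaled[OF d, of "YE h" p] R inZ by blast
qed

text \<open>Every analytic function that vanishes at \<open>p\<close> is of the form \<open>YE h\<close> after zooming in. The coefficients of \<open>h\<close> are those of
\<open>Y\<close> times a quadratic polynomial in \<open>k\<close>, which the geometric decay absorbs, and the missing constant term makes \<open>h\<close> of order \<open>d\<close>.\<close>

lemma YE_preimage:
  assumes e: "expands C R p Y" and C0: "C 0 = 0" and \<eta>: "\<eta> > 0"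
  shows "\<forall>\<^sub>F d in at_right 0. \<exists>h. norm h \<le> \<eta> \<and> (\<forall>z\<in>open_box p (d / DIM('a)). scaled p d (YE h) z = Y z)"
proof -
  note R = expands_pos[OF e] and s = expands_summable[OF e]
  define S where "S = (\<Sum>\<^sub>\<infinity>\<alpha>. \<bar>C \<alpha>\<bar> * R ^ deg \<alpha>)"
  have S0: "S \<ge> 0" unfolding S_def by (rule infsum_nonneg) (use R in auto)
  define B where "B = (real m + 3)\<^sup>2"
  define W where "W \<alpha> = (real (expo \<alpha> e0) + real m) * (real (expo \<alpha> e0) + real m - 1) / real m" for \<alpha> :: "'a mindex"
  have W: "0 < W \<alpha>" "W \<alpha> \<le> B * 2 ^ deg \<alpha>" for \<alpha>
  proof -
    show "0 < W \<alpha>" using m by (simp add: W_def)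
    have "W \<alpha> \<le> (real (expo \<alpha> e0) + real m) * (real (expo \<alpha> e0) + real m) / 1"
      unfolding W_def using m by (intro frac_le mult_left_mono) auto
    also have "\<dots> \<le> (real (deg \<alpha>) + real m) * (real (deg \<alpha>) + real m) / 1"
      using expo_le_deg[OF e0, of \<alpha>] by (intro divide_right_mono mult_mono) auto
    also have "\<dots> \<le> B * 2 ^ deg \<alpha>"
      using quadratic_le_exponential[of "real m" "deg \<alpha>"] by (simp add: B_def power2_eq_square)
    finally show "W \<alpha> \<le> B * 2 ^ deg \<alpha>" .
  qed
  have main: "\<exists>h. norm h \<le> 2 * d / R * (B * S) \<and> (\<forall>z\<in>open_box p (d / DIM('a)). scaled p d (YE h) z = Y z)"
    if d: "0 < d" "d \<le> R / 2" for d
  proof -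
    define u where "u \<alpha> = W \<alpha> * C \<alpha> * d ^ deg \<alpha>" for \<alpha>
    have u: "wt \<alpha> * \<bar>u \<alpha>\<bar> \<le> 2 * d / R * B * (\<bar>C \<alpha>\<bar> * R ^ deg \<alpha>)" for \<alpha>
    proof (cases "\<alpha> = 0")
      case False
      then have n: "1 \<le> deg \<alpha>" by (metis One_nat_def Suc_leI deg_eq_0_iff gr0I)
      have "wt \<alpha> * \<bar>u \<alpha>\<bar> \<le> 1 * \<bar>u \<alpha>\<bar>" by (intro mult_right_mono wt_le_1) auto
      also have "\<dots> = W \<alpha> * (\<bar>C \<alpha>\<bar> * d ^ deg \<alpha>)"
        using W(1)[of \<alpha>] d by (simp add: u_def abs_mult)
      also have "\<dots> \<le> (B * 2 ^ deg \<alpha>) * (\<bar>C \<alpha>\<bar> * d ^ deg \<alpha>)"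
        using d by (intro mult_right_mono W) auto
      also have "\<dots> = (2 * d / R) ^ deg \<alpha> * (B * (\<bar>C \<alpha>\<bar> * R ^ deg \<alpha>))"
        using R by (simp add: power_divide power_mult_distrib)
      also have "\<dots> \<le> (2 * d / R) ^ 1 * (B * (\<bar>C \<alpha>\<bar> * R ^ deg \<alpha>))"
        using n d R by (intro mult_right_mono power_decreasing) (auto simp: B_def field_simps)
      finally show ?thesis by simp
    qed (simp add: u_def C0)
    have s': "(\<lambda>\<alpha>. 2 * d / R * B * (\<bar>C \<alpha>\<bar> * R ^ deg \<alpha>)) summable_on UNIV"
      by (intro summable_on_cmult_right s)
    have su: "(\<lambda>\<alpha>. wt \<alpha> * \<bar>u \<alpha>\<bar>) summable_on UNIV"
      by (rule summable_on_comparison_test[OF s']) (use u in auto)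
    have "norm (Pser u) \<le> (\<Sum>\<^sub>\<infinity>\<alpha>. 2 * d / R * B * (\<bar>C \<alpha>\<bar> * R ^ deg \<alpha>))"
      unfolding norm_pser_def coef_Pser[OF su] by (intro infsum_mono su s' u)
    also have "\<dots> = 2 * d / R * (B * S)"
      unfolding S_def by (subst infsum_cmult_right') simp
    finally have n: "norm (Pser u) \<le> 2 * d / R * (B * S)" .
    have cN: "coef (YE (Pser u)) \<alpha> = C \<alpha> * d ^ deg \<alpha>" for \<alpha>
    proof -
      define k where "k = real (expo \<alpha> e0)"
      have nz: "k + real m \<noteq> 0" "k + real m - 1 \<noteq> 0" "real m \<noteq> 0" using m by (auto simp: k_def)
      show ?thesis using nz
        by (simp add: coef_YE coef_Pser[OF su] u_def W_def mult.assoc flip: k_def)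
    qed
    have "scaled p d (YE (Pser u)) z = Y z" if z: "z \<in> open_box p (d / DIM('a))" for z
    proof (rule has_sum_unique)
      have zb: "\<bar>(z - p) \<bullet> b\<bar> \<le> d / DIM('a)" if "b \<in> Basis" for b
        using z that by (auto simp: open_box_def less_imp_le)
      have "d / DIM('a) \<le> R" using d R
        by (simp add: divide_le_eq) (smt (verit, best) DIM_ge_Suc0 mult_le_cancel_left1 of_nat_1 of_nat_le_iff One_nat_def)
      then show "((\<lambda>\<alpha>. C \<alpha> * mpow (\<lambda>b. (z - p) \<bullet> b) \<alpha>) has_sum Y z) UNIV"
        by (intro expands_has_sum[OF e]) (use zb in \<open>auto intro: order_trans\<close>)
      show "((\<lambda>\<alpha>. C \<alpha> * mpow (\<lambda>b. (z - p) \<bullet> b) \<alpha>) has_sum scaled p d (YE (Pser u)) z) UNIV"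
        using expands_has_sum[OF expands_scaled[OF d(1), of "YE (Pser u)" p] zb] d(1) by (simp add: cN)
    qed
    with n show ?thesis by blast
  qed
  define d0 where "d0 = min (R / 2) (\<eta> * R / (2 * (B * S + 1)))"
  have BS: "0 \<le> B * S" using S0 by (simp add: B_def)
  have d0: "d0 > 0" using R \<eta> BS by (simp add: d0_def add_nonneg_pos)
  have "\<exists>h. norm h \<le> \<eta> \<and> (\<forall>z\<in>open_box p (d / DIM('a)). scaled p d (YE h) z = Y z)"
    if d: "0 < d" "d < d0" for d
  proof -
    have "d * (2 * (B * S + 1)) \<le> \<eta> * R"
      using d BS by (simp add: d0_def pos_less_divide_eq add_nonneg_pos less_imp_le)
    then have "2 * d / R * (B * S) \<le> \<eta>"
      using R d BS by (simp add: field_simps)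
    then show ?thesis using main[of d] d by (force simp: d0_def)
  qed
  then show ?thesis unfolding eventually_at_right_field using d0 by blast
qed

text \<open>After zooming in, both solutions come from fixed points in a ball in which the fixed point is unique.\<close>

theorem local_uniqueness:
  assumes p: "p \<in> Z" and an: "analytic_at Y p" "analytic_at Y' p"
    and Res: "\<forall>\<^sub>F z in nhds p. Res Y z = 0" "\<forall>\<^sub>F z in nhds p. Res Y' z = 0"
    and 0: "Y p = 0" "Y' p = 0"
  shows "\<forall>\<^sub>F z in nhds p. Y z = Y' z"
proof -
  obtain T :: "real \<Rightarrow> 'a pser \<Rightarrow> 'a pser" where T: "small T"
    and fp_iff: "\<forall>\<^sub>F d in at_right 0. \<forall>h. (T d h = h \<longleftrightarrow>
      (\<forall>z\<in>open_box p (d / DIM('a)). Res (scaled p d (YE h)) z = 0))"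
    using fixed_point_problem[OF p] by blast
  obtain \<eta> where "\<eta> > 0"
    and ex: "\<forall>\<^sub>F d in at_right 0. \<exists>!h. norm h \<le> \<eta> \<and> T d h = h"
    using small_fixed_point[OF T] by blast
  have pre: "\<forall>\<^sub>F d in at_right 0. \<exists>h. norm h \<le> \<eta> \<and> (\<forall>z\<in>open_box p (d / DIM('a)). scaled p d (YE h) z = Y z)"
    if "analytic_at Y p" "Y p = 0" for Y
  proof -
    from that(1) obtain C R where e: "expands C R p Y" by (auto simp: analytic_at_def)
    show ?thesis by (rule YE_preimage[OF e _ \<open>\<eta> > 0\<close>]) (use expands_center[OF e] that in simp)
  qed
  have "\<forall>\<^sub>F d :: real in at_right 0. d > 0" by (simp add: eventually_at_right_less)
  with fp_iff ex pre[OF an(1) 0(1)] pre[OF an(2) 0(2)]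
    eventually_open_box_at_right[OF Res(1)] eventually_open_box_at_right[OF Res(2)]
  have "\<forall>\<^sub>F d in at_right 0. d > 0 \<and> (\<forall>z\<in>open_box p (d / DIM('a)). Y z = Y' z)"
  proof eventually_elim
    case (elim d)
    have fp: "T d h = h" if h: "\<forall>z\<in>open_box p (d / DIM('a)). scaled p d (YE h) z = Y z"
      and R: "\<forall>z\<in>open_box p (d / DIM('a)). Res Y z = 0" for h Y
    proof -
      have "Res (scaled p d (YE h)) z = Res Y z" if "z \<in> open_box p (d / DIM('a))" for z
        by (rule Res_cong, rule eventually_mono[OF eventually_open_box'[OF that]]) (use h in blast)
      then show ?thesis using elim(1) R by simp
    qed
    obtain h h' where h: "norm h \<le> \<eta>" "\<forall>z\<in>open_box p (d / DIM('a)). scaled p d (YE h) z = Y z"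
      and h': "norm h' \<le> \<eta>" "\<forall>z\<in>open_box p (d / DIM('a)). scaled p d (YE h') z = Y' z"
      using elim(3,4) by blast
    have "h = h'" using elim(2) h(1) h'(1) fp[OF h(2) elim(5)] fp[OF h'(2) elim(6)] by blast
    then show ?case using h(2) h'(2) elim(7) by simp
  qed
  then have "\<exists>d. d > 0 \<and> (\<forall>z\<in>open_box p (d / DIM('a)). Y z = Y' z)"
    by (rule eventually_happens'[rotated]) simp
  then obtain d where "d > 0" "\<And>z. z \<in> open_box p (d / DIM('a)) \<Longrightarrow> Y z = Y' z" by blast
  then show ?thesis using eventually_open_box[of "d / DIM('a)" p] by (auto elim: eventually_mono)
qed

end

section \<open>Gluing the local solutions\<close>

lemma analytic_at_cong:
  assumes "analytic_at f p" "\<forall>\<^sub>F z in nhds p. f z = g z"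
  shows "analytic_at g p"
proof -
  from assms(1) obtain C R where e: "expands C R p f" by (auto simp: analytic_at_def)
  obtain R' where R': "R' > 0" "\<And>z. z \<in> open_box p R' \<Longrightarrow> f z = g z"
    using eventually_nhds_open_box[OF assms(2)] by blast
  define r where "r = min R (R' / 2)"
  have r: "0 < r" "r \<le> R" "r < R'" using R' expands_pos[OF e] by (auto simp: r_def)
  have "expands C r p g"
    by (rule expands_cong[OF expands_mono[OF e r(1,2)]]) (use r(3) R'(2) in \<open>force simp: open_box_def\<close>)
  then show ?thesis by (auto simp: analytic_at_def)
qed

context fuchsian begin

text \<open>Let \<open>y\<close> be the projection of \<open>z\<close> to \<open>s = 0\<close>. Both solutions agree near \<open>y\<close> by local uniqueness, hence have the
same power series at \<open>y\<close>. By \<open>expands_recenter\<close> both series still converge at \<open>z\<close>; this is the reason for the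
smaller boxes.\<close>

lemma local_solutions_agree:
  assumes p: "p \<in> Z" "p' \<in> Z" and e: "expands C R p Y" "expands C' R' p' Y'"
    and Y: "\<And>z. z \<in> open_box p R \<Longrightarrow> Res Y z = 0 \<and> (z \<bullet> e0 = 0 \<longrightarrow> z \<in> Z \<and> Y z = 0)"
    and Y': "\<And>z. z \<in> open_box p' R' \<Longrightarrow> Res Y' z = 0 \<and> (z \<bullet> e0 = 0 \<longrightarrow> z \<in> Z \<and> Y' z = 0)"
    and z: "z \<in> open_box p (R / (2 * DIM('a)))" "z \<in> open_box p' (R' / (2 * DIM('a)))"
  shows "Y z = Y' z"
proof -
  define y where "y = z - (z \<bullet> e0) *\<^sub>R e0"
  have y0: "y \<bullet> e0 = 0" using e0 by (simp add: y_def inner_diff_left)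
  have comp: "\<bar>(y - p) \<bullet> b\<bar> \<le> \<bar>(z - p) \<bullet> b\<bar>" if "b \<in> Basis" "p \<in> Z" for b p
    using e0 that(1) Z0[OF that(2)] by (cases "b = e0") (auto simp: y_def inner_diff_left inner_Basis)
  have zy: "\<bar>(z - y) \<bullet> b\<bar> \<le> \<bar>(z - p) \<bullet> b\<bar>" if "b \<in> Basis" "p \<in> Z" for b p
    using e0 that(1) Z0[OF that(2)] by (cases "b = e0") (auto simp: y_def inner_diff_left inner_Basis)
  have half: "R / (2 * DIM('a)) \<le> R / 2" if "R > 0" for R :: real
    using that DIM_ge_Suc0[where 'a='a] by (intro divide_left_mono) auto
  have center: "(\<exists>B. expands B (R / (2 * DIM('a))) y Y) \<and> Res Y y = 0 \<and> y \<in> Z \<and> Y y = 0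
      \<and> (\<forall>\<^sub>F y' in nhds y. Res Y y' = 0)"
    if p: "p \<in> Z" and e: "expands C R p Y"
      and Y: "\<And>z. z \<in> open_box p R \<Longrightarrow> Res Y z = 0 \<and> (z \<bullet> e0 = 0 \<longrightarrow> z \<in> Z \<and> Y z = 0)"
      and z: "z \<in> open_box p (R / (2 * DIM('a)))" for p C R Y
  proof -
    note R = expands_pos[OF e]
    have le: "\<bar>(y - p) \<bullet> b\<bar> < R / 2" if b: "b \<in> Basis" for b
    proof -
      have "\<bar>(z - p) \<bullet> b\<bar> < R / (2 * DIM('a))" using z b by (simp add: open_box_def)
      then show ?thesis using comp[OF b p] half[OF R] by linarith
    qed
    have yp: "y \<in> open_box p R" using le R by (fastforce simp: open_box_def)
    have "\<forall>\<^sub>F y' in nhds y. Res Y y' = 0"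
      using eventually_open_box'[OF yp] by eventually_elim (use Y in blast)
    then show ?thesis using expands_recenter[OF e less_imp_le[OF le]] Y[OF yp] y0 by blast
  qed
  from center[OF p(1) e(1) Y z(1)] obtain B where B: "expands B (R / (2 * DIM('a))) y Y"
    and *: "y \<in> Z" "Y y = 0" "\<forall>\<^sub>F y' in nhds y. Res Y y' = 0" by blast
  from center[OF p(2) e(2) Y' z(2)] obtain B' where B': "expands B' (R' / (2 * DIM('a))) y Y'"
    and b0: "Y' y = 0" "\<forall>\<^sub>F y' in nhds y. Res Y' y' = 0" by blast
  have "\<forall>\<^sub>F y' in nhds y. Y y' = Y' y'"
    by (rule local_uniqueness[OF *(1) _ _ *(3) b0(2) *(2) b0(1)]) (use B B' in \<open>auto simp: analytic_at_def\<close>)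
  then have "B = B'" by (rule expands_unique[OF B B'])
  have "((\<lambda>\<alpha>. B \<alpha> * mpow (\<lambda>b. (z - y) \<bullet> b) \<alpha>) has_sum Y z) UNIV"
    using z(1) by (intro expands_has_sum[OF B] order_trans[OF zy[OF _ p(1)]]) (auto simp: open_box_def less_imp_le)
  moreover have "((\<lambda>\<alpha>. B' \<alpha> * mpow (\<lambda>b. (z - y) \<bullet> b) \<alpha>) has_sum Y' z) UNIV"
    using z(2) by (intro expands_has_sum[OF B'] order_trans[OF zy[OF _ p(2)]]) (auto simp: open_box_def less_imp_le)
  ultimately show ?thesis unfolding \<open>B = B'\<close> by (rule has_sum_unique)
qed

theorem global_solution:
  shows "\<exists>Y W. open W \<and> Z \<subseteq> W \<and> (\<forall>z\<in>W. analytic_at Y z \<and> Res Y z = 0) \<and> (\<forall>z\<in>Z. Y z = 0)"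
proof -
  have "\<forall>p\<in>Z. \<exists>Y C R. expands C R p Y \<and> (\<forall>z\<in>open_box p R. Res Y z = 0 \<and> (z \<bullet> e0 = 0 \<longrightarrow> z \<in> Z \<and> Y z = 0))"
    using local_solution by blast
  then obtain y C R where e: "\<And>p. p \<in> Z \<Longrightarrow> expands (C p) (R p) p (y p)"
    and y: "\<And>p z. p \<in> Z \<Longrightarrow> z \<in> open_box p (R p) \<Longrightarrow> Res (y p) z = 0 \<and> (z \<bullet> e0 = 0 \<longrightarrow> z \<in> Z \<and> y p z = 0)"
    by metis
  define N where "N p = open_box p (R p / (2 * DIM('a)))" for p
  define W where "W = (\<Union>p\<in>Z. N p)"
  define Y where "Y z = y (SOME p. p \<in> Z \<and> z \<in> N p) z" for z
  have Y: "Y z = y p z" if "p \<in> Z" "z \<in> N p" for p z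
  proof -
    have "(SOME p. p \<in> Z \<and> z \<in> N p) \<in> Z \<and> z \<in> N (SOME p. p \<in> Z \<and> z \<in> N p)"
      by (rule someI_ex) (use that in blast)
    then show ?thesis unfolding Y_def N_def
      using that by (intro local_solutions_agree[OF _ that(1) e e y y]) (auto simp: N_def)
  qed
  have R: "R p > 0" if "p \<in> Z" for p using expands_pos[OF e[OF that]] .
  have half: "R / (2 * DIM('a)) \<le> R / 2" if "R > 0" for R :: real
    using that DIM_ge_Suc0[where 'a='a] by (intro divide_left_mono) auto
  have "analytic_at Y z \<and> Res Y z = 0" if "p \<in> Z" "z \<in> N p" for p z
  proof -
    have ev: "\<forall>\<^sub>F z' in nhds z. y p z' = Y z'"
      using eventually_open_box'[OF that(2)[unfolded N_def]]
      by eventually_elim (use Y[OF that(1)] in \<open>simp add: N_def\<close>)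
    have le: "\<bar>(z - p) \<bullet> b\<bar> < R p / 2" if b: "b \<in> Basis" for b
      using \<open>z \<in> N p\<close> b half[OF R[OF \<open>p \<in> Z\<close>]] by (force simp: N_def open_box_def)
    have "z \<in> open_box p (R p)" using le R[OF that(1)] by (fastforce simp: open_box_def)
    then have "Res (y p) z = 0" using y[OF that(1)] by blast
    moreover have "analytic_at (y p) z"
      using expands_recenter[OF e[OF that(1)] less_imp_le[OF le]] by (auto simp: analytic_at_def)
    ultimately show ?thesis using Res_cong[OF ev] analytic_at_cong[OF _ ev] by simp
  qed
  moreover have mem: "p \<in> N p" if "p \<in> Z" for p using R[OF that] by (simp add: N_def)
  moreover have "Y p = 0" if "p \<in> Z" for p
    using Y[OF that mem[OF that]] y[OF that, of p] R[OF that] Z0[OF that] by simp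
  moreover have "open W" by (auto simp: W_def N_def)
  ultimately show ?thesis by (intro exI[of _ Y] exI[of _ W]) (auto simp: W_def)
qed

end

section \<open>Real powers of analytic functions\<close>

text \<open>Insert the lift of \<open>f / f q - 1\<close>, which is small, into the binomial series.\<close>

lemma analytic_at_powr:
  assumes f: "analytic_at f q" and pos: "f q > 0"
  shows "analytic_at (\<lambda>z. f z powr r) q"
proof -
  define c where "c = f q"
  have c: "c > 0" using pos by (simp add: c_def)
  define w where "w z = (f z - c) * (1 / c)" for z
  have "analytic_at w q" unfolding w_def[abs_def] by (intro analytic_at_mult analytic_at_diff f analytic_at_const)
  then obtain e where e: "lifts e w q" by (auto simp: analytic_at_iff_lifts)
  have "w q = 0" by (simp add: w_def c_def)
  then have "(e \<longlongrightarrow> 0) (at_right 0)" using e by (simp add: lifts_def)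
  then have "\<forall>\<^sub>F d in at_right 0. norm (e d) < 1 / 2"
    using tendstoD[of e 0 "at_right 0" "1 / 2"] by simp
  moreover have "\<forall>\<^sub>F d in at_right 0. \<forall>z\<in>ebox. ev z (e d) = w (q + d *\<^sub>R z)" using e by (simp add: lifts_def)
  moreover have "\<forall>\<^sub>F d :: real in at_right 0. d > 0" by (simp add: eventually_at_right_less)
  ultimately have "\<forall>\<^sub>F d in at_right 0. \<exists>v. \<forall>z\<in>ebox. ev z v = f (q + d *\<^sub>R z) powr r"
  proof eventually_elim
    case (elim d)
    have "summable (\<lambda>n. (r gchoose n) * (3/4) ^ n)"
      using gen_binomial_real[of "3/4" r] by (simp add: sums_iff)
    from powser_insidea[OF this, of "1/2"]
    have sr: "summable (\<lambda>n. norm ((r gchoose n) * (1/2) ^ n))" by simp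
    have s: "summable (\<lambda>n. (r gchoose n) *\<^sub>R e d ^ n)"
    proof (rule summable_comparison_test'[OF sr])
      fix n :: nat
      have "norm (e d ^ n) \<le> (1/2) ^ n"
        using elim(1) by (intro order_trans[OF norm_power_ineq] power_mono) auto
      then show "norm ((r gchoose n) *\<^sub>R e d ^ n) \<le> norm ((r gchoose n) * (1/2) ^ n)"
        by (simp add: abs_mult mult_left_mono)
    qed
    have "ev z (c powr r *\<^sub>R (\<Sum>n. (r gchoose n) *\<^sub>R e d ^ n)) = f (q + d *\<^sub>R z) powr r" if z: "z \<in> ebox" for z
    proof -
      define x where "x = w (q + d *\<^sub>R z)"
      have ex: "ev z (e d) = x" using elim(2) z by (simp add: x_def)
      have "\<bar>x\<bar> < 1" using abs_ev_le[OF z, of "e d"] elim(1) by (simp add: ex)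
      then have "(\<lambda>n. (r gchoose n) * x ^ n) sums (1 + x) powr r" by (rule gen_binomial_real)
      moreover have "ev z (\<Sum>n. (r gchoose n) *\<^sub>R e d ^ n) = (\<Sum>n. ev z ((r gchoose n) *\<^sub>R e d ^ n))"
        by (rule bounded_linear.suminf[OF bounded_linear_ev[OF z] s])
      ultimately have "ev z (\<Sum>n. (r gchoose n) *\<^sub>R e d ^ n) = (1 + x) powr r"
        by (simp add: ev_scaleR[OF z] ev_power[OF z] ex sums_iff)
      moreover have "c powr r * (1 + x) powr r = (c * (1 + x)) powr r"
        by (rule powr_mult[symmetric])
      moreover have "c * (1 + x) = f (q + d *\<^sub>R z)" using c by (simp add: x_def w_def field_simps)
      ultimately show ?thesis by (simp add: ev_scaleR[OF z])
    qed
    then show ?case by blast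
  qed
  then obtain v where v: "\<forall>\<^sub>F d in at_right 0. \<forall>z\<in>ebox. ev z (v d) = f (q + d *\<^sub>R z) powr r"
    unfolding eventually_ex by blast
  show ?thesis by (rule analytic_at_if_ev[OF v])
qed

section \<open>Chain rule in the singular variable\<close>

abbreviation tdir :: "real \<times> (real ^ 'n)" where "tdir \<equiv> (1, 0)"
abbreviation xdir :: "'n \<Rightarrow> real \<times> (real ^ 'n)" where "xdir i \<equiv> (0, axis i 1)"

lemma Basis_tx: "(Basis :: (real \<times> (real ^ 'n)) set) = insert tdir (range xdir)"
  by (auto simp: Basis_prod_def Basis_vec_def)

lemma inj_xdir: "inj (xdir :: 'n \<Rightarrow> real \<times> (real ^ 'n))"
  by (rule injI) (simp add: axis_eq_axis)

lemma sum_xdir: "(\<Sum>b\<in>Basis - {tdir}. h b) = (\<Sum>i\<in>UNIV. h (xdir i :: real \<times> (real ^ 'n)))"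
proof -
  have "Basis - {tdir} = range (xdir :: 'n \<Rightarrow> real \<times> (real ^ 'n))" unfolding Basis_tx by auto
  then show ?thesis by (simp add: sum.reindex[OF inj_xdir])
qed

lemma sum_Basis_tx: "(\<Sum>b\<in>Basis. h b) = h tdir + (\<Sum>i\<in>UNIV. h (xdir i :: real \<times> (real ^ 'n)))"
proof -
  have "(\<Sum>b\<in>Basis. h b) = h tdir + (\<Sum>b\<in>Basis - {tdir}. h b)"
    by (rule sum.remove) (auto simp: Basis_tx)
  then show ?thesis by (simp add: sum_xdir)
qed

lemma partial_eq_dir_deriv: "partial i g = dir_deriv (axis i 1) g"
  by (simp add: fun_eq_iff partial_def dir_deriv_def)

lemma powr_root_DERIV:
  fixes y :: real and m :: nat
  assumes "y > 0" "m \<ge> 1"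
  shows "((\<lambda>y. y powr (1 / real m)) has_real_derivative y powr (1 / real m) / (real m * y)) (at y)"
proof -
  have "1 / real m * y powr (1 / real m - 1) = y powr (1 / real m) / (real m * y)"
    using assms by (simp add: powr_diff)
  with has_real_derivative_powr[OF assms(1), of "1 / real m"] show ?thesis by simp
qed

text \<open>Along \<open>s = (t - \<psi> x)\<^sup>1\<^sup>/\<^sup>m\<close> the derivative of \<open>s\<close> in \<open>t\<close> is \<open>s / (m (t - \<psi> x))\<close>.\<close>

lemma chain_t:
  fixes x :: "real ^ 'n"
  assumes m: "m \<ge> 1" and t: "t > \<psi> x" and G: "analytic_at G ((t - \<psi> x) powr (1 / real m), x)"
  shows "((\<lambda>\<tau>. G ((\<tau> - \<psi> x) powr (1 / real m), x)) has_real_derivative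
    dir_deriv tdir G ((t - \<psi> x) powr (1 / real m), x) * ((t - \<psi> x) powr (1 / real m) / (real m * (t - \<psi> x)))) (at t)"
proof -
  let ?s = "(t - \<psi> x) powr (1 / real m) / (real m * (t - \<psi> x))"
  have "((\<lambda>\<tau>. (\<tau> - \<psi> x) powr (1 / real m)) has_real_derivative ?s * 1) (at t)"
    by (rule DERIV_chain2[OF powr_root_DERIV]) (use t m in \<open>auto intro!: derivative_eq_intros\<close>)
  then have "((\<lambda>\<tau>. ((\<tau> - \<psi> x) powr (1 / real m), x)) has_vector_derivative (?s, 0)) (at t)"
    by (intro has_vector_derivative_Pair) (auto simp: has_real_derivative_iff_has_vector_derivative)
  from analytic_at_chain[OF G this] show ?thesis
    by (simp add: sum_Basis_tx)
qed

lemma chain_x: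
  fixes x :: "real ^ 'n"
  assumes m: "m \<ge> 1" and t: "t > \<psi> x" and \<psi>: "analytic_at \<psi> x"
    and G: "analytic_at G ((t - \<psi> x) powr (1 / real m), x)"
  shows "partial i (\<lambda>y. G ((t - \<psi> y) powr (1 / real m), y)) x =
    dir_deriv (xdir i) G ((t - \<psi> x) powr (1 / real m), x)
    - dir_deriv tdir G ((t - \<psi> x) powr (1 / real m), x) * (partial i \<psi> x *
        ((t - \<psi> x) powr (1 / real m) / (real m * (t - \<psi> x))))"
proof -
  let ?s = "(t - \<psi> x) powr (1 / real m) / (real m * (t - \<psi> x))"
  let ?p = "partial i \<psi> x"
  have "((\<lambda>h. \<psi> (x + h *\<^sub>R axis i 1)) has_real_derivative ?p) (at 0)"
    unfolding partial_eq_dir_deriv by (rule analytic_at_DERIV[OF \<psi>]) (simp add: axis_in_Basis_iff)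
  then have "((\<lambda>h. t - \<psi> (x + h *\<^sub>R axis i 1)) has_real_derivative - ?p) (at 0)"
    by (auto intro!: derivative_eq_intros)
  then have "((\<lambda>h. (t - \<psi> (x + h *\<^sub>R axis i 1)) powr (1 / real m)) has_real_derivative ?s * - ?p) (at 0)"
    by (rule DERIV_chain2[rotated]) (use powr_root_DERIV[of "t - \<psi> x" m] t m in simp)
  then have s: "((\<lambda>h. (t - \<psi> (x + h *\<^sub>R axis i 1)) powr (1 / real m)) has_vector_derivative ?s * - ?p) (at 0)"
    by (simp add: has_real_derivative_iff_has_vector_derivative)
  have "((\<lambda>h. x + h *\<^sub>R axis i 1) has_vector_derivative axis i 1) (at 0)"
    by (auto intro!: derivative_eq_intros)
  from has_vector_derivative_Pair[OF s this]
  have \<gamma>: "((\<lambda>h. ((t - \<psi> (x + h *\<^sub>R axis i 1)) powr (1 / real m), x + h *\<^sub>R axis i 1))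
      has_vector_derivative (?s * - ?p, axis i 1)) (at 0)" .
  have "(\<Sum>j\<in>UNIV. dir_deriv (xdir j) G z * (axis i 1 \<bullet> axis j (1::real))) = dir_deriv (xdir i) G z" for z
    by (simp add: inner_axis_axis if_distrib cong: if_cong)
  with analytic_at_chain[of G, OF _ \<gamma>] G show ?thesis
    unfolding partial_def by (intro DERIV_imp_deriv) (simp add: sum_Basis_tx mult.commute mult.left_commute)
qed

section \<open>From the profile to the solution\<close>

lemma analytic_at_fst: "analytic_at (\<lambda>z :: real \<times> (real ^ 'n). fst z) p"
  using analytic_at_coord[of "tdir :: real \<times> (real ^ 'n)" p] by (simp add: Basis_tx inner_prod_def)

lemma analytic_at_comp_snd:
  fixes z :: "real \<times> (real ^ 'n)"
  assumes "analytic_at g (snd z)"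
  shows "analytic_at (\<lambda>z. g (snd z)) z"
proof (rule analytic_at_compose[where H = snd and g = g and q = z, OF assms])
  fix b :: "real ^ 'n" assume "b \<in> Basis"
  then have "(0, b) \<in> (Basis :: (real \<times> (real ^ 'n)) set)" by (simp add: Basis_prod_def)
  from analytic_at_coord[OF this, of z] show "analytic_at (\<lambda>z. snd z \<bullet> b) z"
    by (simp add: inner_prod_def)
qed

lemma analytic_at_partial: "analytic_at g x \<Longrightarrow> analytic_at (partial i g) x"
  unfolding partial_eq_dir_deriv by (rule analytic_at_dir_deriv) (simp_all add: axis_in_Basis_iff)

lemma add_zero_pair [simp]: "z + (0 :: real, 0 :: real ^ 'n) = z"
  by (simp add: prod_eq_iff)

lemma xdir_Basis [simp]: "xdir i \<in> Basis" and tdir_Basis [simp]: "tdir \<in> Basis"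
  by (simp_all add: Basis_tx)

text \<open>Derivatives of \<open>u(t, x) = s\<^sup>m\<^sup>-\<^sup>1 (a + Y(s, x))\<close> for an arbitrary analytic \<open>Y\<close>. Each function of \<open>(t, x)\<close> that occurs is a function of
\<open>(s, x)\<close> composed with \<open>(t, x) \<mapsto> (s, x)\<close>: \<open>u\<close> comes from \<open>F\<close> and its time derivative from \<open>P\<close>, while \<open>\<kappa>\<close> is the time derivative
of \<open>s = S t x\<close>.\<close>

locale profile =
  fixes m :: nat and a :: real and \<psi> :: "real ^ 'n \<Rightarrow> real" and D :: "(real ^ 'n) set"
    and W :: "(real \<times> (real ^ 'n)) set" and Y :: "real \<times> (real ^ 'n) \<Rightarrow> real"
  assumes m: "2 \<le> m" and D: "open D" and psi_an: "\<And>x. x \<in> D \<Longrightarrow> analytic_at \<psi> x"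
    and W: "open W" and Y_an: "\<And>z. z \<in> W \<Longrightarrow> analytic_at Y z"
begin

definition "g0 = a * ((real m - 1) / real m)"
definition "S t x = (t - \<psi> x) powr (1 / real m)"
definition "F z = fst z ^ (m - 1) * (a + Y z)"
definition "u = (\<lambda>(t, x). F (S t x, x))"
definition "G z = ((real m - 1) * Y z + fst z * dir_deriv tdir Y z) / real m"
text \<open>The power \<open>- 1\<close> is a reciprocal for positive arguments, and real powers preserve analyticity.\<close>

definition "P z = (g0 + G z) * fst z powr (- 1)"
definition "\<kappa> t x = S t x / (real m * (t - \<psi> x))"
definition "T = {(t, x). x \<in> D \<and> \<psi> x < t \<and> (S t x, x) \<in> W}"

lemma S_pos: "\<psi> x < t \<Longrightarrow> S t x > 0"
  by (simp add: S_def)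

lemma S_power: "\<psi> x < t \<Longrightarrow> S t x ^ m = t - \<psi> x"
  using m by (simp add: S_def powr_realpow[symmetric] powr_powr)

lemma psi_cont: "continuous_on {z. snd z \<in> D} (\<lambda>z. \<psi> (snd z))"
proof -
  have "continuous_on D \<psi>"
    using analytic_at_isCont[OF psi_an] by (intro continuous_at_imp_continuous_on) auto
  then show ?thesis by (rule continuous_on_compose2[OF _ continuous_on_snd[OF continuous_on_id]]) auto
qed

lemma open_snd_D: "open {z :: real \<times> (real ^ 'n). snd z \<in> D}"
proof -
  have "{z :: real \<times> (real ^ 'n). snd z \<in> D} = UNIV \<times> D" by auto
  then show ?thesis using open_Times[OF open_UNIV D] by simp
qed

lemma open_T: "open T"
proof -
  let ?V = "{z :: real \<times> (real ^ 'n). snd z \<in> D}"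
  let ?V1 = "?V \<inter> (\<lambda>z. fst z - \<psi> (snd z)) -` {0<..}"
  have V1: "open ?V1"
    by (intro continuous_open_preimage open_snd_D continuous_intros psi_cont)
  have c: "continuous_on ?V1 (\<lambda>z. ((fst z - \<psi> (snd z)) powr (1 / real m), snd z))"
    by (intro continuous_intros continuous_on_subset[OF psi_cont]) auto
  have "open (?V1 \<inter> (\<lambda>z. ((fst z - \<psi> (snd z)) powr (1 / real m), snd z)) -` W)"
    by (rule continuous_open_preimage[OF c V1 W])
  also have "?V1 \<inter> (\<lambda>z. ((fst z - \<psi> (snd z)) powr (1 / real m), snd z)) -` W = T"
    by (auto simp: T_def S_def)
  finally show ?thesis .
qed

lemma eventually_T:
  assumes "(t, x) \<in> T"
  shows "\<forall>\<^sub>F \<tau> in nhds t. (\<tau>, x) \<in> T" "\<forall>\<^sub>F y in nhds x. (t, y) \<in> T"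
proof -
  have "((\<lambda>\<tau>. (\<tau>, x)) \<longlongrightarrow> (t, x)) (nhds t)" "((\<lambda>y. (t, y)) \<longlongrightarrow> (t, x)) (nhds x)"
    by (intro tendsto_intros filterlim_ident)+
  from topological_tendstoD[OF this(1) open_T assms] topological_tendstoD[OF this(2) open_T assms]
  show "\<forall>\<^sub>F \<tau> in nhds t. (\<tau>, x) \<in> T" "\<forall>\<^sub>F y in nhds x. (t, y) \<in> T" by auto
qed

lemma F_an: "z \<in> W \<Longrightarrow> analytic_at F z"
  unfolding F_def[abs_def]
  by (intro analytic_at_mult analytic_at_power analytic_at_fst analytic_at_add analytic_at_const Y_an)

lemma G_an: "z \<in> W \<Longrightarrow> analytic_at G z"
proof -
  assume z: "z \<in> W"
  have "analytic_at (\<lambda>z. ((real m - 1) * Y z + fst z * dir_deriv tdir Y z) * (1 / real m)) z"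
    by (intro analytic_at_mult analytic_at_fst analytic_at_add analytic_at_const Y_an analytic_at_dir_deriv z) simp
  then show ?thesis by (simp add: G_def[abs_def])
qed

lemma P_an: "z \<in> W \<Longrightarrow> fst z > 0 \<Longrightarrow> analytic_at P z"
  unfolding P_def[abs_def]
  by (intro analytic_at_mult analytic_at_add analytic_at_const G_an analytic_at_powr analytic_at_fst)

lemma P_eq: "fst z > 0 \<Longrightarrow> P z = (g0 + G z) / fst z"
  by (simp add: P_def powr_minus divide_inverse)

lemma eventually_W: "z \<in> W \<Longrightarrow> \<forall>\<^sub>F z' in nhds z. z' \<in> W"
  using eventually_nhds_in_open[OF W] by blast

lemma eventually_fst_pos: "fst z > 0 \<Longrightarrow> \<forall>\<^sub>F z' :: real \<times> (real ^ 'n) in nhds z. fst z' > 0"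
  using order_tendstoD(1)[OF tendsto_fst[OF filterlim_ident], of 0 z] .

lemma dir_deriv_t_F:
  assumes z: "z \<in> W" "fst z > 0"
  shows "dir_deriv tdir F z = real m * fst z ^ (m - 1) * P z"
proof -
  obtain k where k: "m = Suc (Suc k)" using m by (metis add_2_eq_Suc le_Suc_ex)
  have "((\<lambda>h. (fst z + h) ^ n) has_real_derivative real n * fst z ^ (n - 1)) (at 0)" for n
    by (auto intro!: derivative_eq_intros)
  from DERIV_mult[OF this[of "m - 1"] DERIV_add[OF DERIV_const[of a] analytic_at_DERIV[OF Y_an[OF z(1)], of tdir]]]
  have "((\<lambda>h. (fst z + h) ^ (m - 1) * (a + Y (z + h *\<^sub>R tdir))) has_real_derivative
      real (m - 1) * fst z ^ k * (a + Y z) + fst z ^ (m - 1) * dir_deriv tdir Y z) (at 0)"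
    by (simp add: k algebra_simps)
  then have "dir_deriv tdir F z = real (m - 1) * fst z ^ k * (a + Y z) + fst z ^ (m - 1) * dir_deriv tdir Y z"
    by (intro dir_deriv_eqI) (simp add: F_def)
  also have "\<dots> = fst z ^ k * ((real m - 1) * (a + Y z) + fst z * dir_deriv tdir Y z)"
    by (simp add: k algebra_simps)
  also have "(real m - 1) * (a + Y z) + fst z * dir_deriv tdir Y z = real m * (g0 + G z)"
    using m by (simp add: g0_def G_def field_simps)
  finally have "dir_deriv tdir F z = fst z ^ k * (real m * (g0 + G z))" .
  moreover have "fst z ^ (m - 1) = fst z * fst z ^ k" using k by simp
  ultimately show ?thesis unfolding P_eq[OF z(2)] using z(2) by simp
qed

lemma dir_deriv_x_F:
  assumes z: "z \<in> W"
  shows "dir_deriv (xdir i) F z = fst z ^ (m - 1) * dir_deriv (xdir i) Y z"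
    and "dir_deriv (xdir i) (dir_deriv (xdir i) F) z = fst z ^ (m - 1) * dir_deriv (xdir i) (dir_deriv (xdir i) Y) z"
proof -
  have 1: "dir_deriv (xdir i) F z = fst z ^ (m - 1) * dir_deriv (xdir i) Y z" if "z \<in> W" for z
  proof (rule dir_deriv_eqI)
    show "((\<lambda>h. F (z + h *\<^sub>R xdir i)) has_real_derivative fst z ^ (m - 1) * dir_deriv (xdir i) Y z) (at 0)"
      using analytic_at_DERIV[OF Y_an[OF that], of "xdir i"]
      by (auto simp: F_def intro!: derivative_eq_intros)
  qed
  show "dir_deriv (xdir i) F z = fst z ^ (m - 1) * dir_deriv (xdir i) Y z" by (rule 1[OF z])
  have "\<forall>\<^sub>F z' in nhds z. dir_deriv (xdir i) F z' = fst z' ^ (m - 1) * dir_deriv (xdir i) Y z'"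
    using eventually_W[OF z] by eventually_elim (rule 1)
  from eventually_nhds_x_imp_x[OF dir_deriv_eventually_eq[OF this, of "xdir i"]]
  have "dir_deriv (xdir i) (dir_deriv (xdir i) F) z = dir_deriv (xdir i) (\<lambda>z'. fst z' ^ (m - 1) * dir_deriv (xdir i) Y z') z" .
  also have "\<dots> = fst z ^ (m - 1) * dir_deriv (xdir i) (dir_deriv (xdir i) Y) z"
  proof (rule dir_deriv_eqI)
    show "((\<lambda>h. fst (z + h *\<^sub>R xdir i) ^ (m - 1) * dir_deriv (xdir i) Y (z + h *\<^sub>R xdir i))
        has_real_derivative fst z ^ (m - 1) * dir_deriv (xdir i) (dir_deriv (xdir i) Y) z) (at 0)"
      using analytic_at_DERIV[OF analytic_at_dir_deriv[OF Y_an[OF z], of "xdir i"], of "xdir i"]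
      by (auto intro!: derivative_eq_intros)
  qed
  finally show "dir_deriv (xdir i) (dir_deriv (xdir i) F) z = fst z ^ (m - 1) * dir_deriv (xdir i) (dir_deriv (xdir i) Y) z" .
qed

lemma dir_deriv_P:
  assumes z: "z \<in> W" "fst z > 0"
  shows "dir_deriv (xdir i) P z = dir_deriv (xdir i) G z / fst z"
    and "dir_deriv tdir P z = dir_deriv tdir G z / fst z - (g0 + G z) / fst z ^ 2"
    and "dir_deriv tdir (dir_deriv (xdir i) F) z = real m * fst z ^ (m - 1) * dir_deriv (xdir i) P z"
proof -
  have ev: "\<forall>\<^sub>F z' in nhds z. P z' = (g0 + G z') / fst z'"
    using eventually_fst_pos[OF z(2)] by eventually_elim (rule P_eq)
  have "dir_deriv (xdir i) (\<lambda>z. (g0 + G z) / fst z) z = dir_deriv (xdir i) G z / fst z"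
  proof (rule dir_deriv_eqI)
    show "((\<lambda>h. (g0 + G (z + h *\<^sub>R xdir i)) / fst (z + h *\<^sub>R xdir i)) has_real_derivative
        dir_deriv (xdir i) G z / fst z) (at 0)"
      using analytic_at_DERIV[OF G_an[OF z(1)], of "xdir i"] z(2)
      by (auto intro!: derivative_eq_intros)
  qed
  then show "dir_deriv (xdir i) P z = dir_deriv (xdir i) G z / fst z"
    using eventually_nhds_x_imp_x[OF dir_deriv_eventually_eq[OF ev, of "xdir i"]] by simp
  have "dir_deriv tdir (\<lambda>z. (g0 + G z) / fst z) z = dir_deriv tdir G z / fst z - (g0 + G z) / fst z ^ 2"
  proof (rule dir_deriv_eqI)
    show "((\<lambda>h. (g0 + G (z + h *\<^sub>R tdir)) / fst (z + h *\<^sub>R tdir)) has_real_derivative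
        dir_deriv tdir G z / fst z - (g0 + G z) / fst z ^ 2) (at 0)"
      using analytic_at_DERIV[OF G_an[OF z(1)], of tdir] z(2)
      by (auto intro!: derivative_eq_intros simp: field_simps power2_eq_square)
  qed
  then show "dir_deriv tdir P z = dir_deriv tdir G z / fst z - (g0 + G z) / fst z ^ 2"
    using eventually_nhds_x_imp_x[OF dir_deriv_eventually_eq[OF ev, of tdir]] by simp
  have "\<forall>\<^sub>F z' in nhds z. dir_deriv tdir F z' = real m * fst z' ^ (m - 1) * P z'"
    using eventually_W[OF z(1)] eventually_fst_pos[OF z(2)] by eventually_elim (rule dir_deriv_t_F)
  from eventually_nhds_x_imp_x[OF dir_deriv_eventually_eq[OF this, of "xdir i"]]
  have "dir_deriv (xdir i) (dir_deriv tdir F) z = dir_deriv (xdir i) (\<lambda>z'. real m * fst z' ^ (m - 1) * P z') z" .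
  also have "\<dots> = real m * fst z ^ (m - 1) * dir_deriv (xdir i) P z"
  proof (rule dir_deriv_eqI)
    show "((\<lambda>h. real m * fst (z + h *\<^sub>R xdir i) ^ (m - 1) * P (z + h *\<^sub>R xdir i))
        has_real_derivative real m * fst z ^ (m - 1) * dir_deriv (xdir i) P z) (at 0)"
      using analytic_at_DERIV[OF P_an[OF z], of "xdir i"]
      by (auto intro!: derivative_eq_intros)
  qed
  finally show "dir_deriv tdir (dir_deriv (xdir i) F) z = real m * fst z ^ (m - 1) * dir_deriv (xdir i) P z"
    using dir_deriv_commute[OF F_an[OF z(1)], of tdir "xdir i"] by simp
qed

lemma \<kappa>_eq: "\<psi> x < t \<Longrightarrow> real m * S t x ^ (m - 1) * \<kappa> t x = 1"
proof -
  assume t: "\<psi> x < t"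
  have "S t x ^ (m - 1) * S t x = t - \<psi> x"
    using S_power[OF t] m by (metis One_nat_def Suc_leD Suc_1 le_add_diff_inverse2 power_Suc2 Suc_diff_le diff_Suc_1 power_minus_mult zero_less_Suc less_le_trans)
  then show ?thesis using m t by (simp add: \<kappa>_def)
qed

lemma u_t:
  assumes "(t, x) \<in> T"
  shows "deriv (\<lambda>\<tau>. u (\<tau>, x)) t = P (S t x, x)"
proof -
  have z: "(S t x, x) \<in> W" "x \<in> D" and t: "\<psi> x < t" using assms by (auto simp: T_def)
  have "deriv (\<lambda>\<tau>. F ((\<tau> - \<psi> x) powr (1 / real m), x)) t = dir_deriv tdir F (S t x, x) * \<kappa> t x"
    unfolding S_def \<kappa>_def
    by (rule DERIV_imp_deriv, rule chain_t) (use m t F_an[OF z(1)] in \<open>auto simp: S_def\<close>)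
  also have "\<dots> = P (S t x, x) * (real m * S t x ^ (m - 1) * \<kappa> t x)"
    using dir_deriv_t_F[OF z(1)] S_pos[OF t] by simp
  finally show ?thesis unfolding \<kappa>_eq[OF t] by (simp add: u_def S_def)
qed

lemma u_tt:
  assumes "(t, x) \<in> T"
  shows "(deriv ^^ 2) (\<lambda>\<tau>. u (\<tau>, x)) t = dir_deriv tdir P (S t x, x) * \<kappa> t x"
proof -
  have z: "(S t x, x) \<in> W" "x \<in> D" and t: "\<psi> x < t" using assms by (auto simp: T_def)
  have "\<forall>\<^sub>F \<tau> in nhds t. deriv (\<lambda>\<tau>. u (\<tau>, x)) \<tau> = P (S \<tau> x, x)"
    using eventually_T(1)[OF assms] by eventually_elim (rule u_t)
  then have "deriv (deriv (\<lambda>\<tau>. u (\<tau>, x))) t = deriv (\<lambda>\<tau>. P (S \<tau> x, x)) t"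
    by (intro deriv_cong_ev) auto
  also have "\<dots> = dir_deriv tdir P (S t x, x) * \<kappa> t x"
    unfolding S_def \<kappa>_def
    by (rule DERIV_imp_deriv, rule chain_t) (use m t P_an[OF z(1)] S_pos[OF t] in \<open>auto simp: S_def\<close>)
  finally show ?thesis by (simp add: numeral_2_eq_2)
qed

lemma u_x:
  assumes "(t, x) \<in> T"
  shows "partial i (\<lambda>y. u (t, y)) x = dir_deriv (xdir i) F (S t x, x) - partial i \<psi> x * P (S t x, x)"
proof -
  have z: "(S t x, x) \<in> W" "x \<in> D" and t: "\<psi> x < t" using assms by (auto simp: T_def)
  have "partial i (\<lambda>y. F ((t - \<psi> y) powr (1 / real m), y)) x
      = dir_deriv (xdir i) F (S t x, x) - dir_deriv tdir F (S t x, x) * (partial i \<psi> x * \<kappa> t x)"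
    unfolding S_def \<kappa>_def
    by (rule chain_x) (use m t F_an[OF z(1)] psi_an[OF z(2)] in \<open>auto simp: S_def\<close>)
  also have "dir_deriv tdir F (S t x, x) * (partial i \<psi> x * \<kappa> t x)
      = partial i \<psi> x * P (S t x, x) * (real m * S t x ^ (m - 1) * \<kappa> t x)"
    using dir_deriv_t_F[OF z(1)] S_pos[OF t] by simp
  finally show ?thesis unfolding \<kappa>_eq[OF t] by (simp add: u_def S_def)
qed

text \<open>The mixed derivative of \<open>F\<close> is evaluated as the space derivative of \<open>\<partial>\<^sub>s F = m s\<^sup>m\<^sup>-\<^sup>1 P\<close>; this produces the second of the two
equal terms that form the factor \<open>2\<close>.\<close>

lemma u_xx:
  assumes "(t, x) \<in> T"
  shows "partial i (partial i (\<lambda>y. u (t, y))) x =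
    dir_deriv (xdir i) (dir_deriv (xdir i) F) (S t x, x) - partial i (partial i \<psi>) x * P (S t x, x)
    - 2 * partial i \<psi> x * dir_deriv (xdir i) P (S t x, x) + (partial i \<psi> x)\<^sup>2 * (dir_deriv tdir P (S t x, x) * \<kappa> t x)"
proof -
  have z: "(S t x, x) \<in> W" "x \<in> D" and t: "\<psi> x < t" using assms by (auto simp: T_def)
  note s = S_pos[OF t]
  define Q where "Q z = dir_deriv (xdir i) F z - partial i \<psi> (snd z) * P z" for z
  have P: "analytic_at P (S t x, x)" using P_an[OF z(1)] s by simp
  have \<psi>': "analytic_at (partial i \<psi>) x" by (rule analytic_at_partial[OF psi_an[OF z(2)]])
  have Q: "analytic_at Q (S t x, x)"
    unfolding Q_def[abs_def]
    by (intro analytic_at_diff analytic_at_mult analytic_at_dir_deriv F_an z analytic_at_comp_snd P) (use \<psi>' in simp_all)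
  have "\<forall>\<^sub>F y in nhds x. partial i (\<lambda>y. u (t, y)) y = Q (S t y, y)"
    using eventually_T(2)[OF assms] by eventually_elim (simp add: u_x Q_def)
  from eventually_nhds_x_imp_x[OF dir_deriv_eventually_eq[OF this, of "axis i 1"]]
  have "partial i (partial i (\<lambda>y. u (t, y))) x = partial i (\<lambda>y. Q (S t y, y)) x"
    by (simp add: partial_eq_dir_deriv)
  also have "\<dots> = dir_deriv (xdir i) Q (S t x, x) - dir_deriv tdir Q (S t x, x) * (partial i \<psi> x * \<kappa> t x)"
    unfolding S_def \<kappa>_def
    by (rule chain_x) (use m t Q psi_an[OF z(2)] in \<open>auto simp: S_def\<close>)
  also have "dir_deriv (xdir i) Q (S t x, x) = dir_deriv (xdir i) (dir_deriv (xdir i) F) (S t x, x)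
      - (partial i (partial i \<psi>) x * P (S t x, x) + partial i \<psi> x * dir_deriv (xdir i) P (S t x, x))"
  proof (rule dir_deriv_eqI)
    have "((\<lambda>h. partial i \<psi> (x + h *\<^sub>R axis i 1)) has_real_derivative partial i (partial i \<psi>) x) (at 0)"
      using analytic_at_DERIV[OF \<psi>', of "axis i 1"] by (simp add: partial_eq_dir_deriv[of i "partial i \<psi>"] axis_in_Basis_iff)
    then show "((\<lambda>h. Q ((S t x, x) + h *\<^sub>R xdir i)) has_real_derivative dir_deriv (xdir i) (dir_deriv (xdir i) F) (S t x, x)
      - (partial i (partial i \<psi>) x * P (S t x, x) + partial i \<psi> x * dir_deriv (xdir i) P (S t x, x))) (at 0)"
      using analytic_at_DERIV[OF analytic_at_dir_deriv[OF F_an[OF z(1)], of "xdir i"], of "xdir i"]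
        analytic_at_DERIV[OF P, of "xdir i"]
      unfolding Q_def by (auto intro!: derivative_eq_intros)
  qed
  also have "dir_deriv tdir Q (S t x, x) = dir_deriv tdir (dir_deriv (xdir i) F) (S t x, x) - partial i \<psi> x * dir_deriv tdir P (S t x, x)"
  proof (rule dir_deriv_eqI)
    show "((\<lambda>h. Q ((S t x, x) + h *\<^sub>R tdir)) has_real_derivative
        dir_deriv tdir (dir_deriv (xdir i) F) (S t x, x) - partial i \<psi> x * dir_deriv tdir P (S t x, x)) (at 0)"
      using analytic_at_DERIV[OF analytic_at_dir_deriv[OF F_an[OF z(1)], of "xdir i"], of tdir]
        analytic_at_DERIV[OF P, of tdir]
      unfolding Q_def by (auto intro!: derivative_eq_intros)
  qed
  also have "dir_deriv tdir (dir_deriv (xdir i) F) (S t x, x) = real m * S t x ^ (m - 1) * dir_deriv (xdir i) P (S t x, x)"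
    using dir_deriv_P(3)[OF z(1)] s by simp
  also have "(real m * S t x ^ (m - 1) * dir_deriv (xdir i) P (S t x, x) - partial i \<psi> x * dir_deriv tdir P (S t x, x)) *
      (partial i \<psi> x * \<kappa> t x) = partial i \<psi> x * dir_deriv (xdir i) P (S t x, x) * (real m * S t x ^ (m - 1) * \<kappa> t x)
      - (partial i \<psi> x)\<^sup>2 * (dir_deriv tdir P (S t x, x) * \<kappa> t x)"
    by (simp add: algebra_simps power2_eq_square)
  finally show ?thesis unfolding \<kappa>_eq[OF t] by simp
qed

text \<open>The second time derivative appears with the factor \<open>1\<close> in \<open>u\<^sub>t\<^sub>t\<close> and with \<open>|\<nabla>\<psi>|\<^sup>2\<close> in the Laplacian, which gives the
coefficient \<open>1 - |\<nabla>\<psi>|\<^sup>2\<close>.\<close>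

lemma wave_operator:
  assumes "(t, x) \<in> T"
  shows "S t x ^ (m + 1) * ((deriv ^^ 2) (\<lambda>\<tau>. u (\<tau>, x)) t - laplacian (\<lambda>y. u (t, y)) x)
    = (1 - (norm (grad \<psi> x))\<^sup>2) / real m * (S t x * dir_deriv tdir G (S t x, x) - G (S t x, x) - g0)
      + S t x ^ m * laplacian \<psi> x * (g0 + G (S t x, x))
      + 2 * (\<Sum>i\<in>UNIV. partial i \<psi> x * (S t x ^ m * dir_deriv (xdir i) G (S t x, x)))
      - (\<Sum>i\<in>UNIV. S t x ^ (2 * m) * dir_deriv (xdir i) (dir_deriv (xdir i) Y) (S t x, x))"
proof -
  have z: "(S t x, x) \<in> W" "x \<in> D" and t: "\<psi> x < t" using assms by (auto simp: T_def)
  define s where "s = S t x"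
  have s: "s > 0" using S_pos[OF t] by (simp add: s_def)
  define Pt where "Pt = dir_deriv tdir P (s, x) * \<kappa> t x"
  have Pt: "s ^ (m + 1) * Pt = (s * dir_deriv tdir G (s, x) - G (s, x) - g0) / real m"
  proof -
    have "s ^ (m + 1) = s ^ (m - 1) * s ^ 2" using m by (simp flip: power_add)
    then have "s ^ (m + 1) * \<kappa> t x = (real m * s ^ (m - 1) * \<kappa> t x) * s ^ 2 / real m"
      using m by simp
    also have "\<dots> = s ^ 2 / real m" unfolding s_def \<kappa>_eq[OF t] by simp
    finally have "s ^ (m + 1) * \<kappa> t x * dir_deriv tdir P (s, x) = s ^ 2 / real m * dir_deriv tdir P (s, x)" by simp
    then have "s ^ (m + 1) * Pt = s ^ 2 / real m * dir_deriv tdir P (s, x)"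
      unfolding Pt_def by (simp only: mult.assoc mult.commute[of "\<kappa> t x"])
    also have "dir_deriv tdir P (s, x) = dir_deriv tdir G (s, x) / s - (g0 + G (s, x)) / s ^ 2"
      using dir_deriv_P(2)[OF z(1)] s by (simp add: s_def)
    also have "s ^ 2 / real m * (dir_deriv tdir G (s, x) / s - (g0 + G (s, x)) / s ^ 2)
        = (s * dir_deriv tdir G (s, x) - G (s, x) - g0) / real m"
      using s m by (simp add: field_simps power2_eq_square)
    finally show ?thesis .
  qed
  have nrm: "(norm (grad \<psi> x))\<^sup>2 = (\<Sum>i\<in>UNIV. (partial i \<psi> x)\<^sup>2)"
    unfolding power2_norm_eq_inner by (simp add: inner_vec_def grad_def power2_eq_square)
  have xx: "s ^ (m + 1) * partial i (partial i (\<lambda>y. u (t, y))) x =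
      s ^ (2 * m) * dir_deriv (xdir i) (dir_deriv (xdir i) Y) (s, x) - s ^ m * (partial i (partial i \<psi>) x * (g0 + G (s, x)))
      - 2 * (partial i \<psi> x * (s ^ m * dir_deriv (xdir i) G (s, x))) + (partial i \<psi> x)\<^sup>2 * (s ^ (m + 1) * Pt)" for i
  proof -
    have "(m + 1) + (m - 1) = 2 * m" using m by simp
    then have e1: "s ^ (m + 1) * s ^ (m - 1) = s ^ (2 * m)" by (metis power_add)
    have e2: "s ^ (m + 1) * P (s, x) = s ^ m * (g0 + G (s, x))"
      using P_eq[of "(s, x)"] s by simp
    have e3: "s ^ (m + 1) * dir_deriv (xdir i) P (s, x) = s ^ m * dir_deriv (xdir i) G (s, x)"
      using dir_deriv_P(1)[OF z(1)] s by (simp add: s_def[symmetric])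
    have "s ^ (m + 1) * partial i (partial i (\<lambda>y. u (t, y))) x =
        (s ^ (m + 1) * s ^ (m - 1)) * dir_deriv (xdir i) (dir_deriv (xdir i) Y) (s, x)
        - partial i (partial i \<psi>) x * (s ^ (m + 1) * P (s, x))
        - 2 * (partial i \<psi> x * (s ^ (m + 1) * dir_deriv (xdir i) P (s, x)))
        + (partial i \<psi> x)\<^sup>2 * (s ^ (m + 1) * Pt)"
      unfolding u_xx[OF assms] dir_deriv_x_F(2)[OF z(1)] fst_conv
      unfolding s_def[symmetric] Pt_def[symmetric]
      by (simp add: algebra_simps)
    then show ?thesis unfolding e1 e2 e3 by (simp only: mult.left_commute)
  qed
  have "s ^ (m + 1) * laplacian (\<lambda>y. u (t, y)) x
      = (\<Sum>i\<in>UNIV. s ^ (2 * m) * dir_deriv (xdir i) (dir_deriv (xdir i) Y) (s, x))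
        - s ^ m * (laplacian \<psi> x * (g0 + G (s, x)))
        - 2 * (\<Sum>i\<in>UNIV. partial i \<psi> x * (s ^ m * dir_deriv (xdir i) G (s, x)))
        + (norm (grad \<psi> x))\<^sup>2 * (s ^ (m + 1) * Pt)"
    unfolding laplacian_def sum_distrib_left[of "s ^ (m + 1)"] xx nrm
    by (simp add: sum.distrib sum_subtractf sum_distrib_left sum_distrib_right mult.assoc)
  note lap = this[unfolded Pt]
  define X where "X = s * dir_deriv tdir G (s, x) - G (s, x) - g0"
  have "(1 - (norm (grad \<psi> x))\<^sup>2) / real m * X = X / real m - (norm (grad \<psi> x))\<^sup>2 * (X / real m)"
    by (simp add: diff_divide_distrib left_diff_distrib)
  then show ?thesis
    unfolding u_tt[OF assms] s_def[symmetric] Pt_def[symmetric] right_diff_distrib[of "s ^ (m + 1)"] Pt lap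
      X_def[symmetric] by simp
qed

end

section \<open>The solution that blows up\<close>

lemma hom_part_mindex:
  fixes c :: "('a::euclidean_space \<Rightarrow> nat) \<Rightarrow> 'b \<Rightarrow> real"
  shows "hom_part c l p \<zeta> = (\<Sum>\<alpha> | deg \<alpha> = l. c (expo \<alpha>) p * mpow (\<lambda>b. \<zeta> \<bullet> b) \<alpha>)"
proof -
  have "bij_betw expo {\<alpha> :: 'a mindex. deg \<alpha> = l} {\<alpha> \<in> multi_indices. mi_order \<alpha> = l}"
  proof (rule bij_betwI')
    fix y :: "'a \<Rightarrow> nat" assume "y \<in> {\<alpha> \<in> multi_indices. mi_order \<alpha> = l}"
    then show "\<exists>x\<in>{\<alpha>. deg \<alpha> = l}. y = expo x"
      by (intro bexI[of _ "Mindex y"]) (auto simp: Mindex_inverse deg_def mi_order_def)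
  qed (auto simp: expo_inject expo deg_def mi_order_def)
  from sum.reindex_bij_betw[OF this, of "\<lambda>\<alpha>. c \<alpha> p * mi_power \<zeta> \<alpha>"] show ?thesis
    by (simp add: hom_part_def mi_power_expo)
qed

lemma sum_hom_part:
  fixes c :: "('a::euclidean_space \<Rightarrow> nat) \<Rightarrow> 'b \<Rightarrow> real"
  shows "(\<Sum>l\<le>n. hom_part c l p \<zeta>) = (\<Sum>\<alpha> | deg \<alpha> \<le> n. c (expo \<alpha>) p * mpow (\<lambda>b. \<zeta> \<bullet> b) \<alpha>)"
proof -
  have "(\<Sum>l\<in>{..n}. \<Sum>\<alpha> | \<alpha> \<in> {\<alpha>. deg \<alpha> \<le> n} \<and> deg \<alpha> = l. c (expo \<alpha>) p * mpow (\<lambda>b. \<zeta> \<bullet> b) \<alpha>)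
      = (\<Sum>\<alpha> | deg \<alpha> \<le> n. c (expo \<alpha>) p * mpow (\<lambda>b. \<zeta> \<bullet> b) \<alpha>)"
    by (rule sum.group) (auto simp: finite_deg_le)
  moreover have "{\<alpha> \<in> {\<alpha> :: 'a mindex. deg \<alpha> \<le> n}. deg \<alpha> = l} = {\<alpha>. deg \<alpha> = l}" if "l \<le> n" for l
    using that by auto
  ultimately show ?thesis by (simp add: hom_part_mindex)
qed

text \<open>The polynomial of the equation is evaluated at \<open>(1, - \<nabla>\<psi>)\<close>, the negative of the vector in the hypothesis on its top degree part;
the sign \<open>(-1)\<^sup>m\<^sup>+\<^sup>1\<close> combines with \<open>(1 - m)\<^sup>m\<close> to the power of \<open>m - 1\<close> in \<open>g0\<^sup>m\<close>.\<close>

lemma equation_is_fuchsian: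
  fixes c :: "(real \<times> (real ^ 'n) \<Rightarrow> nat) \<Rightarrow> real \<times> (real ^ 'n) \<Rightarrow> real" and \<psi> :: "real ^ 'n \<Rightarrow> real"
  assumes m: "m \<ge> 2" and U: "open U" and D: "open D"
    and c: "\<And>\<alpha> p. deg \<alpha> \<le> m + 1 \<Longrightarrow> p \<in> U \<Longrightarrow> analytic_at (c (expo \<alpha>)) p"
    and \<psi>: "\<And>x. x \<in> D \<Longrightarrow> analytic_at \<psi> x" and a: "a \<noteq> 0"
    and top: "\<And>x. x \<in> D \<Longrightarrow> (\<psi> x, x) \<in> U \<Longrightarrow> 0 \<noteq> 1 - (norm (grad \<psi> x))\<^sup>2 \<and>
        1 - (norm (grad \<psi> x))\<^sup>2 = (- real m + 1) ^ m * a ^ m / real m ^ (m - 1)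
            * hom_part c (m + 1) (\<psi> x, x) (- 1, grad \<psi> x)"
  shows "fuchsian tdir m (a * ((real m - 1) / real m)) (\<lambda>z. 1 - (norm (grad \<psi> (snd z)))\<^sup>2)
    (\<lambda>z. laplacian \<psi> (snd z)) (\<lambda>z. (1, - grad \<psi> (snd z)))
    (\<lambda>\<alpha> z. fst z ^ (m + 1 - deg \<alpha>) * c (expo \<alpha>) (\<psi> (snd z) + fst z ^ m, snd z))
    {p. fst p = 0 \<and> snd p \<in> D \<and> (\<psi> (snd p), snd p) \<in> U}"
    (is "fuchsian _ _ ?g ?A ?lap ?q ?K ?Z")
proof
  show "tdir \<in> Basis" "2 \<le> m" by (simp_all add: m)
  show "?g \<noteq> 0" using m a by simp
  fix p assume p: "p \<in> ?Z"
  then have x: "snd p \<in> D" "(\<psi> (snd p), snd p) \<in> U" and p0: "fst p = 0" by auto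
  have psi_p: "analytic_at (\<lambda>z. \<psi> (snd z)) p" by (rule analytic_at_comp_snd[OF \<psi>[OF x(1)]])
  have d1: "analytic_at (\<lambda>z. partial i \<psi> (snd z)) p" for i
    by (rule analytic_at_comp_snd[OF analytic_at_partial[OF \<psi>[OF x(1)]]])
  have d2: "analytic_at (\<lambda>z. partial i (partial i \<psi>) (snd z)) p" for i
    by (rule analytic_at_comp_snd[OF analytic_at_partial[OF analytic_at_partial[OF \<psi>[OF x(1)]]]])
  show "p \<bullet> tdir = 0" using p0 by (simp add: inner_prod_def)
  show "\<forall>\<^sub>F p' in nhds p. p' \<bullet> tdir = 0 \<longrightarrow> p' \<in> ?Z"
  proof -
    have "((\<lambda>z. (\<psi> (snd z), snd z)) \<longlongrightarrow> (\<psi> (snd p), snd p)) (nhds p)"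
      using analytic_at_isCont[OF psi_p, unfolded isCont_def, THEN tendsto_at_iff_tendsto_nhds[THEN iffD1]]
      by (intro tendsto_Pair tendsto_snd filterlim_ident)
    from topological_tendstoD[OF this U x(2)] topological_tendstoD[OF tendsto_snd[OF filterlim_ident] D x(1)]
    show ?thesis by eventually_elim (auto simp: inner_prod_def)
  qed
  have nrm: "(norm (grad \<psi> y))\<^sup>2 = (\<Sum>i\<in>UNIV. (partial i \<psi> y)\<^sup>2)" for y
    unfolding power2_norm_eq_inner by (simp add: inner_vec_def grad_def power2_eq_square)
  show "analytic_at ?A p"
    unfolding nrm by (intro analytic_at_diff analytic_at_const analytic_at_sum analytic_at_power d1)
  show "analytic_at ?lap p"
    unfolding laplacian_def by (intro analytic_at_sum d2)
  show "analytic_at (\<lambda>z. ?q z \<bullet> b) p" if "b \<in> Basis" for b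
  proof -
    from that consider "b = tdir" | i where "b = xdir i" by (auto simp: Basis_tx)
    then show ?thesis
    proof cases
      case (2 i)
      then show ?thesis using analytic_at_minus[OF d1[of i]]
        by (simp add: inner_prod_def grad_def inner_axis)
    qed (simp add: inner_prod_def)
  qed
  show "analytic_at (?K \<alpha>) p" if \<alpha>: "deg \<alpha> \<le> m + 1" for \<alpha>
  proof (intro analytic_at_mult analytic_at_power analytic_at_fst)
    have "(\<psi> (snd p) + fst p ^ m, snd p) \<in> U" using x(2) p0 m by (simp add: zero_power)
    then show "analytic_at (\<lambda>z. c (expo \<alpha>) (\<psi> (snd z) + fst z ^ m, snd z)) p"
    proof (rule analytic_at_compose[where H = "\<lambda>z. (\<psi> (snd z) + fst z ^ m, snd z)" and g = "c (expo \<alpha>)", OF c[OF \<alpha>]])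
      fix b :: "real \<times> (real ^ 'n)" assume b: "b \<in> Basis"
      then consider "b = tdir" | i where "b = xdir i" by (auto simp: Basis_tx)
      then show "analytic_at (\<lambda>z. (\<psi> (snd z) + fst z ^ m, snd z) \<bullet> b) p"
      proof cases
        case 1
        have "analytic_at (\<lambda>z. \<psi> (snd z) + fst z ^ m) p"
          by (intro analytic_at_add analytic_at_power analytic_at_fst psi_p)
        then show ?thesis by (simp add: 1 inner_prod_def)
      next
        case (2 i)
        then show ?thesis using analytic_at_coord[OF b, of p] by (simp add: inner_prod_def)
      qed
    qed
  qed
  show "?A p \<noteq> 0" using conjunct1[OF top[OF x]] by simp
  show "?K \<alpha> p = 0" if "deg \<alpha> \<le> m" for \<alpha>
    using that p0 by (simp add: Suc_diff_le)
  show "(\<Sum>\<alpha> | deg \<alpha> = m + 1. ?K \<alpha> p * mpow (\<lambda>b. ?q p \<bullet> b) \<alpha>) = - ?A p / (real m * ?g ^ m)"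
  proof -
    let ?H = "hom_part c (m + 1) (\<psi> (snd p), snd p) (- 1, grad \<psi> (snd p))"
    have "(\<Sum>\<alpha> | deg \<alpha> = m + 1. ?K \<alpha> p * mpow (\<lambda>b. ?q p \<bullet> b) \<alpha>)
        = (\<Sum>\<alpha> | deg \<alpha> = m + 1. (- 1) ^ (m + 1) *
            (c (expo \<alpha>) (\<psi> (snd p), snd p) * mpow (\<lambda>b. (- 1, grad \<psi> (snd p)) \<bullet> b) \<alpha>))"
    proof (rule sum.cong)
      fix \<alpha> :: "(real \<times> (real ^ 'n)) mindex" assume \<alpha>: "\<alpha> \<in> {\<alpha>. deg \<alpha> = m + 1}"
      have "mpow (\<lambda>b. ?q p \<bullet> b) \<alpha> = mpow (\<lambda>b. - 1 * ((- 1, grad \<psi> (snd p)) \<bullet> b)) \<alpha>"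
        by (rule mpow_cong) (simp add: inner_prod_def)
      also have "\<dots> = (- 1) ^ (m + 1) * mpow (\<lambda>b. (- 1, grad \<psi> (snd p)) \<bullet> b) \<alpha>"
        using \<alpha> unfolding mpow_mult mpow_const by simp
      finally show "?K \<alpha> p * mpow (\<lambda>b. ?q p \<bullet> b) \<alpha> = (- 1) ^ (m + 1) *
          (c (expo \<alpha>) (\<psi> (snd p), snd p) * mpow (\<lambda>b. (- 1, grad \<psi> (snd p)) \<bullet> b) \<alpha>)"
        using \<alpha> p0 m by (simp add: zero_power)
    qed simp
    also have "\<dots> = (- 1) ^ (m + 1) * ?H" by (simp only: sum_distrib_left hom_part_mindex)
    also have "\<dots> = - ?A p / (real m * ?g ^ m)"
    proof -
      have "real m ^ m = real m * real m ^ (m - 1)" using m by (cases m) auto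
      moreover have "(- real m + 1) ^ m = (- 1) ^ m * (real m - 1) ^ m"
        by (simp flip: power_mult_distrib)
      moreover have "?A p = (- real m + 1) ^ m * a ^ m / real m ^ (m - 1) * ?H" using top[OF x] by blast
      moreover have "(real m - 1) ^ m \<noteq> 0" "a ^ m \<noteq> 0" "real m ^ (m - 1) \<noteq> 0" using m a by auto
      ultimately show ?thesis
        using m by (simp add: power_mult_distrib power_divide)
    qed
    finally show ?thesis .
  qed
qed

theorem theorem8p1:
  fixes m :: nat
    and U :: "(real \<times> (real ^ 'n)) set"
    and D :: "(real ^ 'n) set"
    and f :: "real \<times> (real ^ 'n) \<Rightarrow> real \<times> (real ^ 'n) \<Rightarrow> real"
    and c :: "(real \<times> (real ^ 'n) \<Rightarrow> nat) \<Rightarrow> real \<times> (real ^ 'n) \<Rightarrow> real"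
    and \<psi> :: "real ^ 'n \<Rightarrow> real"
    and \<Sigma> :: "(real \<times> (real ^ 'n)) set"
    and a :: real
  assumes m: "m \<ge> 2"
    and U: "open U"
    and coeffs: "\<And>\<alpha>. \<alpha> \<in> multi_indices \<Longrightarrow> mi_order \<alpha> \<le> m + 1 \<Longrightarrow> real_analytic_on (c \<alpha>) U"
    and deg: "\<exists>\<alpha>\<in>multi_indices. mi_order \<alpha> = m + 1 \<and> (\<exists>p\<in>U. c \<alpha> p \<noteq> 0)"
    and f: "\<And>p \<zeta>. p \<in> U \<Longrightarrow> f p \<zeta> = (\<Sum>l\<le>m + 1. hom_part c l p \<zeta>)"
    and D: "open D"
    and \<psi>: "real_analytic_on \<psi> D"
    and \<Sigma>: "\<Sigma> = {(t, x). (t, x) \<in> U \<and> x \<in> D \<and> t = \<psi> x}"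
    and a: "a \<noteq> 0"
    and top: "\<And>x. x \<in> D \<Longrightarrow> (\<psi> x, x) \<in> U \<Longrightarrow>
        0 \<noteq> 1 - (norm (grad \<psi> x))\<^sup>2 \<and>
        1 - (norm (grad \<psi> x))\<^sup>2 =
          (- real m + 1) ^ m * a ^ m / real m ^ (m - 1)
            * hom_part c (m + 1) (\<psi> x, x) (- 1, grad \<psi> x)"
    and sub: "\<And>x. x \<in> D \<Longrightarrow> (\<psi> x, x) \<in> U \<Longrightarrow> hom_part c m (\<psi> x, x) (- 1, grad \<psi> x) = 0"
  shows "\<exists>\<Omega> u. open \<Omega> \<and> \<Sigma> \<subseteq> \<Omega> \<and> \<Omega> \<subseteq> U \<and> snd ` \<Omega> \<subseteq> D \<and>
      real_analytic_on u (above \<psi> \<Omega>) \<and>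
      (\<forall>(t, x) \<in> above \<psi> \<Omega>.
         (deriv ^^ 2) (\<lambda>s. u (s, x)) t - laplacian (\<lambda>y. u (t, y)) x
           = f (t, x) (deriv (\<lambda>s. u (s, x)) t, grad (\<lambda>y. u (t, y)) x)) \<and>
      (\<forall>p\<in>\<Sigma>.
         u \<sim>[at p within above \<psi> \<Omega>]
           (\<lambda>(t, x). a * (t - \<psi> x) powr ((real m - 1) / real m)) \<and>
         (\<lambda>(t, x). deriv (\<lambda>s. u (s, x)) t) \<sim>[at p within above \<psi> \<Omega>]
           (\<lambda>(t, x). a * ((real m - 1) / real m) * (t - \<psi> x) powr (- 1 / real m)) \<and>
         (u \<longlongrightarrow> 0) (at p within above \<psi> \<Omega>) \<and>
         filterlim (\<lambda>(t, x). deriv (\<lambda>s. u (s, x)) t) at_infinity (at p within above \<psi> \<Omega>)) \<and>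
      (\<exists>F W. open W \<and> {(0, x) | x. (\<psi> x, x) \<in> \<Sigma>} \<subseteq> W \<and> real_analytic_on F W \<and>
         (\<forall>(t, x) \<in> above \<psi> \<Omega>.
            ((t - \<psi> x) powr (1 / real m), x) \<in> W \<and>
            u (t, x) = F ((t - \<psi> x) powr (1 / real m), x)))"
proof -
  have psi_an: "analytic_at \<psi> x" if "x \<in> D" for x
    using \<psi> that by (simp add: real_analytic_on_iff_analytic_at)
  have c_an: "analytic_at (c (expo \<alpha>)) p" if "deg \<alpha> \<le> m + 1" "p \<in> U" for \<alpha> p
    using coeffs[of "expo \<alpha>"] that expo[of \<alpha>]
    by (simp add: real_analytic_on_iff_analytic_at mi_order_def deg_def)
  define Z :: "(real \<times> (real ^ 'n)) set" where "Z = {p. fst p = 0 \<and> snd p \<in> D \<and> (\<psi> (snd p), snd p) \<in> U}"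
  interpret E: fuchsian tdir m "a * ((real m - 1) / real m)" "\<lambda>z. 1 - (norm (grad \<psi> (snd z)))\<^sup>2"
    "\<lambda>z. laplacian \<psi> (snd z)" "\<lambda>z. (1, - grad \<psi> (snd z))"
    "\<lambda>\<alpha> z. fst z ^ (m + 1 - deg \<alpha>) * c (expo \<alpha>) (\<psi> (snd z) + fst z ^ m, snd z)" Z
    unfolding Z_def by (rule equation_is_fuchsian[OF m U D c_an psi_an a top])
  obtain Y W where W: "open W" "Z \<subseteq> W" and Y: "\<And>z. z \<in> W \<Longrightarrow> analytic_at Y z \<and> E.Res Y z = 0"
    and Y0: "\<And>z. z \<in> Z \<Longrightarrow> Y z = 0" using E.global_solution by blast
  interpret p: profile m a \<psi> D W Y
    by standard (use m D psi_an W Y in auto)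
  have G_eq: "E.Gam Y = p.G"
    by (simp add: fun_eq_iff E.Gam_def p.G_def inner_prod_def)
  \<comment> \<open>The absolute value extends the condition on \<open>s\<close> continuously across \<open>t = \<psi> x\<close>, so that the set is open and contains \<open>\<Sigma>\<close>.\<close>
  define \<Omega> where "\<Omega> = (U \<inter> {z. snd z \<in> D}) \<inter> (\<lambda>z. (root m \<bar>fst z - \<psi> (snd z)\<bar>, snd z)) -` W"
  have "open \<Omega>"
    unfolding \<Omega>_def
    by (intro continuous_open_preimage open_Int U p.open_snd_D W(1) continuous_intros
        continuous_on_subset[OF p.psi_cont]) auto
  have root: "root m \<bar>t - \<psi> x\<bar> = p.S t x" if "\<psi> x < t" for t x
    using that m by (simp add: p.S_def root_powr_inverse)
  have above_T: "(t, x) \<in> U \<and> (t, x) \<in> p.T" if "(t, x) \<in> above \<psi> \<Omega>" for t x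
    using that root[of x t] by (auto simp: above_def \<Omega>_def p.T_def)
  have \<Sigma>_Z: "(0, x) \<in> Z" if "(t, x) \<in> \<Sigma>" for t x
    using that by (auto simp: \<Sigma> Z_def)
  have \<Sigma>_\<Omega>: "\<Sigma> \<subseteq> \<Omega>"
    using \<Sigma>_Z m by (auto simp: \<Omega>_def \<Sigma> intro!: subsetD[OF W(2)])
  have F_an: "analytic_at p.F z" if "z \<in> W" for z by (rule p.F_an[OF that])
  have u_an: "analytic_at p.u (t, x)" if "(t, x) \<in> above \<psi> \<Omega>" for t x
  proof -
    have tx: "x \<in> D" "\<psi> x < t" "(p.S t x, x) \<in> W" using above_T[OF that] by (auto simp: p.T_def)
    define H where "H z = ((fst z - \<psi> (snd z)) powr (1 / real m), snd z)" for z :: "real \<times> (real ^ 'n)"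
    have "analytic_at (\<lambda>z. p.F (H z)) (t, x)"
    proof (rule analytic_at_compose[where H = H and g = p.F])
      show "analytic_at p.F (H (t, x))" using F_an[OF tx(3)] by (simp add: H_def p.S_def)
      fix b :: "real \<times> (real ^ 'n)" assume b: "b \<in> Basis"
      then consider "b = tdir" | i where "b = xdir i" by (auto simp: Basis_tx)
      then show "analytic_at (\<lambda>z. H z \<bullet> b) (t, x)"
      proof cases
        case 1
        have "analytic_at (\<lambda>z. (fst z - \<psi> (snd z)) powr (1 / real m)) (t, x)"
          by (intro analytic_at_powr analytic_at_diff analytic_at_fst analytic_at_comp_snd)
            (use tx psi_an in simp_all)
        then show ?thesis by (simp add: 1 H_def inner_prod_def)
      next
        case (2 i)
        then show ?thesis using analytic_at_coord[OF b, of "(t, x)"] by (simp add: H_def inner_prod_def)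
      qed
    qed
    moreover have "(\<lambda>z. p.F (H z)) = p.u" by (simp add: fun_eq_iff H_def p.u_def p.S_def)
    ultimately show ?thesis by simp
  qed
  have pde: "(deriv ^^ 2) (\<lambda>s. p.u (s, x)) t - laplacian (\<lambda>y. p.u (t, y)) x
      = f (t, x) (deriv (\<lambda>s. p.u (s, x)) t, grad (\<lambda>y. p.u (t, y)) x)"
    if tx: "(t, x) \<in> above \<psi> \<Omega>" for t x
  proof -
    have T: "(t, x) \<in> p.T" and inU: "(t, x) \<in> U" using above_T[OF tx] by auto
    then have z: "(p.S t x, x) \<in> W" "x \<in> D" and t: "\<psi> x < t" by (auto simp: p.T_def)
    define s where "s = p.S t x"
    have s: "s > 0" using p.S_pos[OF t] by (simp add: s_def)
    have sm: "\<psi> x + s ^ m = t" using p.S_power[OF t] by (simp add: s_def)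
    define \<xi> where "\<xi> = (deriv (\<lambda>s. p.u (s, x)) t, grad (\<lambda>y. p.u (t, y)) x)"
    have P: "s * p.P (s, x) = p.g0 + p.G (s, x)" using p.P_eq[of "(s, x)"] s by simp
    have sF: "s * dir_deriv (xdir i) p.F (s, x) = s ^ m * dir_deriv (xdir i) Y (s, x)" for i
      using p.dir_deriv_x_F(1)[OF z(1)] m by (cases m) (simp_all add: s_def)
    \<comment> \<open>Multiplication by \<open>s\<close> removes the singularity of the gradient.\<close>
    have zeta: "s * (\<xi> \<bullet> b) = E.zeta Y (s, x) b" if "b \<in> Basis" for b
    proof -
      from that consider "b = tdir" | i where "b = xdir i" by (auto simp: Basis_tx)
      then show ?thesis
      proof cases
        case 1
        then show ?thesis using P p.u_t[OF T] unfolding E.zeta_def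
          by (simp add: \<xi>_def inner_prod_def G_eq p.g0_def flip: s_def)
      next
        case (2 i)
        have "s * partial i (\<lambda>y. p.u (t, y)) x
            = s ^ m * dir_deriv (xdir i) Y (s, x) - partial i \<psi> x * (p.g0 + p.G (s, x))"
          unfolding p.u_x[OF T] s_def[symmetric] right_diff_distrib sF P[symmetric] by simp
        then show ?thesis unfolding E.zeta_def
          by (simp add: 2 \<xi>_def inner_prod_def G_eq p.g0_def grad_def inner_axis)
      qed
    qed
    have "s ^ (m + 1) * f (t, x) \<xi>
        = (\<Sum>\<alpha> | deg \<alpha> \<le> m + 1. s ^ (m + 1 - deg \<alpha>) * c (expo \<alpha>) (t, x) * mpow (E.zeta Y (s, x)) \<alpha>)"
      unfolding f[OF inU] sum_hom_part sum_distrib_left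
    proof (rule sum.cong)
      fix \<alpha> :: "(real \<times> (real ^ 'n)) mindex" assume "\<alpha> \<in> {\<alpha>. deg \<alpha> \<le> m + 1}"
      then have "s ^ (m + 1) = s ^ (m + 1 - deg \<alpha>) * s ^ deg \<alpha>" by (simp flip: power_add)
      moreover have "mpow (E.zeta Y (s, x)) \<alpha> = mpow (\<lambda>b. s * (\<xi> \<bullet> b)) \<alpha>"
        by (rule mpow_cong) (simp add: zeta)
      ultimately show "s ^ (m + 1) * (c (expo \<alpha>) (t, x) * mpow (\<lambda>b. \<xi> \<bullet> b) \<alpha>)
          = s ^ (m + 1 - deg \<alpha>) * c (expo \<alpha>) (t, x) * mpow (E.zeta Y (s, x)) \<alpha>"
        unfolding mpow_mult mpow_const by simp
    qed simp
    also have "\<dots> = (1 - (norm (grad \<psi> x))\<^sup>2) / real m * (s * dir_deriv tdir p.G (s, x) - p.G (s, x) - p.g0)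
      + s ^ m * laplacian \<psi> x * (p.g0 + p.G (s, x))
      + 2 * (\<Sum>i\<in>UNIV. partial i \<psi> x * (s ^ m * dir_deriv (xdir i) p.G (s, x)))
      - (\<Sum>i\<in>UNIV. s ^ (2 * m) * dir_deriv (xdir i) (dir_deriv (xdir i) Y) (s, x))"
    proof -
      have "E.Res Y (s, x) = 0" using Y[OF z(1)] by (simp add: s_def)
      note this[unfolded E.Res_def sum_xdir G_eq]
      then show ?thesis
        by (simp add: inner_prod_def sm sum_negf grad_def inner_axis p.g0_def)
    qed
    also have "\<dots> = s ^ (m + 1) * ((deriv ^^ 2) (\<lambda>s. p.u (s, x)) t - laplacian (\<lambda>y. p.u (t, y)) x)"
      unfolding s_def by (rule p.wave_operator[OF T, symmetric])
    finally show ?thesis using s by (simp add: \<xi>_def)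
  qed
  have asym: "p.u \<sim>[at q within above \<psi> \<Omega>]
         (\<lambda>(t, x). a * (t - \<psi> x) powr ((real m - 1) / real m)) \<and>
       (\<lambda>(t, x). deriv (\<lambda>s. p.u (s, x)) t) \<sim>[at q within above \<psi> \<Omega>]
         (\<lambda>(t, x). a * ((real m - 1) / real m) * (t - \<psi> x) powr (- 1 / real m)) \<and>
       (p.u \<longlongrightarrow> 0) (at q within above \<psi> \<Omega>) \<and>
       filterlim (\<lambda>(t, x). deriv (\<lambda>s. p.u (s, x)) t) at_infinity (at q within above \<psi> \<Omega>)"
    if q: "q \<in> \<Sigma>" for q
  proof -
    obtain t0 x0 where q_eq: "q = (t0, x0)" by (cases q)
    let ?L = "at q within above \<psi> \<Omega>"
    have z0: "(0, x0) \<in> Z" using \<Sigma>_Z q by (simp add: q_eq)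
    have x0: "x0 \<in> D" "t0 = \<psi> x0" using q by (auto simp: \<Sigma> q_eq)
    \<comment> \<open>All limits are limits of analytic functions of \<open>(s, x)\<close> at the point \<open>(0, x0)\<close>.\<close>
    define h where "h = (\<lambda>z. (p.S (fst z) (snd z), snd z))"
    have S0: "((\<lambda>z. p.S (fst z) (snd z)) \<longlongrightarrow> 0) ?L"
    proof -
      have "continuous_on {z. snd z \<in> D} (\<lambda>z. root m \<bar>fst z - \<psi> (snd z)\<bar>)"
        by (intro continuous_intros p.psi_cont)
      then have "((\<lambda>z. root m \<bar>fst z - \<psi> (snd z)\<bar>) \<longlongrightarrow> root m \<bar>fst q - \<psi> (snd q)\<bar>) (at q within {z. snd z \<in> D})"
        unfolding continuous_on_def by (rule bspec) (use x0 in \<open>simp add: q_eq\<close>)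
      then have "((\<lambda>z. root m \<bar>fst z - \<psi> (snd z)\<bar>) \<longlongrightarrow> root m \<bar>fst q - \<psi> (snd q)\<bar>) ?L"
        by (rule tendsto_within_subset) (auto simp: above_def \<Omega>_def)
      then have "((\<lambda>z. root m \<bar>fst z - \<psi> (snd z)\<bar>) \<longlongrightarrow> 0) ?L" using m by (simp add: q_eq x0)
      then show ?thesis
        by (rule Lim_transform_eventually)
          (use m in \<open>auto simp: eventually_at_filter above_def p.S_def root_powr_inverse intro!: always_eventually\<close>)
    qed
    have h: "(h \<longlongrightarrow> (0, x0)) ?L"
      unfolding h_def using tendsto_snd[OF tendsto_ident_at[of q "above \<psi> \<Omega>"]]
      by (intro tendsto_Pair S0) (simp add: q_eq)
    have lim: "((\<lambda>z. g (h z)) \<longlongrightarrow> g (0, x0)) ?L" if "analytic_at g (0, x0)" for g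
      by (rule isCont_tendsto_compose[OF analytic_at_isCont[OF that] h])
    have inW: "(0, x0) \<in> W" using z0 W(2) by blast
    have Ylim: "((\<lambda>z. Y (h z)) \<longlongrightarrow> 0) ?L"
      using lim[of Y] Y[OF inW] Y0[OF z0] by simp
    have Glim: "((\<lambda>z. p.G (h z)) \<longlongrightarrow> 0) ?L"
      using lim[OF p.G_an[OF inW]] Y0[OF z0] by (simp add: p.G_def)
    have g0: "p.g0 \<noteq> 0" using a m by (simp add: p.g0_def)
    have ev: "\<forall>\<^sub>F z in ?L. z \<in> above \<psi> \<Omega>" by (simp add: eventually_at_filter)
    have u_eq: "p.u z = p.S (fst z) (snd z) ^ (m - 1) * (a + Y (h z))" for z
      by (simp add: p.u_def p.F_def h_def case_prod_unfold)
    have ut_eq: "deriv (\<lambda>s. p.u (s, snd z)) (fst z) = (p.g0 + p.G (h z)) / p.S (fst z) (snd z)"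
      if "z \<in> above \<psi> \<Omega>" for z
    proof -
      have T: "(fst z, snd z) \<in> p.T" using above_T[of "fst z" "snd z"] that by simp
      then have "p.S (fst z) (snd z) > 0" by (intro p.S_pos) (auto simp: p.T_def)
      then show ?thesis unfolding p.u_t[OF T] h_def by (subst p.P_eq) auto
    qed
    have S_pos: "p.S (fst z) (snd z) > 0" if "z \<in> above \<psi> \<Omega>" for z
      using that by (intro p.S_pos) (auto simp: above_def)
    have S_powr: "(fst z - \<psi> (snd z)) powr ((real m - 1) / real m) = p.S (fst z) (snd z) ^ (m - 1)"
      "(fst z - \<psi> (snd z)) powr (- 1 / real m) = 1 / p.S (fst z) (snd z)" if "z \<in> above \<psi> \<Omega>" for z
    proof -
      have pos: "fst z - \<psi> (snd z) > 0" using that by (auto simp: above_def)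
      have "(fst z - \<psi> (snd z)) powr ((real m - 1) / real m)
          = ((fst z - \<psi> (snd z)) powr (1 / real m)) powr real (m - 1)"
        using m by (simp add: powr_powr of_nat_diff)
      then show "(fst z - \<psi> (snd z)) powr ((real m - 1) / real m) = p.S (fst z) (snd z) ^ (m - 1)"
        using pos by (simp add: p.S_def powr_realpow)
      show "(fst z - \<psi> (snd z)) powr (- 1 / real m) = 1 / p.S (fst z) (snd z)"
        by (simp add: p.S_def powr_minus_divide)
    qed
    have "((\<lambda>z. (a + Y (h z)) / a) \<longlongrightarrow> (a + 0) / a) ?L"
      by (intro tendsto_intros Ylim a)
    then have lim1: "((\<lambda>z. (a + Y (h z)) / a) \<longlongrightarrow> 1) ?L" using a by simp
    have A1: "p.u \<sim>[?L] (\<lambda>(t, x). a * (t - \<psi> x) powr ((real m - 1) / real m))"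
    proof (rule asymp_equivI', rule Lim_transform_eventually[OF lim1])
      show "\<forall>\<^sub>F z in ?L. (a + Y (h z)) / a
          = p.u z / (case z of (t, x) \<Rightarrow> a * (t - \<psi> x) powr ((real m - 1) / real m))"
        using ev by eventually_elim (use S_pos S_powr in \<open>force simp: u_eq case_prod_unfold\<close>)
    qed
    have "((\<lambda>z. (p.g0 + p.G (h z)) / p.g0) \<longlongrightarrow> (p.g0 + 0) / p.g0) ?L"
      by (intro tendsto_intros Glim g0)
    then have lim2: "((\<lambda>z. (p.g0 + p.G (h z)) / p.g0) \<longlongrightarrow> 1) ?L" using g0 by simp
    have A2: "(\<lambda>(t, x). deriv (\<lambda>s. p.u (s, x)) t) \<sim>[?L]
         (\<lambda>(t, x). a * ((real m - 1) / real m) * (t - \<psi> x) powr (- 1 / real m))"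
    proof (rule asymp_equivI', rule Lim_transform_eventually[OF lim2])
      show "\<forall>\<^sub>F z in ?L. (p.g0 + p.G (h z)) / p.g0
          = (case z of (t, x) \<Rightarrow> deriv (\<lambda>s. p.u (s, x)) t)
            / (case z of (t, x) \<Rightarrow> a * ((real m - 1) / real m) * (t - \<psi> x) powr (- 1 / real m))"
        using ev
      proof eventually_elim
        case (elim z)
        then show ?case
          unfolding case_prod_unfold ut_eq[OF elim] S_powr(2)[OF elim] p.g0_def[symmetric]
          using S_pos[OF elim] by simp
      qed
    qed
    have "((\<lambda>z. p.S (fst z) (snd z) ^ (m - 1) * (a + Y (h z))) \<longlongrightarrow> 0 ^ (m - 1) * (a + 0)) ?L"
      by (intro tendsto_intros S0 Ylim)
    then have A3: "(p.u \<longlongrightarrow> 0) ?L" using m by (simp add: u_eq[abs_def] zero_power)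
    have "((\<lambda>z. p.S (fst z) (snd z) / (p.g0 + p.G (h z))) \<longlongrightarrow> 0 / (p.g0 + 0)) ?L"
      by (intro tendsto_intros S0 Glim) (use g0 in simp)
    moreover have "\<forall>\<^sub>F z in ?L. p.g0 + p.G (h z) \<noteq> 0"
      using tendsto_imp_eventually_ne[OF tendsto_add[OF tendsto_const[of p.g0] Glim], of 0] g0 by simp
    then have "\<forall>\<^sub>F z in ?L. p.S (fst z) (snd z) / (p.g0 + p.G (h z)) \<noteq> 0"
      using ev by eventually_elim (use S_pos in force)
    ultimately have "filterlim (\<lambda>z. p.S (fst z) (snd z) / (p.g0 + p.G (h z))) (at 0) ?L"
      by (simp add: filterlim_at)
    then have "filterlim (\<lambda>z. (p.g0 + p.G (h z)) / p.S (fst z) (snd z)) at_infinity ?L"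
      by (subst filterlim_inverse_at_iff[symmetric]) (simp add: inverse_eq_divide)
    then have A4: "filterlim (\<lambda>(t, x). deriv (\<lambda>s. p.u (s, x)) t) at_infinity ?L"
      by (rule filterlim_mono_eventually[OF _ order_refl order_refl])
        (use ev in eventually_elim, simp add: ut_eq case_prod_unfold)
    from A1 A2 A3 A4 show ?thesis by blast
  qed
  have prof: "\<exists>F W. open W \<and> {(0, x) | x. (\<psi> x, x) \<in> \<Sigma>} \<subseteq> W \<and> real_analytic_on F W \<and>
         (\<forall>(t, x) \<in> above \<psi> \<Omega>.
            ((t - \<psi> x) powr (1 / real m), x) \<in> W \<and>
            p.u (t, x) = F ((t - \<psi> x) powr (1 / real m), x))"
  proof (intro exI[of _ p.F] exI[of _ W] conjI W(1))
    show "{(0, x) | x. (\<psi> x, x) \<in> \<Sigma>} \<subseteq> W" using \<Sigma>_Z W(2) by blast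
    show "real_analytic_on p.F W" using F_an by (simp add: real_analytic_on_iff_analytic_at)
    show "\<forall>(t, x) \<in> above \<psi> \<Omega>. ((t - \<psi> x) powr (1 / real m), x) \<in> W \<and>
            p.u (t, x) = p.F ((t - \<psi> x) powr (1 / real m), x)"
      using above_T by (auto simp: p.T_def p.S_def p.u_def)
  qed
  show ?thesis
  proof (rule exI[of _ \<Omega>], rule exI[of _ p.u], intro conjI)
    show "open \<Omega>" "\<Sigma> \<subseteq> \<Omega>" "\<Omega> \<subseteq> U" "snd ` \<Omega> \<subseteq> D"
      using \<open>open \<Omega>\<close> \<Sigma>_\<Omega> by (auto simp: \<Omega>_def)
    show "real_analytic_on p.u (above \<psi> \<Omega>)"
      unfolding real_analytic_on_iff_analytic_at using u_an by auto
    show "\<forall>(t, x) \<in> above \<psi> \<Omega>. (deriv ^^ 2) (\<lambda>s. p.u (s, x)) t - laplacian (\<lambda>y. p.u (t, y)) x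
           = f (t, x) (deriv (\<lambda>s. p.u (s, x)) t, grad (\<lambda>y. p.u (t, y)) x)"
      using pde by blast
  qed (rule ballI, erule asym, rule prof)
qed

end
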